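(* Let $n\ge 2$ and let $\Omega\subset\mathbb{S}^n$ be a domain with $\mathbb{S}^n\setminus\overline{\Omega}\neq\emptyset$ whose boundary $\partial\Omega$ is of class $C^{2,\alpha}$ for some $0<\alpha<1$. Set $\Omega^+:=\Omega$, $\Omega^-:=\mathbb{S}^n\setminus\overline{\Omega}$ and $\gamma:=|\Omega^+|/|\Omega^-|$. Assume that $\partial\Omega$ is contained in an open hemisphere of $\mathbb{S}^n$ and that there exists a solution $u\in C^1(\mathbb{S}^n)$ to the overdetermined problem $$-\Delta u=\mathcal{X}_{\Omega^+}-\gamma\,\mathcal{X}_{\Omega^-}\ \text{ in } \mathbb{S}^n,\qquad u=0\ \text{ on }\partial\Omega .$$ Then $\Omega$ is a geodesic ball.
   Context: $\mathbb{S}^n$ is the round unit $n$-sphere, $\Delta$ its Laplace--Beltrami operator, $|\cdot|$ the Riemannian volume, and $\mathcal{X}_A$ the characteristic function of a set $A$. A domain is a connected open set. The equation is understood in the weak sense on $\mathbb{S}^n$. Equivalently, the restrictions $u^\pm$ of $u$ to $\overline{\Omega^\pm}$ satisfy $-\Delta u^+=1$ in $\Omega^+$, $-\Delta u^-=-\gamma$ in $\Omega^-$, $u^\pm=0$ on $\partial\Omega$, and $\nabla u^+=\nabla u^-$ on $\partial\Omega$. *)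

theory Defs
  imports "HOL-Analysis.Analysis"
begin

text \<open>
  The unit sphere of dimension \<open>n\<close> is \<open>sphere 0 1\<close> in a Euclidean space of dimension \<open>n + 1\<close>,
  with the metric induced by the inner product. Functions on the sphere are represented by
  functions on the ambient space whose values off the sphere are never used.
\<close>

text \<open>
  The Riemannian volume of the unit sphere is the measure \<open>\<sigma>\<close> of polar integration, that is
  \<open>dx = r ^ n dr d\<sigma>\<close>. Hence \<open>\<sigma> A\<close> is \<open>n + 1\<close> times the Lebesgue measure of the
  part of the unit ball that radial projection maps into \<open>A\<close>.
\<close>

definition sphere_measure :: "'a::euclidean_space measure" where
  "sphere_measure =
     scale_measure (of_nat DIM('a))
       (distr (restrict_space lborel (cball 0 1 - {0})) (restrict_space borel (sphere 0 1))
          (\<lambda>x. x /\<^sub>R norm x))"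

lemma space_sphere_measure [simp]: "space (sphere_measure :: 'a::euclidean_space measure) = sphere 0 1"
  by (simp add: sphere_measure_def space_scale_measure space_restrict_space)

lemma sets_sphere_measure [measurable_cong]:
  "sets (sphere_measure :: 'a::euclidean_space measure) = sets (restrict_space borel (sphere 0 1))"
  by (simp add: sphere_measure_def)

lemma radial_projection_measurable:
  "(\<lambda>x::'a::euclidean_space. x /\<^sub>R norm x) \<in>
     restrict_space lborel (cball 0 1 - {0}) \<rightarrow>\<^sub>M restrict_space borel (sphere 0 1)"
proof (rule measurable_restrict_space2)
  show "(\<lambda>x::'a. x /\<^sub>R norm x) \<in>
      space (restrict_space lborel (cball 0 1 - {0})) \<rightarrow> sphere 0 1"
    by (auto simp: space_restrict_space)
  have "(\<lambda>x::'a. x /\<^sub>R norm x) \<in> borel_measurable lborel"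
    by measurable
  then show "(\<lambda>x::'a. x /\<^sub>R norm x) \<in>
      borel_measurable (restrict_space lborel (cball 0 1 - {0}))"
    by (rule measurable_restrict_space1)
qed

lemma emeasure_sphere_measure:
  assumes "A \<in> sets borel" "A \<subseteq> sphere (0::'a::euclidean_space) 1"
  shows "emeasure sphere_measure A =
           of_nat DIM('a) * emeasure lborel {x \<in> cball 0 1 - {0}. x /\<^sub>R norm x \<in> A}"
proof -
  have A: "A \<in> sets (restrict_space borel (sphere 0 1))"
    using assms by (auto simp: sets_restrict_space)
  have pre: "(\<lambda>x::'a. x /\<^sub>R norm x) -` A \<inter> (cball 0 1 - {0}) =
          {x \<in> cball 0 1 - {0}. x /\<^sub>R norm x \<in> A}"
    by auto
  have "emeasure (restrict_space lborel (cball 0 1 - {0})) {x::'a \<in> cball 0 1 - {0}. x /\<^sub>R norm x \<in> A} =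
          emeasure lborel {x \<in> cball 0 1 - {0}. x /\<^sub>R norm x \<in> A}"
    by (rule emeasure_restrict_space) auto
  then show ?thesis
    unfolding sphere_measure_def emeasure_scale_measure
      emeasure_distr[OF radial_projection_measurable A]
    by (simp only: space_restrict_space space_lborel space_borel Int_UNIV_right pre)
qed

text \<open>
  The derivative within the sphere only determines the action on tangent vectors at \<open>x\<close>.
  Requiring \<open>g \<bullet> x = 0\<close> makes \<open>g\<close> the unique tangent vector that represents the differential.
\<close>

definition has_sphere_gradient ::
    "('a::euclidean_space \<Rightarrow> real) \<Rightarrow> 'a \<Rightarrow> 'a \<Rightarrow> bool" where
  "has_sphere_gradient u g x \<longleftrightarrow>
     g \<bullet> x = 0 \<and> (u has_derivative (\<lambda>h. g \<bullet> h)) (at x within sphere 0 1)"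

definition sphere_gradient :: "('a::euclidean_space \<Rightarrow> real) \<Rightarrow> 'a \<Rightarrow> 'a" where
  "sphere_gradient u x = (THE g. has_sphere_gradient u g x)"

lemma has_sphere_gradient_unique:
  assumes x: "x \<in> sphere 0 1"
    and g: "has_sphere_gradient u g x" and g': "has_sphere_gradient u g' x"
  shows "g = g'"
proof (rule ccontr)
  assume "g \<noteq> g'"
  define d where "d = g - g'"
  have d0: "d \<noteq> 0" and dx: "d \<bullet> x = 0"
    using \<open>g \<noteq> g'\<close> g g' by (auto simp: d_def has_sphere_gradient_def inner_diff_left)
  define v where "v = d /\<^sub>R norm d"
  define c where "c t = cos t *\<^sub>R x + sin t *\<^sub>R v" for t :: real
  have v: "v \<bullet> x = 0" "x \<bullet> v = 0" "v \<bullet> v = 1" and xx: "x \<bullet> x = 1"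
    using d0 dx x by (auto simp: v_def inner_commute dot_square_norm field_simps power2_eq_square)
  have c_sphere: "c t \<in> sphere 0 1" for t
  proof -
    have "c t \<bullet> c t = (cos t)\<^sup>2 + (sin t)\<^sup>2"
      by (simp add: c_def inner_add_left inner_add_right v xx power2_eq_square)
    then show ?thesis
      by (simp add: norm_eq_sqrt_inner)
  qed
  have c0: "c 0 = x"
    by (simp add: c_def)
  have c': "(c has_derivative (\<lambda>t. t *\<^sub>R v)) (at 0)"
    unfolding c_def by (auto intro!: derivative_eq_intros)
  have deriv: "((\<lambda>t. u (c t)) has_derivative (\<lambda>t. k \<bullet> (t *\<^sub>R v))) (at 0)"
    if "has_sphere_gradient u k x" for k
  proof -
    have "(u has_derivative (\<lambda>h. k \<bullet> h)) (at (c 0) within c ` UNIV)"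
      using that c_sphere unfolding c0 has_sphere_gradient_def
      by (blast intro: has_derivative_subset)
    from has_derivative_in_compose[OF c' this] show ?thesis .
  qed
  have "(\<lambda>t. g \<bullet> (t *\<^sub>R v)) = (\<lambda>t. g' \<bullet> (t *\<^sub>R v))"
    using has_derivative_unique[OF deriv[OF g] deriv[OF g']] .
  from fun_cong[OF this, of 1] have "d \<bullet> v = 0"
    by (simp add: d_def inner_diff_left)
  then show False
    using d0 by (simp add: v_def)
qed

definition C1_sphere :: "('a::euclidean_space \<Rightarrow> real) \<Rightarrow> bool" where
  "C1_sphere u \<longleftrightarrow>
     (\<exists>G. continuous_on (sphere 0 1) G \<and> (\<forall>x\<in>sphere 0 1. has_sphere_gradient u (G x) x))"

text \<open>
  The equation \<open>-\<Delta>u = f\<close> on the sphere in the weak sense, where \<open>\<Delta>\<close> is the Laplace--Beltrami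
  operator. There is no boundary term since the sphere is closed.
\<close>

definition weak_neg_laplacian_eq ::
    "('a::euclidean_space \<Rightarrow> real) \<Rightarrow> ('a \<Rightarrow> real) \<Rightarrow> bool" where
  "weak_neg_laplacian_eq u f \<longleftrightarrow>
     (\<forall>\<phi>. C1_sphere \<phi> \<longrightarrow>
        (LINT x|sphere_measure. sphere_gradient u x \<bullet> sphere_gradient \<phi> x) =
        (LINT x|sphere_measure. f x * \<phi> x))"

definition sphere_domain :: "'a::euclidean_space set \<Rightarrow> bool" where
  "sphere_domain \<Omega> \<longleftrightarrow>
     openin (top_of_set (sphere 0 1)) \<Omega> \<and> connected \<Omega> \<and> \<Omega> \<noteq> {}"

abbreviation sphere_frontier :: "'a::euclidean_space set \<Rightarrow> 'a set" where
  "sphere_frontier \<Omega> \<equiv> top_of_set (sphere 0 1) frontier_of \<Omega>"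

definition sphere_dist :: "'a::euclidean_space \<Rightarrow> 'a \<Rightarrow> real" where
  "sphere_dist x y = arccos (x \<bullet> y)"

definition geodesic_ball :: "'a::euclidean_space \<Rightarrow> real \<Rightarrow> 'a set" where
  "geodesic_ball p r = {x \<in> sphere 0 1. sphere_dist p x < r}"

definition C2_holder_on ::
    "real \<Rightarrow> ('a::euclidean_space \<Rightarrow> 'b::euclidean_space) \<Rightarrow> 'a set \<Rightarrow> bool" where
  "C2_holder_on \<alpha> f U \<longleftrightarrow>
     (\<exists>(f' :: 'a \<Rightarrow> 'a \<Rightarrow>\<^sub>L 'b) (f'' :: 'a \<Rightarrow> 'a \<Rightarrow>\<^sub>L 'a \<Rightarrow>\<^sub>L 'b).
        (\<forall>x\<in>U. (f has_derivative blinfun_apply (f' x)) (at x)) \<and>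
        (\<forall>x\<in>U. (f' has_derivative blinfun_apply (f'' x)) (at x)) \<and>
        (\<forall>K. compact K \<and> K \<subseteq> U \<longrightarrow>
           (\<exists>C. \<forall>x\<in>K. \<forall>y\<in>K. norm (f'' x - f'' y) \<le> C * dist x y powr \<alpha>)))"

text \<open>
  The boundary of \<open>\<Omega>\<close> is of class \<open>C\<^sup>2\<^sup>,\<^sup>\<alpha>\<close> if near each of its points there are local coordinates
  of the sphere of that class in which \<open>\<Omega>\<close> is one side of a hyperplane and the boundary is the
  hyperplane. The coordinates are given by the inverse \<open>\<Phi>\<close> of the coordinate map, from an open
  subset of \<open>n\<close>-space \<open>'a\<close> onto a relatively open subset \<open>V\<close> of the sphere in \<open>'a \<times> real\<close>.
  Injectivity of the differential of \<open>\<Phi>\<close> makes the coordinate map be of the same class.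
\<close>

definition C2_holder_boundary :: "real \<Rightarrow> ('a::euclidean_space \<times> real) set \<Rightarrow> bool" where
  "C2_holder_boundary \<alpha> \<Omega> \<longleftrightarrow>
     (\<forall>p\<in>sphere_frontier \<Omega>. \<exists>V (D :: 'a set) \<Phi> \<Psi> e.
        openin (top_of_set (sphere 0 1)) V \<and> p \<in> V \<and> open D \<and>
        homeomorphism D V \<Phi> \<Psi> \<and>
        C2_holder_on \<alpha> \<Phi> D \<and> (\<forall>y\<in>D. inj (frechet_derivative \<Phi> (at y))) \<and>
        norm e = 1 \<and>
        V \<inter> \<Omega> = \<Phi> ` {y \<in> D. y \<bullet> e > 0} \<and>
        V \<inter> sphere_frontier \<Omega> = \<Phi> ` {y \<in> D. y \<bullet> e = 0})"

end

theory Submission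
  imports Defs
begin

text \<open>
  Moving planes through the origin. The maximum principle gives \<open>u > 0\<close> in \<open>\<Omega>\<close> and \<open>u \<le> 0\<close>
  outside, strictly in \<open>\<Omega>m\<close> unless \<open>\<gamma> = 0\<close>, so the right hand side is a nondecreasing function
  of \<open>u\<close>. For a unit vector \<open>d\<close> with reflection \<open>R\<close>, if \<open>w = u - u \<circ> R\<close> is nonnegative on
  the hemisphere \<open>x \<bullet> d > 0\<close>, it is therefore superharmonic there, and it vanishes identically or
  is positive with positive normal derivative on the equator. The second case is an open condition
  on \<open>d\<close>. Since \<open>\<partial>\<Omega>\<close> lies in the hemisphere around \<open>e\<close>, the right hand side is constant on the
  opposite hemisphere, so one of \<open>e\<close> and \<open>-e\<close> is in the second case.

  Put \<open>m = \<integral> u(x) x d\<sigma>\<close>. The first case forces \<open>m \<bullet> d = 0\<close>, so the second case persists on the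
  connected set \<open>m \<bullet> d > 0\<close>. Any two points are exchanged by a reflection, hence \<open>u\<close> is strictly
  increasing in \<open>x \<bullet> m\<close>. Thus \<open>\<partial>\<Omega>\<close> lies in a single level set of \<open>x \<bullet> m\<close>, and \<open>\<Omega>\<close> is one of
  the two caps that it bounds.
\<close>

section \<open>Reflections and the measure of the sphere\<close>

text \<open>The right hand side jumps across \<open>\<partial>\<Omega>\<close>, so the difference
  \<open>w\<close> of \<open>u\<close> and its reflection solves no linear equation with a bounded
  zero order coefficient. Only a sign is available: where \<open>w \<ge> 0\<close>, monotonicity
  gives \<open>-\<Delta>w \<ge> 0\<close> outright. Where \<open>w < 0\<close> nothing is known, so
  the first direction must get the sign of the right hand side from geometry instead.

  Planes through the origin cannot come in from infinity; they are parametrised by the sphere of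
  directions, on which \<open>d\<close> and \<open>- d\<close> give opposite inequalities. The
  identity \<open>2 (m \<bullet> d) = \<integral> w(x) (x \<bullet> d) d\<sigma>\<close> tells where
  the motion may stop: good directions have \<open>m \<bullet> d > 0\<close>, symmetric ones lie on
  the boundary of that hemisphere.

  Since \<open>u\<close> is only of class \<open>C1\<close>, no second derivative of it is ever
  formed. The maximum principles and Hopf's lemma come from testing the weak equation and from
  comparison with functions of \<open>x \<bullet> y\<close>, whose weak Laplacian follows from the
  invariance of the measure under reflections.\<close>

lemma lborel_eqI_translation_invariant:
  fixes M :: "'a::euclidean_space measure"
  assumes sets_M: "sets M = sets borel" and sf: "sigma_finite_measure M"
    and inv: "\<And>a. distr M borel ((+) a) = M"
    and unit: "emeasure M (ball 0 1) = emeasure lborel (ball (0::'a) 1)"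
  shows "M = lborel"
proof (rule measure_eqI)
  interpret M: sigma_finite_measure M by fact
  interpret pair_sigma_finite M "lborel :: 'a measure" ..
  note [measurable_cong] = sets_M
  fix B assume "B \<in> sets M"
  then have [measurable]: "B \<in> sets borel" using sets_M by simp
  \<comment> \<open>Fubini for the pairs with \<open>x\<close> in \<open>A\<close> and
    \<open>x + y\<close> in \<open>B\<close>: integrating over \<open>y\<close> first gives
    \<open>M(A)\<close> times the Lebesgue measure of \<open>B\<close>; substituting
    \<open>z = x + y\<close> exchanges the two measures, since the points \<open>y\<close> with
    \<open>z - y\<close> in the unit ball again form a unit ball. The measure of \<open>A\<close> is
    finite and nonzero, so it cancels.\<close>
  define A where "A = ball (0::'a) 1"
  have [measurable]: "A \<in> sets borel" by (simp add: A_def)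
  have shiftL: "emeasure lborel {y. x + y \<in> B} = emeasure lborel B" for x
  proof -
    have "emeasure lborel B = emeasure (distr lborel borel ((+) x)) B"
      by (simp add: lborel_distr_plus)
    also have "\<dots> = emeasure lborel {y. x + y \<in> B}"
      by (subst emeasure_distr) (auto intro!: arg_cong[where f="emeasure lborel"])
    finally show ?thesis by simp
  qed
  have "emeasure M A * emeasure lborel B = (\<integral>\<^sup>+x. \<integral>\<^sup>+y. indicator A x * indicator B (x + y) \<partial>lborel \<partial>M)"
  proof -
    have "(\<integral>\<^sup>+y. indicator A x * indicator B (x + y) \<partial>lborel) = indicator A x * emeasure lborel B" for x
    proof -
      have "(\<integral>\<^sup>+y. indicator A x * indicator B (x + y) \<partial>lborel)
          = indicator A x * (\<integral>\<^sup>+y. indicator B (x + y) \<partial>lborel)"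
        by (rule nn_integral_cmult) measurable
      also have "(\<integral>\<^sup>+y. indicator B (x + y) \<partial>lborel) = (\<integral>\<^sup>+y. indicator {y. x + y \<in> B} y \<partial>lborel)"
        by (intro nn_integral_cong) (auto simp: indicator_def)
      also have "\<dots> = emeasure lborel {y. x + y \<in> B}"
        by (rule nn_integral_indicator) (use measurable_sets[of "(+) x" borel borel B] in \<open>simp add: vimage_def\<close>)
      finally show ?thesis by (simp add: shiftL)
    qed
    then show ?thesis
      by (simp add: nn_integral_multc sets_M)
  qed
  also have "\<dots> = (\<integral>\<^sup>+y. \<integral>\<^sup>+x. indicator A x * indicator B (x + y) \<partial>M \<partial>lborel)"
    by (rule Fubini'[symmetric]) measurable
  also have "\<dots> = (\<integral>\<^sup>+y. \<integral>\<^sup>+z. indicator A (z - y) * indicator B z \<partial>M \<partial>lborel)"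
  proof (rule nn_integral_cong)
    fix y
    have "(\<integral>\<^sup>+z. indicator A (z - y) * indicator B z \<partial>M)
        = (\<integral>\<^sup>+z. indicator A (z - y) * indicator B z \<partial>distr M borel ((+) y))"
      by (simp add: inv)
    also have "\<dots> = (\<integral>\<^sup>+x. indicator A (y + x - y) * indicator B (y + x) \<partial>M)"
      by (rule nn_integral_distr) measurable
    finally show "(\<integral>\<^sup>+x. indicator A x * indicator B (x + y) \<partial>M)
        = (\<integral>\<^sup>+z. indicator A (z - y) * indicator B z \<partial>M)"
      by (simp add: add.commute)
  qed
  also have "\<dots> = (\<integral>\<^sup>+z. \<integral>\<^sup>+y. indicator A (z - y) * indicator B z \<partial>lborel \<partial>M)"
    by (rule Fubini') measurable
  also have "\<dots> = (\<integral>\<^sup>+z. emeasure lborel A * indicator B z \<partial>M)"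
  proof (rule nn_integral_cong)
    fix z
    have "(\<integral>\<^sup>+y. indicator A (z - y) * indicator B z \<partial>lborel) = (\<integral>\<^sup>+y. indicator A (z - y) \<partial>lborel) * indicator B z"
      by (rule nn_integral_multc) measurable
    also have "(\<integral>\<^sup>+y. indicator A (z - y) \<partial>lborel) = (\<integral>\<^sup>+y. indicator (ball z 1) y \<partial>lborel)"
      by (intro nn_integral_cong) (auto simp: indicator_def A_def dist_norm norm_minus_commute)
    also have "\<dots> = emeasure lborel A"
      by (simp add: A_def emeasure_ball)
    finally show "(\<integral>\<^sup>+y. indicator A (z - y) * indicator B z \<partial>lborel) = emeasure lborel A * indicator B z" .
  qed
  also have "\<dots> = emeasure lborel A * emeasure M B"
    by (simp add: nn_integral_cmult sets_M)
  finally have eq: "emeasure lborel A * emeasure lborel B = emeasure lborel A * emeasure M B"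
    using unit by (simp add: A_def)
  have fin: "emeasure lborel A < top" "emeasure lborel A \<noteq> 0"
    by (auto simp: A_def emeasure_ball unit_ball_vol_pos intro!: less_imp_neq[symmetric])
  then show "emeasure M B = emeasure lborel B"
    using eq by (metis ennreal_mult_cancel_left top.not_eq_extremum)
qed (simp add: sets_M)

text \<open>The image measure is translation invariant because \<open>T\<close> is linear and onto,
  and it agrees with Lebesgue measure on the unit ball because \<open>T\<close> preserves the norm.
  Uniqueness of such a measure takes the place of a determinant.\<close>

lemma lborel_distr_orthogonal:
  fixes T :: "'a::euclidean_space \<Rightarrow> 'a"
  assumes T: "orthogonal_transformation T"
  shows "distr lborel borel T = lborel"
proof (rule lborel_eqI_translation_invariant)
  have lin: "linear T" using T by (rule orthogonal_transformation_linear)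
  have [measurable]: "T \<in> borel_measurable borel"
    using lin by (intro borel_measurable_continuous_onI linear_continuous_on linear_conv_bounded_linear[THEN iffD1])
  show "sets (distr lborel borel T) = sets borel" by simp
  have pre: "T -` ball 0 r = ball 0 r" for r
    using T by (auto simp: orthogonal_transformation)
  show "sigma_finite_measure (distr lborel borel T)"
  proof (rule sigma_finite_measure.intro, intro exI conjI)
    show "countable (range (\<lambda>n. ball (0::'a) (real n)))" by simp
    show "range (\<lambda>n. ball (0::'a) (real n)) \<subseteq> sets (distr lborel borel T)" by auto
    show "\<Union> (range (\<lambda>n. ball (0::'a) (real n))) = space (distr lborel borel T)"
      by (auto simp: reals_Archimedean2)
    show "\<forall>a\<in>range (\<lambda>n. ball (0::'a) (real n)). emeasure (distr lborel borel T) a \<noteq> \<infinity>"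
      by (auto simp: emeasure_distr pre emeasure_ball)
  qed
  show "distr (distr lborel borel T) borel ((+) a) = distr lborel borel T" for a
  proof -
    obtain b where b: "T b = a"
      using orthogonal_transformation_surj[OF T] by (metis surjD)
    have "distr (distr lborel borel T) borel ((+) a) = distr lborel borel (T \<circ> (+) b)"
      by (subst distr_distr) (auto intro!: distr_cong simp: b linear_add[OF lin])
    also have "\<dots> = distr (distr lborel borel ((+) b)) borel T"
      by (subst distr_distr) auto
    finally show ?thesis by (simp add: lborel_distr_plus)
  qed
  show "emeasure (distr lborel borel T) (ball 0 1) = emeasure lborel (ball (0::'a) 1)"
    by (simp add: emeasure_distr pre)
qed

section \<open>Reflections in hyperplanes through the origin\<close>

definition reflect :: "'a::euclidean_space \<Rightarrow> 'a \<Rightarrow> 'a" where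
  "reflect d x = x - (2 * (x \<bullet> d)) *\<^sub>R d"

context
  fixes d :: "'a::euclidean_space"
  assumes d: "d \<in> sphere 0 1"
begin

lemma inner_self_sphere: "d \<bullet> d = 1"
  using d by (simp add: dot_square_norm)

lemma reflect_inner: "reflect d x \<bullet> reflect d y = x \<bullet> y"
  by (simp add: reflect_def inner_diff_left inner_diff_right inner_self_sphere inner_commute)

lemma reflect_reflect [simp]: "reflect d (reflect d x) = x"
  by (simp add: reflect_def inner_diff_left inner_self_sphere algebra_simps flip: scaleR_add_left)

lemma inner_reflect: "reflect d x \<bullet> y = x \<bullet> reflect d y"
  by (simp add: reflect_def inner_diff_left inner_diff_right inner_commute)

lemma reflect_inner_normal: "reflect d x \<bullet> d = - (x \<bullet> d)"
  by (simp add: reflect_def inner_diff_left inner_self_sphere)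

lemma linear_reflect: "linear (reflect d)"
  by (auto intro!: linearI simp: reflect_def algebra_simps inner_add_left)

lemma orthogonal_transformation_reflect: "orthogonal_transformation (reflect d)"
  by (simp add: orthogonal_transformation_def linear_reflect reflect_inner)

lemma norm_reflect [simp]: "norm (reflect d x) = norm x"
  by (simp add: norm_eq_sqrt_inner reflect_inner)

lemma reflect_sphere: "x \<in> sphere 0 1 \<Longrightarrow> reflect d x \<in> sphere 0 1"
  by simp

end

lemma continuous_on_reflect [continuous_intros]:
  "continuous_on S f \<Longrightarrow> continuous_on S g \<Longrightarrow> continuous_on S (\<lambda>x. reflect (f x) (g x))"
  unfolding reflect_def by (intro continuous_intros)

lemma reflect_measurable [measurable]: "reflect d \<in> borel_measurable borel"
  unfolding reflect_def by measurable

text \<open>A reflection commutes with radial projection, hence carries the cone over a set to the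
  cone over its image, and the invariance of Lebesgue measure descends to the sphere.\<close>

lemma sphere_measure_distr_reflect:
  fixes d :: "'a::euclidean_space"
  assumes d: "d \<in> sphere 0 1"
  shows "distr sphere_measure sphere_measure (reflect d) = sphere_measure"
    and reflect_measurable_sphere: "reflect d \<in> sphere_measure \<rightarrow>\<^sub>M sphere_measure"
proof -
  have "reflect d \<in> restrict_space borel (sphere 0 1) \<rightarrow>\<^sub>M restrict_space borel (sphere (0::'a) 1)"
    using d by (intro measurable_restrict_space3) auto
  then show meas: "reflect d \<in> sphere_measure \<rightarrow>\<^sub>M sphere_measure"
    using measurable_cong_sets[OF sets_sphere_measure sets_sphere_measure] by blast
  show "distr sphere_measure sphere_measure (reflect d) = sphere_measure"
  proof (rule measure_eqI)
    fix B :: "'a set" assume "B \<in> sets (distr sphere_measure sphere_measure (reflect d))"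
    then have "B \<in> sets (restrict_space borel (sphere 0 1))"
      by (simp add: sets_sphere_measure)
    then have [measurable]: "B \<in> sets borel" and BS: "B \<subseteq> sphere 0 1"
      by (auto simp: sets_restrict_space_iff)
    define X where "X = {x \<in> cball (0::'a) 1 - {0}. x /\<^sub>R norm x \<in> B}"
    have [measurable]: "X \<in> sets borel"
      unfolding X_def by measurable
    have pre: "reflect d -` B \<inter> sphere 0 1 = reflect d -` B"
      using BS d by auto
    have "reflect d -` B \<in> sets borel"
      using measurable_sets[OF reflect_measurable, of B d] by simp
    moreover have "reflect d -` B \<subseteq> sphere 0 1"
      using pre by blast
    ultimately have "emeasure sphere_measure (reflect d -` B) =
       of_nat DIM('a) * emeasure lborel {x \<in> cball 0 1 - {0}. x /\<^sub>R norm x \<in> reflect d -` B}"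
      by (rule emeasure_sphere_measure)
    also have "{x \<in> cball 0 1 - {0}. x /\<^sub>R norm x \<in> reflect d -` B} = reflect d -` X"
    proof -
      have "reflect d x = 0 \<longleftrightarrow> x = 0" for x
        using d by (metis norm_eq_zero norm_reflect)
      then show ?thesis
        using d by (auto simp: X_def linear_cmul[OF linear_reflect])
    qed
    also have "emeasure lborel (reflect d -` X) = emeasure (distr lborel borel (reflect d)) X"
      by (simp add: emeasure_distr)
    also have "\<dots> = emeasure lborel X"
      by (simp only: lborel_distr_orthogonal[OF orthogonal_transformation_reflect[OF d]])
    finally show "emeasure (distr sphere_measure sphere_measure (reflect d)) B = emeasure sphere_measure B"
      using \<open>B \<in> sets (distr _ _ _)\<close> meas emeasure_sphere_measure[OF \<open>B \<in> sets borel\<close> BS]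
      by (simp add: emeasure_distr pre X_def)
  qed simp
qed

lemma integral_reflect:
  fixes F :: "'a::euclidean_space \<Rightarrow> real"
  assumes d: "d \<in> sphere 0 1" and F: "F \<in> borel_measurable sphere_measure"
  shows "(LINT x|sphere_measure. F (reflect d x)) = (LINT x|sphere_measure. F x)"
  using integral_distr[OF reflect_measurable_sphere[OF d] F]
  by (simp add: sphere_measure_distr_reflect[OF d])

section \<open>Finiteness, positivity on open sets, integrability\<close>

lemma finite_measure_sphere_measure: "finite_measure (sphere_measure :: 'a::euclidean_space measure)"
proof (rule finite_measureI)
  have "emeasure (sphere_measure :: 'a measure) (sphere 0 1)
      \<le> of_nat DIM('a) * emeasure lborel (cball (0::'a) 1)"
    by (subst emeasure_sphere_measure) (auto intro!: mult_left_mono emeasure_mono)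
  also have "\<dots> < \<infinity>"
    using emeasure_lborel_cball_finite[of "0::'a" 1] of_nat_less_top[of "DIM('a)"]
    unfolding infinity_ennreal_def ennreal_mult_less_top by blast
  finally show "emeasure sphere_measure (space (sphere_measure :: 'a measure)) \<noteq> \<infinity>"
    by simp
qed

text \<open>The part of the open unit ball that projects into \<open>V\<close> is open, and it
  contains half of any vector of \<open>V\<close>.\<close>

lemma emeasure_sphere_measure_open_pos:
  fixes V :: "'a::euclidean_space set"
  assumes V: "openin (top_of_set (sphere 0 1)) V" and ne: "V \<noteq> {}"
  shows "emeasure sphere_measure V > 0"
proof -
  obtain U where U: "open U" "V = sphere 0 1 \<inter> U"
    using V by (auto simp: openin_open)
  obtain v where v: "v \<in> V" using ne by auto
  have Vb: "V \<in> sets borel" "V \<subseteq> sphere 0 1"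
    using U by auto
  define Y where "Y = {x \<in> ball (0::'a) 1 - {0}. x /\<^sub>R norm x \<in> U}"
  have "open Y"
  proof -
    have "continuous_on (ball (0::'a) 1 - {0}) (\<lambda>x. x /\<^sub>R norm x)"
      by (intro continuous_intros) auto
    moreover have "open (ball (0::'a) 1 - {0})" by (intro open_Diff) auto
    ultimately have "open ((ball (0::'a) 1 - {0}) \<inter> (\<lambda>x. x /\<^sub>R norm x) -` U)"
      using U(1) continuous_open_preimage by blast
    moreover have "Y = (ball (0::'a) 1 - {0}) \<inter> (\<lambda>x. x /\<^sub>R norm x) -` U"
      by (auto simp: Y_def)
    ultimately show ?thesis by simp
  qed
  have "(1/2) *\<^sub>R v \<in> Y"
    using v U by (auto simp: Y_def)
  then have "\<not> negligible Y"
    using \<open>open Y\<close> open_not_negligible by blast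
  then have "emeasure lborel Y \<noteq> 0"
    using \<open>open Y\<close> by (metis borel_open negligible_iff_null_sets null_setsI null_sets_completionI sets_lborel)
  moreover have "emeasure lborel Y \<le> emeasure lborel {x \<in> cball 0 1 - {0}. x /\<^sub>R norm x \<in> V}"
  proof (rule emeasure_mono)
    show "Y \<subseteq> {x \<in> cball 0 1 - {0}. x /\<^sub>R norm x \<in> V}"
      using U by (auto simp: Y_def)
    have "{x \<in> cball 0 1 - {0}. x /\<^sub>R norm x \<in> V} \<in> sets borel"
      using Vb(1) by measurable
    then show "{x \<in> cball 0 1 - {0}. x /\<^sub>R norm x \<in> V} \<in> sets lborel" by simp
  qed
  ultimately show ?thesis
    unfolding emeasure_sphere_measure[OF Vb]
    by (auto simp: ennreal_zero_less_mult_iff zero_less_iff_neq_zero)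
qed

lemma openin_sphere_measurable:
  assumes "openin (top_of_set (sphere 0 1)) V"
  shows "V \<in> sets sphere_measure"
proof -
  obtain U where "open U" "V = sphere 0 1 \<inter> U"
    using assms unfolding openin_open by blast
  then have "V \<in> sets (restrict_space borel (sphere 0 1))"
    by (subst sets_restrict_space_iff) auto
  then show ?thesis by (simp only: sets_sphere_measure)
qed

lemma continuous_on_sphere_measurable:
  assumes "continuous_on (sphere 0 1) f"
  shows "f \<in> borel_measurable sphere_measure"
  using borel_measurable_continuous_on_restrict[OF assms]
  by (metis measurable_cong_sets sets_sphere_measure)

lemma integrable_sphere_bounded:
  fixes f :: "'a::euclidean_space \<Rightarrow> 'b::{banach, second_countable_topology}"
  assumes "f \<in> borel_measurable sphere_measure" and "\<And>x. x \<in> sphere 0 1 \<Longrightarrow> norm (f x) \<le> B"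
  shows "integrable sphere_measure f"
  using assms by (intro finite_measure.integrable_const_bound[OF finite_measure_sphere_measure, of _ B]) auto

lemma continuous_on_sphere_integrable:
  fixes f :: "'a::euclidean_space \<Rightarrow> 'b::euclidean_space"
  assumes "continuous_on (sphere 0 1) f"
  shows "integrable sphere_measure f"
proof -
  have "bounded (f ` sphere 0 1)"
    using assms compact_continuous_image compact_imp_bounded compact_sphere by blast
  then obtain B where "\<And>x. x \<in> sphere 0 1 \<Longrightarrow> norm (f x) \<le> B"
    unfolding bounded_iff by blast
  then show ?thesis
    by (rule integrable_sphere_bounded[OF continuous_on_sphere_measurable[OF assms]])
qed

text \<open>The integral must be zero, so \<open>f\<close> vanishes almost everywhere; a continuous
  \<open>f\<close> that is nonzero somewhere is nonzero on a relatively open set, which has positive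
  measure. This turns integral identities into pointwise ones.\<close>

lemma integral_nonpos_imp_zero_on_sphere:
  fixes f :: "'a::euclidean_space \<Rightarrow> real"
  assumes f: "continuous_on (sphere 0 1) f" and nonneg: "\<And>x. x \<in> sphere 0 1 \<Longrightarrow> 0 \<le> f x"
    and int: "(LINT x|sphere_measure. f x) \<le> 0" and x: "x \<in> sphere 0 1"
  shows "f x = 0"
proof (rule ccontr)
  assume "f x \<noteq> 0"
  have "(LINT x|sphere_measure. f x) = 0"
    using int nonneg by (intro antisym Bochner_Integration.integral_nonneg) auto
  then have "AE x in sphere_measure. f x = 0"
    using nonneg by (subst (asm) integral_nonneg_eq_0_iff_AE)
      (auto intro!: continuous_on_sphere_integrable f)
  define Z where "Z = {x \<in> sphere 0 1. f x \<noteq> 0}"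
  have Z: "openin (top_of_set (sphere 0 1)) Z"
    using continuous_openin_preimage_gen[OF f, of "- {0}"]
    by (simp add: Z_def vimage_def Int_def open_Compl)
  then have "emeasure sphere_measure Z > 0"
    using emeasure_sphere_measure_open_pos x \<open>f x \<noteq> 0\<close> unfolding Z_def by blast
  moreover have "Z \<in> sets sphere_measure"
    by (rule openin_sphere_measurable[OF Z])
  moreover have "{x \<in> space sphere_measure. \<not> f x = 0} = Z"
    by (auto simp: Z_def)
  ultimately show False
    using \<open>AE x in sphere_measure. f x = 0\<close> AE_iff_measurable[of Z sphere_measure "\<lambda>x. f x = 0"]
    by simp
qed

section \<open>Gradients and Green's identity for zonal functions\<close>

lemma sphere_gradient_eqI:
  "x \<in> sphere 0 1 \<Longrightarrow> has_sphere_gradient u g x \<Longrightarrow> sphere_gradient u x = g"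
  unfolding sphere_gradient_def by (blast intro: has_sphere_gradient_unique)

text \<open>Carrying the gradient field as an argument lets the closure rules compute gradients;
  \<open>sphere_gradient\<close>, a definite description, is then read off by uniqueness.\<close>

definition C1_sphere_with ::
    "('a::euclidean_space \<Rightarrow> real) \<Rightarrow> ('a \<Rightarrow> 'a) \<Rightarrow> bool" where
  "C1_sphere_with u G \<longleftrightarrow>
     continuous_on (sphere 0 1) G \<and> (\<forall>x\<in>sphere 0 1. has_sphere_gradient u (G x) x)"

lemma C1_sphere_withD:
  assumes "C1_sphere_with u G"
  shows "C1_sphere u" "x \<in> sphere 0 1 \<Longrightarrow> sphere_gradient u x = G x"
  using assms by (auto simp: C1_sphere_with_def C1_sphere_def intro!: sphere_gradient_eqI)

lemma C1_sphere_withI: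
  assumes "C1_sphere u"
  shows "C1_sphere_with u (sphere_gradient u)"
proof -
  obtain G where G: "C1_sphere_with u G"
    using assms by (auto simp: C1_sphere_def C1_sphere_with_def)
  then show ?thesis
    using C1_sphere_withD(2)[OF G]
    by (metis C1_sphere_with_def continuous_on_cong)
qed

lemma has_sphere_gradient_sphere_gradient:
  "C1_sphere u \<Longrightarrow> x \<in> sphere 0 1 \<Longrightarrow> has_sphere_gradient u (sphere_gradient u x) x"
  using C1_sphere_withI unfolding C1_sphere_with_def by blast

lemma sphere_gradient_tangent:
  "C1_sphere u \<Longrightarrow> x \<in> sphere 0 1 \<Longrightarrow> sphere_gradient u x \<bullet> x = 0"
  using has_sphere_gradient_sphere_gradient by (auto simp: has_sphere_gradient_def)

lemma continuous_on_sphere_gradient: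
  "C1_sphere u \<Longrightarrow> continuous_on (sphere 0 1) (sphere_gradient u)"
  using C1_sphere_withI by (auto simp: C1_sphere_with_def)

lemma C1_sphere_continuous_on:
  "C1_sphere u \<Longrightarrow> continuous_on (sphere 0 1) u"
  using has_sphere_gradient_sphere_gradient
  unfolding has_sphere_gradient_def continuous_on_eq_continuous_within
  by (blast intro: has_derivative_continuous)

lemma C1_sphere_with_continuous_on:
  "C1_sphere_with u G \<Longrightarrow> continuous_on (sphere 0 1) u"
  "C1_sphere_with u G \<Longrightarrow> continuous_on (sphere 0 1) G"
  using C1_sphere_continuous_on C1_sphere_withD(1) by (blast, simp add: C1_sphere_with_def)

text \<open>
  On the sphere the function \<open>z \<bullet> z\<close> is constant, so the normal part of a derivative may be
  removed.
\<close>

lemma has_sphere_gradient_tangential_part: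
  assumes x: "x \<in> sphere 0 1" and u: "(u has_derivative (\<lambda>h. g \<bullet> h)) (at x within sphere 0 1)"
  shows "has_sphere_gradient u (g - (g \<bullet> x) *\<^sub>R x) x"
proof -
  have xx: "z \<bullet> z = 1" if "z \<in> sphere 0 1" for z :: 'a
    using that by (simp add: dot_square_norm)
  have "((\<lambda>z. u z - (g \<bullet> x) * (z \<bullet> z - 1) / 2) has_derivative (\<lambda>h. g \<bullet> h - (g \<bullet> x) * (x \<bullet> h)))
      (at x within sphere 0 1)"
    by (auto intro!: derivative_eq_intros u simp: inner_commute)
  then have "(u has_derivative (\<lambda>h. g \<bullet> h - (g \<bullet> x) * (x \<bullet> h))) (at x within sphere 0 1)"
    by (rule has_derivative_transform[OF x, rotated]) (simp add: xx del: mem_sphere_0)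
  then show ?thesis
    using xx[OF x] by (simp add: has_sphere_gradient_def inner_diff_left)
qed

lemma C1_sphere_with_inner:
  "C1_sphere_with (\<lambda>x. x \<bullet> y) (\<lambda>x. y - (x \<bullet> y) *\<^sub>R x)"
  unfolding C1_sphere_with_def
proof (intro conjI ballI)
  fix x :: 'a assume "x \<in> sphere 0 1"
  moreover have "((\<lambda>x. x \<bullet> y) has_derivative (\<lambda>h. y \<bullet> h)) (at x within sphere 0 1)"
    by (auto intro!: derivative_eq_intros simp: inner_commute)
  ultimately show "has_sphere_gradient (\<lambda>x. x \<bullet> y) (y - (x \<bullet> y) *\<^sub>R x) x"
    by (metis has_sphere_gradient_tangential_part inner_commute)
qed (intro continuous_intros)

lemma C1_sphere_with_const: "C1_sphere_with (\<lambda>x. c) (\<lambda>x. 0)"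
  by (auto simp: C1_sphere_with_def has_sphere_gradient_def)

lemma C1_sphere_with_diff:
  assumes "C1_sphere_with u G" "C1_sphere_with v H"
  shows "C1_sphere_with (\<lambda>x. u x - v x) (\<lambda>x. G x - H x)"
  using assms has_derivative_diff[of u _ _ v] unfolding C1_sphere_with_def has_sphere_gradient_def inner_diff_left
  by (auto intro!: continuous_intros simp del: mem_sphere_0)

lemma C1_sphere_with_mult:
  assumes u: "C1_sphere_with u G" and v: "C1_sphere_with v H"
  shows "C1_sphere_with (\<lambda>x. u x * v x) (\<lambda>x. u x *\<^sub>R H x + v x *\<^sub>R G x)"
  unfolding C1_sphere_with_def
proof (intro conjI ballI)
  show "continuous_on (sphere 0 1) (\<lambda>x. u x *\<^sub>R H x + v x *\<^sub>R G x)"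
    using u v by (intro continuous_intros C1_sphere_with_continuous_on)
  fix x :: 'a assume x: "x \<in> sphere 0 1"
  have "((\<lambda>x. u x * v x) has_derivative (\<lambda>h. u x * (H x \<bullet> h) + (G x \<bullet> h) * v x)) (at x within sphere 0 1)"
    using u v x by (intro has_derivative_mult) (auto simp: C1_sphere_with_def has_sphere_gradient_def)
  then show "has_sphere_gradient (\<lambda>x. u x * v x) (u x *\<^sub>R H x + v x *\<^sub>R G x) x"
    using u v x by (simp add: C1_sphere_with_def has_sphere_gradient_def inner_add_left mult.commute)
qed

lemma C1_sphere_with_compose:
  assumes u: "C1_sphere_with u G" and f: "\<And>s. (f has_real_derivative f' s) (at s)"
    and f': "continuous_on UNIV f'"
  shows "C1_sphere_with (\<lambda>x. f (u x)) (\<lambda>x. f' (u x) *\<^sub>R G x)"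
  unfolding C1_sphere_with_def
proof (intro conjI ballI)
  show "continuous_on (sphere 0 1) (\<lambda>x. f' (u x) *\<^sub>R G x)"
    using u by (intro continuous_intros continuous_on_compose2[OF f'] C1_sphere_with_continuous_on) auto
  fix x :: 'a assume x: "x \<in> sphere 0 1"
  have "((\<lambda>x. f (u x)) has_derivative (\<lambda>h. f' (u x) * (G x \<bullet> h))) (at x within sphere 0 1)"
    using u x f[of "u x"] by (intro has_derivative_compose[of u _ _ _ f])
      (auto simp: C1_sphere_with_def has_sphere_gradient_def has_field_derivative_def)
  then show "has_sphere_gradient (\<lambda>x. f (u x)) (f' (u x) *\<^sub>R G x) x"
    using u x by (simp add: C1_sphere_with_def has_sphere_gradient_def)
qed

text \<open>A reflection is its own adjoint, so in the chain rule it moves from the increment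
  \<open>h\<close> to the gradient.\<close>

lemma C1_sphere_with_reflect:
  assumes u: "C1_sphere_with u G" and d: "d \<in> sphere 0 1"
  shows "C1_sphere_with (\<lambda>x. u (reflect d x)) (\<lambda>x. reflect d (G (reflect d x)))"
  unfolding C1_sphere_with_def
proof (intro conjI ballI)
  have cont: "continuous_on (sphere 0 1) G"
    using u by (simp add: C1_sphere_with_def)
  show "continuous_on (sphere 0 1) (\<lambda>x. reflect d (G (reflect d x)))"
    using d by (intro continuous_intros continuous_on_compose2[OF cont]) auto
  fix x :: 'a assume x: "x \<in> sphere 0 1"
  have Rx: "reflect d x \<in> sphere 0 1" using x d by simp
  have G: "G (reflect d x) \<bullet> reflect d x = 0"
      "(u has_derivative (\<lambda>h. G (reflect d x) \<bullet> h)) (at (reflect d x) within sphere 0 1)"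
    using u Rx by (auto simp: C1_sphere_with_def has_sphere_gradient_def)
  have "(reflect d has_derivative reflect d) (at x within sphere 0 1)"
    using linear_reflect[OF d] by (simp add: linear_imp_has_derivative)
  moreover have "(u has_derivative (\<lambda>h. G (reflect d x) \<bullet> h)) (at (reflect d x) within reflect d ` sphere 0 1)"
    using G(2) by (rule has_derivative_subset) (use d in auto)
  ultimately have "((\<lambda>x. u (reflect d x)) has_derivative (\<lambda>h. G (reflect d x) \<bullet> reflect d h)) (at x within sphere 0 1)"
    by (rule has_derivative_in_compose)
  then show "has_sphere_gradient (\<lambda>x. u (reflect d x)) (reflect d (G (reflect d x))) x"
    using G(1) unfolding has_sphere_gradient_def inner_reflect[OF d] by blast
qed

section \<open>Curves and great circles\<close>

lemma C1_sphere_curve_derivative: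
  assumes u: "C1_sphere u" and c: "(c has_vector_derivative c') (at t)"
    and c_sphere: "\<And>s. c s \<in> sphere 0 1"
  shows "((\<lambda>s. u (c s)) has_real_derivative sphere_gradient u (c t) \<bullet> c') (at t)"
proof -
  have "(u has_derivative (\<lambda>h. sphere_gradient u (c t) \<bullet> h)) (at (c t) within range c)"
    using has_sphere_gradient_sphere_gradient[OF u c_sphere[of t]] c_sphere
    unfolding has_sphere_gradient_def by (blast intro: has_derivative_subset)
  from has_derivative_in_compose[OF c[unfolded has_vector_derivative_def] this]
  show ?thesis
    by (simp add: has_field_derivative_def mult.commute[of _ "sphere_gradient u (c t) \<bullet> c'"])
qed

lemma great_circle_in_sphere:
  fixes p v :: "'a::euclidean_space"
  assumes "p \<in> sphere 0 1" "v \<in> sphere 0 1" "p \<bullet> v = 0"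
  shows "cos t *\<^sub>R p + sin t *\<^sub>R v \<in> sphere 0 1"
proof -
  have "(cos t *\<^sub>R p + sin t *\<^sub>R v) \<bullet> (cos t *\<^sub>R p + sin t *\<^sub>R v) = (cos t)\<^sup>2 + (sin t)\<^sup>2"
    using assms inner_self_sphere[OF assms(1)] inner_self_sphere[OF assms(2)]
    by (simp add: inner_add_left inner_add_right inner_commute power2_eq_square)
  then show ?thesis by (simp add: norm_eq_sqrt_inner)
qed

lemma great_circle_derivative:
  "((\<lambda>t. cos t *\<^sub>R p + sin t *\<^sub>R v) has_vector_derivative (- sin t *\<^sub>R p + cos t *\<^sub>R v)) (at t)"
  by (auto intro!: derivative_eq_intros simp: has_vector_derivative_def algebra_simps)

text \<open>Normalise the component of \<open>x\<close> orthogonal to \<open>p\<close>. If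
  \<open>x\<close> is \<open>p\<close> or \<open>- p\<close> that component is zero and any unit
  vector orthogonal to \<open>p\<close> serves; its existence is where the dimension enters.\<close>

lemma great_circle_through:
  fixes p x :: "'a::euclidean_space"
  assumes dim: "DIM('a) \<ge> 2" and p: "p \<in> sphere 0 1" and x: "x \<in> sphere 0 1"
  obtains t v where "0 \<le> t" "t \<le> pi" "v \<in> sphere 0 1" "p \<bullet> v = 0"
    "x = cos t *\<^sub>R p + sin t *\<^sub>R v"
proof -
  define s where "s = p \<bullet> x"
  define t where "t = arccos s"
  have s: "\<bar>s\<bar> \<le> 1"
    using Cauchy_Schwarz_ineq2[of p x] p x by (simp add: s_def)
  have t: "0 \<le> t" "t \<le> pi" "cos t = s" "sin t = sqrt (1 - s\<^sup>2)"
    using s by (auto simp: t_def arccos_lbound arccos_ubound cos_arccos_abs sin_arccos_abs)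
  have pp: "p \<bullet> p = 1" and xx: "x \<bullet> x = 1"
    using p x by (auto simp: inner_self_sphere)
  define w where "w = x - s *\<^sub>R p"
  have pw: "p \<bullet> w = 0"
    by (simp add: w_def inner_diff_right pp s_def)
  have "w \<bullet> w = 1 - s\<^sup>2"
    by (simp add: w_def inner_diff_left inner_diff_right pp xx s_def inner_commute power2_eq_square)
  then have nw: "norm w = sin t"
    by (simp add: norm_eq_sqrt_inner t)
  show thesis
  proof (cases "w = 0")
    case True
    obtain y where y: "y \<noteq> 0" "orthogonal p y"
      using orthogonal_to_vector_exists[OF dim] .
    show thesis
      by (rule that[of t "y /\<^sub>R norm y"]) (use True nw y t in \<open>auto simp: orthogonal_def w_def\<close>)
  next
    case False
    then have sin: "0 < sin t"
      using nw by (metis zero_less_norm_iff)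
    show thesis
    proof (rule that[of t "w /\<^sub>R sin t"])
      show "x = cos t *\<^sub>R p + sin t *\<^sub>R (w /\<^sub>R sin t)"
        using sin by (simp add: t(3) w_def)
    qed (use t nw pw sin in auto)
  qed
qed

lemma C1_sphere_gradient_zero_imp_const:
  fixes u :: "'a::euclidean_space \<Rightarrow> real"
  assumes dim: "DIM('a) \<ge> 2" and u: "C1_sphere u"
    and zero: "\<And>x. x \<in> sphere 0 1 \<Longrightarrow> sphere_gradient u x = 0"
    and p: "p \<in> sphere 0 1" and x: "x \<in> sphere 0 1"
  shows "u x = u p"
proof -
  obtain t v where v: "v \<in> sphere 0 1" "p \<bullet> v = 0" "x = cos t *\<^sub>R p + sin t *\<^sub>R v"
    using great_circle_through[OF dim p x] by metis
  have "((\<lambda>s. u (cos s *\<^sub>R p + sin s *\<^sub>R v)) has_real_derivative 0) (at s)" for s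
    using C1_sphere_curve_derivative[OF u great_circle_derivative great_circle_in_sphere[OF p v(1,2)], of s]
      zero[OF great_circle_in_sphere[OF p v(1,2)]] by simp
  then have "u (cos t *\<^sub>R p + sin t *\<^sub>R v) = u (cos 0 *\<^sub>R p + sin 0 *\<^sub>R v)"
    by (intro DERIV_isconst_all[rule_format]) auto
  then show ?thesis by (simp add: v)
qed

text \<open>
  Composing two reflections whose normals lie in a plane gives a rotation of that plane. Hence
  differentiating the integral of \<open>F\<close> over reflections shows that rotation fields are divergence
  free.
\<close>

lemma integral_rotation_field_orthonormal:
  fixes F :: "'a::euclidean_space \<Rightarrow> real"
  assumes F: "C1_sphere F" and y: "y \<in> sphere 0 1" and b: "b \<in> sphere 0 1" and yb: "y \<bullet> b = 0"
  shows "(LINT x|sphere_measure. sphere_gradient F x \<bullet> ((x \<bullet> b) *\<^sub>R y - (x \<bullet> y) *\<^sub>R b)) = 0"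
proof -
  define d where "d t = cos t *\<^sub>R y + sin t *\<^sub>R b" for t :: real
  define d' where "d' t = - sin t *\<^sub>R y + cos t *\<^sub>R b" for t :: real
  have d_sphere: "d t \<in> sphere 0 1" for t
    unfolding d_def by (rule great_circle_in_sphere[OF y b yb])
  have nd: "norm (d t) = 1" for t
    using d_sphere[of t] by simp
  have nd': "norm (d' t) = 1" for t
  proof -
    have "d' t = cos (t + pi/2) *\<^sub>R y + sin (t + pi/2) *\<^sub>R b"
      by (simp add: d'_def cos_add sin_add)
    then show ?thesis
      using great_circle_in_sphere[OF y b yb, of "t + pi/2"] by simp
  qed
  define D where "D x t = - ((2 * (x \<bullet> d' t)) *\<^sub>R d t + (2 * (x \<bullet> d t)) *\<^sub>R d' t)" for x t
  have der: "((\<lambda>t. reflect (d t) x) has_vector_derivative D x t) (at t)" for x t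
  proof -
    have dd: "(d has_derivative (\<lambda>h. h *\<^sub>R d' t)) (at t)"
      using great_circle_derivative[where p=y and v=b and t=t]
      unfolding d_def[abs_def] d'_def has_vector_derivative_def by simp
    show ?thesis
      unfolding reflect_def has_vector_derivative_def
      by (rule derivative_eq_intros dd refl)+ (auto simp: D_def algebra_simps fun_eq_iff)
  qed
  \<comment> \<open>Each of the two terms of \<open>D\<close> has norm at most \<open>2\<close>. A
    bound uniform in \<open>t\<close> is needed for dominated convergence.\<close>
  have normD: "norm (D x t) \<le> 4" if "x \<in> sphere 0 1" for x t
  proof -
    have "\<bar>x \<bullet> d t\<bar> \<le> 1" "\<bar>x \<bullet> d' t\<bar> \<le> 1"
      using Cauchy_Schwarz_ineq2[of x "d t"] Cauchy_Schwarz_ineq2[of x "d' t"] nd nd' that by auto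
    moreover have "norm (D x t) \<le> norm ((2 * (x \<bullet> d' t)) *\<^sub>R d t) + norm ((2 * (x \<bullet> d t)) *\<^sub>R d' t)"
      unfolding D_def norm_minus_cancel by (rule norm_triangle_ineq)
    ultimately show ?thesis
      by (simp add: nd nd' abs_mult)
  qed
  have DF: "((\<lambda>t. F (reflect (d t) x)) has_real_derivative
        sphere_gradient F (reflect (d t) x) \<bullet> D x t) (at t)" if "x \<in> sphere 0 1" for x t
    by (rule C1_sphere_curve_derivative[OF F der]) (use that reflect_sphere[OF d_sphere] in blast)
  obtain M where M: "\<And>x. x \<in> sphere 0 1 \<Longrightarrow> norm (sphere_gradient F x) \<le> M"
  proof -
    have "bounded (sphere_gradient F ` sphere 0 1)"
      using continuous_on_sphere_gradient[OF F] compact_continuous_image compact_imp_bounded compact_sphere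
      by blast
    then show thesis
      using that unfolding bounded_iff by blast
  qed
  have Mpos: "0 \<le> M" using M[OF y] norm_ge_zero order_trans by blast
  have cF: "continuous_on (sphere 0 1) F" by (rule C1_sphere_continuous_on[OF F])
  \<comment> \<open>Difference quotients at \<open>0\<close> with step \<open>1/(k+1)\<close>. Each
    integrates to zero by reflection invariance, and the mean value theorem dominates them all by
    \<open>M * 4\<close>; hence the limit \<open>L\<close> integrates to zero as well.\<close>
  define s where "s k x = (F (reflect (d (inverse (real (Suc k)))) x) - F (reflect (d 0) x)) / inverse (real (Suc k))"
    for k x
  define L where "L x = sphere_gradient F (reflect (d 0) x) \<bullet> D x 0" for x
  have d0: "d 0 = y" "d' 0 = b"
    by (auto simp: d_def d'_def)
  have cR: "continuous_on (sphere 0 1) (\<lambda>x. F (reflect (d t) x))" for t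
    using reflect_sphere[OF d_sphere] by (intro continuous_on_compose2[OF cF] continuous_intros) blast
  have int0: "(LINT x|sphere_measure. s k x) = 0" for k
  proof -
    have "(LINT x|sphere_measure. F (reflect (d t) x)) = (LINT x|sphere_measure. F x)" for t
      by (rule integral_reflect[OF d_sphere continuous_on_sphere_measurable[OF cF]])
    then show ?thesis
      unfolding s_def by (simp add: continuous_on_sphere_integrable cR)
  qed
  have cL: "continuous_on (sphere 0 1) L"
    unfolding L_def D_def using reflect_sphere[OF d_sphere]
    by (intro continuous_intros continuous_on_compose2[OF continuous_on_sphere_gradient[OF F]]) auto
  have "(\<lambda>k. LINT x|sphere_measure. s k x) \<longlonglongrightarrow> (LINT x|sphere_measure. L x)"
  proof (rule integral_dominated_convergence[where w = "\<lambda>_. M * 4"])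
    show "L \<in> borel_measurable sphere_measure"
      by (rule continuous_on_sphere_measurable[OF cL])
    show "s k \<in> borel_measurable sphere_measure" for k
      unfolding s_def by (intro continuous_on_sphere_measurable continuous_intros cR) auto
    show "integrable sphere_measure (\<lambda>_. M * 4)"
      by (intro continuous_on_sphere_integrable continuous_intros)
    show "AE x in sphere_measure. (\<lambda>k. s k x) \<longlonglongrightarrow> L x"
    proof (rule AE_I2)
      fix x :: 'a assume "x \<in> space sphere_measure"
      then have x: "x \<in> sphere 0 1" by simp
      have "(\<lambda>h. (F (reflect (d (0 + h)) x) - F (reflect (d 0) x)) / h) \<midarrow>0\<rightarrow> L x"
        using DF[OF x, of 0] unfolding DERIV_def L_def .
      moreover have "filterlim (\<lambda>k. inverse (real (Suc k))) (at 0) sequentially"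
        unfolding filterlim_at using LIMSEQ_inverse_real_of_nat by auto
      ultimately have "(\<lambda>k. (F (reflect (d (0 + inverse (real (Suc k)))) x) - F (reflect (d 0) x))
           / inverse (real (Suc k))) \<longlonglongrightarrow> L x"
        by (rule filterlim_compose)
      then show "(\<lambda>k. s k x) \<longlonglongrightarrow> L x"
        by (simp add: s_def)
    qed
    show "AE x in sphere_measure. norm (s k x) \<le> M * 4" for k
    proof (rule AE_I2)
      fix x :: 'a assume "x \<in> space sphere_measure"
      then have x: "x \<in> sphere 0 1" by simp
      define h where "h = inverse (real (Suc k))"
      have h: "0 < h" by (simp add: h_def)
      obtain z where z: "F (reflect (d h) x) - F (reflect (d 0) x)
          = (h - 0) * (sphere_gradient F (reflect (d z) x) \<bullet> D x z)"
        using MVT2[OF h, of "\<lambda>t. F (reflect (d t) x)", OF DF[OF x]] by blast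
      have "\<bar>sphere_gradient F (reflect (d z) x) \<bullet> D x z\<bar> \<le> norm (sphere_gradient F (reflect (d z) x)) * norm (D x z)"
        by (rule Cauchy_Schwarz_ineq2)
      also have "\<dots> \<le> M * 4"
        using M[OF reflect_sphere[OF d_sphere x]] normD[OF x] Mpos by (intro mult_mono) auto
      finally show "norm (s k x) \<le> M * 4"
        using h unfolding s_def h_def[symmetric] z by simp
    qed
  qed
  then have "(LINT x|sphere_measure. L x) = 0"
    by (simp add: int0 LIMSEQ_const_iff)
  \<comment> \<open>Substituting \<open>reflect y x\<close> composes the moving reflection with the
    fixed one at time \<open>0\<close>; the velocity of the resulting rotation is \<open>-2\<close>
    times the field in question.\<close>
  also have "(LINT x|sphere_measure. L x) = (LINT x|sphere_measure. L (reflect y x))"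
    by (rule integral_reflect[OF y continuous_on_sphere_measurable[OF cL], symmetric])
  also have "\<dots> = (LINT x|sphere_measure. - 2 * (sphere_gradient F x \<bullet> ((x \<bullet> b) *\<^sub>R y - (x \<bullet> y) *\<^sub>R b)))"
  proof (intro Bochner_Integration.integral_cong refl)
    fix x
    have "reflect y x \<bullet> b = x \<bullet> b"
      using yb by (simp add: reflect_def inner_diff_left)
    then show "L (reflect y x) = - 2 * (sphere_gradient F x \<bullet> ((x \<bullet> b) *\<^sub>R y - (x \<bullet> y) *\<^sub>R b))"
      using y reflect_inner_normal[OF y, of x]
      by (simp add: L_def D_def d0 inner_diff_right inner_add_right)
  qed
  finally show ?thesis by simp
qed

text \<open>The field is linear in \<open>b\<close> and vanishes for \<open>b = y\<close>, so only
  the component of \<open>b\<close> orthogonal to \<open>y\<close> counts, and it may be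
  normalised.\<close>

lemma integral_rotation_field:
  fixes F :: "'a::euclidean_space \<Rightarrow> real"
  assumes F: "C1_sphere F" and y: "y \<in> sphere 0 1"
  shows "(LINT x|sphere_measure. sphere_gradient F x \<bullet> ((x \<bullet> b) *\<^sub>R y - (x \<bullet> y) *\<^sub>R b)) = 0"
proof -
  define b' where "b' = b - (b \<bullet> y) *\<^sub>R y"
  have eq: "(x \<bullet> b) *\<^sub>R y - (x \<bullet> y) *\<^sub>R b = (x \<bullet> b') *\<^sub>R y - (x \<bullet> y) *\<^sub>R b'" for x
    by (simp add: b'_def inner_diff_right algebra_simps)
  show ?thesis
  proof (cases "b' = 0")
    case True
    then show ?thesis by (simp add: eq)
  next
    case False
    define e where "e = b' /\<^sub>R norm b'"
    have e: "e \<in> sphere 0 1" "y \<bullet> e = 0" and b'e: "b' = norm b' *\<^sub>R e"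
      using False inner_self_sphere[OF y]
      by (auto simp: e_def b'_def inner_diff_right inner_commute)
    have "sphere_gradient F x \<bullet> ((x \<bullet> b') *\<^sub>R y - (x \<bullet> y) *\<^sub>R b')
        = norm b' * (sphere_gradient F x \<bullet> ((x \<bullet> e) *\<^sub>R y - (x \<bullet> y) *\<^sub>R e))" for x
      by (subst (1 2) b'e) (simp add: inner_diff_right algebra_simps)
    then show ?thesis
      by (simp add: eq integral_rotation_field_orthonormal[OF F y e])
  qed
qed

text \<open>
  The right hand side contains \<open>-\<Delta>\<close> of a primitive of \<open>k\<close> at \<open>x \<bullet> y\<close>. The identity is the
  sum over an orthonormal basis \<open>b\<close> of the divergence theorem for the rotation fields in the
  planes of \<open>y\<close> and \<open>b\<close>, applied to \<open>\<phi> x * k (x \<bullet> y) * (x \<bullet> b)\<close>.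
\<close>

lemma Green_zonal:
  fixes \<phi> :: "'a::euclidean_space \<Rightarrow> real"
  assumes \<phi>: "C1_sphere \<phi>" and y: "y \<in> sphere 0 1"
    and k: "\<And>s. (k has_real_derivative k' s) (at s)" and k': "continuous_on UNIV k'"
  shows "(LINT x|sphere_measure. k (x \<bullet> y) * (sphere_gradient \<phi> x \<bullet> y)) =
     (LINT x|sphere_measure.
        ((real DIM('a) - 1) * (x \<bullet> y) * k (x \<bullet> y) - (1 - (x \<bullet> y)\<^sup>2) * k' (x \<bullet> y)) * \<phi> x)"
proof -
  note C\<phi> = C1_sphere_withI[OF \<phi>]
  note cont = C1_sphere_with_continuous_on[OF C\<phi>]
  have ck: "continuous_on UNIV k"
    using k by (meson DERIV_isCont continuous_at_imp_continuous_on)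
  let ?g = "sphere_gradient \<phi>"
  have yy: "y \<bullet> y = 1" by (rule inner_self_sphere[OF y])
  \<comment> \<open>The gradient of \<open>\<phi> x * k (x \<bullet> y) * (x \<bullet> b)\<close>
    paired with the rotation field. The three summands come from differentiating
    \<open>\<phi>\<close>, \<open>k\<close> and the coordinate; radial parts drop out because the
    field is tangent.\<close>
  define I where "I b x =
      k (x \<bullet> y) * (x \<bullet> b) * ((x \<bullet> b) * (?g x \<bullet> y) - (x \<bullet> y) * (?g x \<bullet> b))
      + \<phi> x * k' (x \<bullet> y) * ((x \<bullet> b)\<^sup>2 - (x \<bullet> y) * ((x \<bullet> b) * (y \<bullet> b)))
      + \<phi> x * k (x \<bullet> y) * ((x \<bullet> b) * (y \<bullet> b) - (x \<bullet> y))" for b x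
  have cI: "continuous_on (sphere 0 1) (I b)" for b
    unfolding I_def
    by (intro continuous_intros cont continuous_on_compose2[OF ck] continuous_on_compose2[OF k']) auto
  have I0: "(LINT x|sphere_measure. I b x) = 0" if b: "b \<in> Basis" for b
  proof -
    have C: "C1_sphere_with (\<lambda>x. \<phi> x * k (x \<bullet> y) * (x \<bullet> b))
      (\<lambda>x. (\<phi> x * k (x \<bullet> y)) *\<^sub>R (b - (x \<bullet> b) *\<^sub>R x)
         + (x \<bullet> b) *\<^sub>R (\<phi> x *\<^sub>R (k' (x \<bullet> y) *\<^sub>R (y - (x \<bullet> y) *\<^sub>R x)) + k (x \<bullet> y) *\<^sub>R ?g x))"
      by (intro C1_sphere_with_mult C\<phi> C1_sphere_with_compose[OF _ k k'] C1_sphere_with_inner)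
    show ?thesis
      unfolding integral_rotation_field[OF C1_sphere_withD(1)[OF C] y, of b, symmetric]
    proof (intro Bochner_Integration.integral_cong refl)
      fix x :: 'a assume "x \<in> space sphere_measure"
      then have x: "x \<in> sphere 0 1" by simp
      have bb: "b \<bullet> b = 1" using b by simp
      show "I b x = sphere_gradient (\<lambda>x. \<phi> x * k (x \<bullet> y) * (x \<bullet> b)) x \<bullet> ((x \<bullet> b) *\<^sub>R y - (x \<bullet> y) *\<^sub>R b)"
        unfolding C1_sphere_withD(2)[OF C x] I_def
        by (simp add: inner_add_left inner_diff_left inner_diff_right bb yy inner_commute[of b y]
            power2_eq_square algebra_simps)
    qed
  qed
  have "0 = (\<Sum>b\<in>Basis. LINT x|sphere_measure. I b x)"
    by (simp add: I0)
  also have "\<dots> = (LINT x|sphere_measure. (\<Sum>b\<in>Basis. I b x))"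
    by (intro Bochner_Integration.integral_sum[symmetric] continuous_on_sphere_integrable cI)
  also have "\<dots> = (LINT x|sphere_measure. k (x \<bullet> y) * (?g x \<bullet> y)
       - ((real DIM('a) - 1) * (x \<bullet> y) * k (x \<bullet> y) - (1 - (x \<bullet> y)\<^sup>2) * k' (x \<bullet> y)) * \<phi> x)"
  proof (intro Bochner_Integration.integral_cong refl)
    fix x :: 'a assume "x \<in> space sphere_measure"
    then have x: "x \<in> sphere 0 1" by simp
    \<comment> \<open>Expansions in the basis; the third sum vanishes because the gradient is
      tangent. The summand without \<open>b\<close> is counted \<open>DIM('a)\<close> times and the
      second sum takes one copy back, hence the factor \<open>DIM('a) - 1\<close>.\<close>
    have 1: "(\<Sum>b\<in>Basis. (x \<bullet> b)\<^sup>2) = 1"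
      using inner_self_sphere[OF x] euclidean_inner[of x x] by (simp add: power2_eq_square)
    have 2: "(\<Sum>b\<in>Basis. (x \<bullet> b) * (y \<bullet> b)) = x \<bullet> y"
      by (rule euclidean_inner[symmetric])
    have 3: "(\<Sum>b\<in>Basis. (x \<bullet> b) * (?g x \<bullet> b)) = 0"
      using sphere_gradient_tangent[OF \<phi> x] euclidean_inner[of x "?g x"] by (simp add: inner_commute)
    have I_eq: "I b x = (k (x \<bullet> y) * (?g x \<bullet> y) + \<phi> x * k' (x \<bullet> y)) * (x \<bullet> b)\<^sup>2
       - (k (x \<bullet> y) * (x \<bullet> y)) * ((x \<bullet> b) * (?g x \<bullet> b))
       + (\<phi> x * k (x \<bullet> y) - \<phi> x * k' (x \<bullet> y) * (x \<bullet> y)) * ((x \<bullet> b) * (y \<bullet> b))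
       - \<phi> x * k (x \<bullet> y) * (x \<bullet> y)" for b
      by (simp add: I_def power2_eq_square algebra_simps)
    have "(\<Sum>b\<in>Basis. I b x) = (k (x \<bullet> y) * (?g x \<bullet> y) + \<phi> x * k' (x \<bullet> y)) * (\<Sum>b\<in>Basis. (x \<bullet> b)\<^sup>2)
       - (k (x \<bullet> y) * (x \<bullet> y)) * (\<Sum>b\<in>Basis. (x \<bullet> b) * (?g x \<bullet> b))
       + (\<phi> x * k (x \<bullet> y) - \<phi> x * k' (x \<bullet> y) * (x \<bullet> y)) * (\<Sum>b\<in>Basis. (x \<bullet> b) * (y \<bullet> b))
       - real DIM('a) * (\<phi> x * k (x \<bullet> y) * (x \<bullet> y))"
      by (simp only: I_eq sum.distrib sum_subtractf sum_distrib_left[symmetric] sum_constant, simp)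
    also have "\<dots> = k (x \<bullet> y) * (?g x \<bullet> y)
       - ((real DIM('a) - 1) * (x \<bullet> y) * k (x \<bullet> y) - (1 - (x \<bullet> y)\<^sup>2) * k' (x \<bullet> y)) * \<phi> x"
      unfolding 1 2 3 by (simp add: power2_eq_square algebra_simps)
    finally show "(\<Sum>b\<in>Basis. I b x) = \<dots>" .
  qed
  also have "\<dots> = (LINT x|sphere_measure. k (x \<bullet> y) * (?g x \<bullet> y)) - (LINT x|sphere_measure.
       ((real DIM('a) - 1) * (x \<bullet> y) * k (x \<bullet> y) - (1 - (x \<bullet> y)\<^sup>2) * k' (x \<bullet> y)) * \<phi> x)"
    by (intro Bochner_Integration.integral_diff continuous_on_sphere_integrable continuous_intros cont
          continuous_on_compose2[OF ck] continuous_on_compose2[OF k']) auto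
  finally show ?thesis by simp
qed

section \<open>Maximum principles\<close>

lemma closed_sphere_halfspace: "closed {x \<in> sphere 0 1. c \<le> x \<bullet> (y::'a::euclidean_space)}"
  using closed_Int[OF closed_sphere[of "0::'a" 1] closed_halfspace_ge[of c y]]
  by (simp add: Int_def inner_commute)

lemma openin_sphere_halfspace:
  "openin (top_of_set (sphere 0 1)) {x \<in> sphere 0 1. c < x \<bullet> (y::'a::euclidean_space)}"
  using open_halfspace_gt[of c y] by (auto simp: openin_open inner_commute)

lemma sphere_eventually_in:
  "openin (top_of_set (sphere 0 1)) A \<Longrightarrow> x \<in> A \<Longrightarrow> eventually (\<lambda>z. z \<in> A) (at x within sphere 0 1)"
  by (auto simp: openin_open eventually_at_topological)

text \<open>The weak form of \<open>-\<Delta>w \<ge> 0\<close> in \<open>A\<close>. Test functions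
  need only vanish outside \<open>A\<close>, without compact support in it, so that truncations of
  solutions can be tested.\<close>

definition weakly_superharmonic_on :: "'a::euclidean_space set \<Rightarrow> ('a \<Rightarrow> real) \<Rightarrow> bool" where
  "weakly_superharmonic_on A w \<longleftrightarrow> C1_sphere w \<and>
     (\<forall>\<phi>. C1_sphere \<phi> \<longrightarrow> (\<forall>x\<in>sphere 0 1. 0 \<le> \<phi> x) \<longrightarrow> (\<forall>x\<in>sphere 0 1 - A. \<phi> x = 0) \<longrightarrow>
        0 \<le> (LINT x|sphere_measure. sphere_gradient w x \<bullet> sphere_gradient \<phi> x))"

lemma weakly_superharmonic_on_subset:
  "weakly_superharmonic_on A w \<Longrightarrow> B \<subseteq> A \<Longrightarrow> weakly_superharmonic_on B w"
  unfolding weakly_superharmonic_on_def by blast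

lemma integrable_gradient_inner:
  "C1_sphere u \<Longrightarrow> C1_sphere \<phi> \<Longrightarrow>
     integrable sphere_measure (\<lambda>x. sphere_gradient u x \<bullet> sphere_gradient \<phi> x)"
  by (intro continuous_on_sphere_integrable continuous_intros continuous_on_sphere_gradient)

lemma integral_nonpos_on_sphere:
  fixes f :: "'a::euclidean_space \<Rightarrow> real"
  assumes "\<And>x. x \<in> sphere 0 1 \<Longrightarrow> f x \<le> 0"
  shows "(LINT x|sphere_measure. f x) \<le> 0"
proof -
  have "0 \<le> (LINT x|sphere_measure. - f x)"
    using assms by (intro integral_nonneg_AE AE_I2) simp
  then show ?thesis by simp
qed

lemma neg_part_square_derivative:
  "((\<lambda>s::real. (min s 0)\<^sup>2) has_real_derivative 2 * min s 0) (at s)"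
proof -
  consider "s < 0" | "s > 0" | "s = 0" by linarith
  then show ?thesis
  proof cases
    case 1
    have "((\<lambda>s::real. s\<^sup>2) has_real_derivative 2 * min s 0) (at s)"
      using 1 by (auto intro!: derivative_eq_intros)
    then show ?thesis
      by (rule has_field_derivative_transform_within_open[where S = "{..<0}"]) (use 1 in auto)
  next
    case 2
    have "((\<lambda>s::real. 0) has_real_derivative 2 * min s 0) (at s)"
      using 2 by auto
    then show ?thesis
      by (rule has_field_derivative_transform_within_open[where S = "{0<..}"]) (use 2 in auto)
  next
    case 3
    have "(\<lambda>h::real. min h 0) \<midarrow>0\<rightarrow> min 0 0"
      by (intro tendsto_intros)
    \<comment> \<open>For \<open>h = 0\<close> both sides are \<open>0\<close>, by the convention
      for division by zero.\<close>
    moreover have "((min (0 + h) 0)\<^sup>2 - (min (0::real) 0)\<^sup>2) / h = min h 0" for h :: real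
      by (auto simp: min_def power2_eq_square)
    ultimately show ?thesis
      using 3 by (simp add: DERIV_def)
  qed
qed

text \<open>
  Squaring makes the truncation \<open>C\<^sup>1\<close> both where \<open>W\<close> changes sign and across the boundary of
  \<open>A\<close>, so that it is an admissible test function without any regularity of \<open>A\<close>.
\<close>

lemma C1_sphere_with_truncation:
  fixes W :: "'a::euclidean_space \<Rightarrow> real"
  assumes A: "openin (top_of_set (sphere 0 1)) A" and W: "C1_sphere W"
    and bd: "\<And>x. x \<in> closure A \<Longrightarrow> x \<notin> A \<Longrightarrow> 0 \<le> W x"
  defines "\<psi> \<equiv> \<lambda>x. if x \<in> A then min (W x) 0 else 0"
  shows "C1_sphere_with (\<lambda>x. (\<psi> x)\<^sup>2) (\<lambda>x. (2 * \<psi> x) *\<^sub>R sphere_gradient W x)"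
    and "continuous_on (sphere 0 1) \<psi>"
proof -
  have cW: "continuous_on (sphere 0 1) W" by (rule C1_sphere_continuous_on[OF W])
  have near: "eventually (\<lambda>z. \<psi> z = min (W z) 0) (at x within sphere 0 1)" if "x \<in> A" for x
    using sphere_eventually_in[OF A that] by eventually_elim (simp add: \<psi>_def)
  \<comment> \<open>At a boundary point \<open>W x \<ge> 0\<close>, so the negative part of
    \<open>W z\<close> cannot exceed the distance from \<open>W z\<close> to \<open>W x\<close>.
    Away from the closure of \<open>A\<close>, \<open>\<psi>\<close> is zero nearby.\<close>
  have bound: "eventually (\<lambda>z. \<bar>\<psi> z\<bar> \<le> \<bar>W z - W x\<bar>) (at x within sphere 0 1)"
    if "x \<notin> A" for x
  proof (cases "x \<in> closure A")
    case True
    then have "0 \<le> W x" using bd that by blast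
    then show ?thesis by (intro always_eventually allI) (auto simp: \<psi>_def min_def)
  next
    case False
    then have "eventually (\<lambda>z. z \<in> - closure A) (at x within sphere 0 1)"
      by (intro topological_tendstoD[OF tendsto_ident_at]) auto
    then show ?thesis
      by eventually_elim (use closure_subset[of A] in \<open>auto simp: \<psi>_def\<close>)
  qed
  have Wlim: "(W \<longlongrightarrow> W x) (at x within sphere 0 1)" if "x \<in> sphere 0 1" for x
    using cW that by (auto simp: continuous_on_def)
  show c\<psi>: "continuous_on (sphere 0 1) \<psi>"
    unfolding continuous_on_def
  proof
    fix x :: 'a assume x: "x \<in> sphere 0 1"
    show "(\<psi> \<longlongrightarrow> \<psi> x) (at x within sphere 0 1)"
    proof (cases "x \<in> A")
      case True
      have "((\<lambda>z. min (W z) 0) \<longlongrightarrow> min (W x) 0) (at x within sphere 0 1)"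
        by (intro tendsto_intros Wlim x)
      then have "(\<psi> \<longlongrightarrow> min (W x) 0) (at x within sphere 0 1)"
        by (rule Lim_transform_eventually)
          (use near[OF True] in eventually_elim, simp)
      then show ?thesis using True by (simp add: \<psi>_def)
    next
      case False
      have "((\<lambda>z. \<bar>W z - W x\<bar>) \<longlongrightarrow> \<bar>W x - W x\<bar>) (at x within sphere 0 1)"
        by (intro tendsto_intros Wlim x)
      then have "(\<psi> \<longlongrightarrow> 0) (at x within sphere 0 1)"
        using bound[OF False] by (intro Lim_null_comparison[of \<psi> "\<lambda>z. \<bar>W z - W x\<bar>"]) auto
      then show ?thesis using False by (simp add: \<psi>_def)
    qed
  qed
  show "C1_sphere_with (\<lambda>x. (\<psi> x)\<^sup>2) (\<lambda>x. (2 * \<psi> x) *\<^sub>R sphere_gradient W x)"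
    unfolding C1_sphere_with_def
  proof (intro conjI ballI)
    show "continuous_on (sphere 0 1) (\<lambda>x. (2 * \<psi> x) *\<^sub>R sphere_gradient W x)"
      by (intro continuous_intros c\<psi> continuous_on_sphere_gradient W)
    fix x :: 'a assume x: "x \<in> sphere 0 1"
    show "has_sphere_gradient (\<lambda>x. (\<psi> x)\<^sup>2) ((2 * \<psi> x) *\<^sub>R sphere_gradient W x) x"
    proof (cases "x \<in> A")
      case True
      have "C1_sphere_with (\<lambda>x. (min (W x) 0)\<^sup>2) (\<lambda>x. (2 * min (W x) 0) *\<^sub>R sphere_gradient W x)"
        by (rule C1_sphere_with_compose[OF C1_sphere_withI[OF W] neg_part_square_derivative])
          (intro continuous_intros)
      then have *: "has_sphere_gradient (\<lambda>x. (min (W x) 0)\<^sup>2) ((2 * min (W x) 0) *\<^sub>R sphere_gradient W x) x"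
        using x unfolding C1_sphere_with_def by blast
      have "((\<lambda>x. (\<psi> x)\<^sup>2) has_derivative (\<lambda>h. ((2 * min (W x) 0) *\<^sub>R sphere_gradient W x) \<bullet> h)) (at x within sphere 0 1)"
        by (rule has_derivative_transform_eventually[where f = "\<lambda>x. (min (W x) 0)\<^sup>2"])
          (use * True near[OF True] x in \<open>auto simp: has_sphere_gradient_def \<psi>_def elim: eventually_mono\<close>)
      then show ?thesis
        using * True by (simp add: has_sphere_gradient_def \<psi>_def)
    next
      case False
      \<comment> \<open>The square of a differentiable increment is of smaller order than
        \<open>norm (z - x)\<close> and dominates the square of \<open>\<psi>\<close>, so the
        truncation has gradient zero at \<open>x\<close>.\<close>
      have "((\<lambda>z. (W z - W x)\<^sup>2) has_derivative (\<lambda>h. 0)) (at x within sphere 0 1)"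
      proof -
        have "(W has_derivative (\<lambda>h. sphere_gradient W x \<bullet> h)) (at x within sphere 0 1)"
          using has_sphere_gradient_sphere_gradient[OF W x] by (simp add: has_sphere_gradient_def)
        then show ?thesis
          by (auto intro!: derivative_eq_intros)
      qed
      then have lim: "((\<lambda>z. (W z - W x)\<^sup>2 / norm (z - x)) \<longlongrightarrow> 0) (at x within sphere 0 1)"
        by (simp add: has_derivative_iff_norm)
      have "((\<lambda>z. (\<psi> z)\<^sup>2 / norm (z - x)) \<longlongrightarrow> 0) (at x within sphere 0 1)"
      proof (rule Lim_null_comparison[OF _ lim])
        show "\<forall>\<^sub>F z in at x within sphere 0 1. norm ((\<psi> z)\<^sup>2 / norm (z - x)) \<le> (W z - W x)\<^sup>2 / norm (z - x)"
          using bound[OF False] by eventually_elim (auto intro!: divide_right_mono simp: abs_le_square_iff)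
      qed
      then have "((\<lambda>x. (\<psi> x)\<^sup>2) has_derivative (\<lambda>h. 0)) (at x within sphere 0 1)"
        using False by (simp add: has_derivative_iff_norm \<psi>_def)
      then show ?thesis
        using False by (simp add: has_sphere_gradient_def \<psi>_def)
    qed
  qed
qed

text \<open>Let \<open>\<psi>\<close> be the negative part of \<open>W\<close> on \<open>A\<close>,
  taken with its sign. Testing with its square gives
  \<open>0 \<le> \<integral> 2 \<psi> |\<nabla>W|^2\<close>, whose integrand is nonpositive and
  hence zero. So the square of \<open>\<psi>\<close> has zero gradient and is constant; the point
  \<open>x0\<close> outside \<open>A\<close> makes the constant zero.\<close>

lemma weak_maximum_principle:
  fixes W :: "'a::euclidean_space \<Rightarrow> real"
  assumes dim: "DIM('a) \<ge> 2" and A: "openin (top_of_set (sphere 0 1)) A"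
    and x0: "x0 \<in> sphere 0 1" "x0 \<notin> A" and W: "weakly_superharmonic_on A W"
    and bd: "\<And>x. x \<in> closure A \<Longrightarrow> x \<notin> A \<Longrightarrow> 0 \<le> W x" and x: "x \<in> A"
  shows "0 \<le> W x"
proof -
  define \<psi> where "\<psi> x = (if x \<in> A then min (W x) 0 else 0)" for x
  have C1: "C1_sphere W" using W by (simp add: weakly_superharmonic_on_def)
  note trunc = C1_sphere_with_truncation[OF A C1 bd, folded \<psi>_def]
  have \<psi>: "\<psi> x \<le> 0" for x by (simp add: \<psi>_def)
  have "0 \<le> (LINT x|sphere_measure. sphere_gradient W x \<bullet> sphere_gradient (\<lambda>x. (\<psi> x)\<^sup>2) x)"
    using W C1_sphere_withD(1)[OF trunc(1)] unfolding weakly_superharmonic_on_def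
    by (simp add: \<psi>_def)
  also have "\<dots> = (LINT x|sphere_measure. 2 * \<psi> x * (sphere_gradient W x \<bullet> sphere_gradient W x))"
    by (intro Bochner_Integration.integral_cong refl) (simp add: C1_sphere_withD(2)[OF trunc(1)])
  finally have "(LINT x|sphere_measure. - (2 * \<psi> x * (sphere_gradient W x \<bullet> sphere_gradient W x))) \<le> 0"
    by simp
  then have "- (2 * \<psi> x * (sphere_gradient W x \<bullet> sphere_gradient W x)) = 0" if "x \<in> sphere 0 1" for x
    by (rule integral_nonpos_imp_zero_on_sphere[rotated 2])
      (use that \<psi> in \<open>auto intro!: continuous_intros trunc(2) continuous_on_sphere_gradient C1
        simp: mult_nonpos_nonneg\<close>)
  then have "sphere_gradient (\<lambda>x. (\<psi> x)\<^sup>2) x = 0" if "x \<in> sphere 0 1" for x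
    using that C1_sphere_withD(2)[OF trunc(1) that] by auto
  moreover have "x \<in> sphere 0 1"
    using A x openin_imp_subset by blast
  ultimately have "(\<psi> x)\<^sup>2 = (\<psi> x0)\<^sup>2"
    using C1_sphere_gradient_zero_imp_const[OF dim C1_sphere_withD(1)[OF trunc(1)] _ x0(1)] by blast
  then show ?thesis
    using x x0 by (simp add: \<psi>_def min_def split: if_splits)
qed

text \<open>For a function \<open>h(s)\<close> of \<open>s = x \<bullet> y\<close> the Laplacian is
  \<open>(1 - s^2) h'' - (DIM('a) - 1) s h'\<close>, where \<open>k\<close> and \<open>k'\<close>
  stand for \<open>h'\<close> and \<open>h''\<close>. All comparison functions below are of this
  form.\<close>

lemma zonal_weak_laplacian:
  fixes \<phi> :: "'a::euclidean_space \<Rightarrow> real"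
  assumes h: "\<And>s. (h has_real_derivative k s) (at s)"
    and k: "\<And>s. (k has_real_derivative k' s) (at s)" and k': "continuous_on UNIV k'"
  shows "C1_sphere_with (\<lambda>x. h (x \<bullet> y)) (\<lambda>x. k (x \<bullet> y) *\<^sub>R (y - (x \<bullet> y) *\<^sub>R x))"
    and "C1_sphere \<phi> \<Longrightarrow> y \<in> sphere 0 1 \<Longrightarrow>
     (LINT x|sphere_measure. sphere_gradient (\<lambda>x. h (x \<bullet> y)) x \<bullet> sphere_gradient \<phi> x) =
     (LINT x|sphere_measure.
        ((real DIM('a) - 1) * (x \<bullet> y) * k (x \<bullet> y) - (1 - (x \<bullet> y)\<^sup>2) * k' (x \<bullet> y)) * \<phi> x)"
proof -
  have ck: "continuous_on UNIV k"
    using k by (meson DERIV_isCont continuous_at_imp_continuous_on)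
  show C: "C1_sphere_with (\<lambda>x. h (x \<bullet> y)) (\<lambda>x. k (x \<bullet> y) *\<^sub>R (y - (x \<bullet> y) *\<^sub>R x))"
    by (rule C1_sphere_with_compose[OF C1_sphere_with_inner h ck])
  assume \<phi>: "C1_sphere \<phi>" and y: "y \<in> sphere 0 1"
  show "(LINT x|sphere_measure. sphere_gradient (\<lambda>x. h (x \<bullet> y)) x \<bullet> sphere_gradient \<phi> x) =
     (LINT x|sphere_measure.
        ((real DIM('a) - 1) * (x \<bullet> y) * k (x \<bullet> y) - (1 - (x \<bullet> y)\<^sup>2) * k' (x \<bullet> y)) * \<phi> x)"
    unfolding Green_zonal[OF \<phi> y k k', symmetric]
  proof (intro Bochner_Integration.integral_cong refl)
    fix x :: 'a assume "x \<in> space sphere_measure"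
    then have x: "x \<in> sphere 0 1" by simp
    show "sphere_gradient (\<lambda>x. h (x \<bullet> y)) x \<bullet> sphere_gradient \<phi> x = k (x \<bullet> y) * (sphere_gradient \<phi> x \<bullet> y)"
      using sphere_gradient_tangent[OF \<phi> x]
      by (simp add: C1_sphere_withD(2)[OF C x] inner_diff_left inner_diff_right inner_commute)
  qed
qed

section \<open>Distances and caps on the sphere\<close>

lemma sphere_dist_inner:
  assumes "x \<in> sphere 0 1" "y \<in> sphere (0::'a::euclidean_space) 1"
  shows "(norm (x - y))\<^sup>2 = 2 - 2 * (x \<bullet> y)"
  using inner_self_sphere[OF assms(1)] inner_self_sphere[OF assms(2)]
  by (simp add: power2_norm_eq_inner inner_diff_left inner_diff_right inner_commute)

lemma sphere_inner_le_1:
  assumes "x \<in> sphere 0 1" "y \<in> sphere (0::'a::euclidean_space) 1"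
  shows "x \<bullet> y \<le> 1"
  using sphere_dist_inner[OF assms] zero_le_power2[of "norm (x - y)"] by linarith

lemma sphere_inner_eq_1:
  assumes "x \<in> sphere 0 1" "y \<in> sphere (0::'a::euclidean_space) 1" "x \<bullet> y = 1"
  shows "x = y"
  using sphere_dist_inner[OF assms(1,2)] assms(3) by simp

lemma sphere_cap_subset_open:
  fixes z :: "'a::euclidean_space"
  assumes A: "openin (top_of_set (sphere 0 1)) A" and z: "z \<in> A"
  obtains c where "0 \<le> c" "c < 1" "{x \<in> sphere 0 1. c \<le> x \<bullet> z} \<subseteq> A"
proof -
  have zS: "z \<in> sphere 0 1" using A z openin_imp_subset by blast
  obtain r where r: "r > 0" "ball z r \<inter> sphere 0 1 \<subseteq> A"
    using A z by (meson openin_contains_ball)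
  \<comment> \<open>On the sphere \<open>norm (x - z)\<close> squared is
    \<open>2 - 2 (x \<bullet> z)\<close>, at most \<open>r^2 / 2\<close> at this level. The maximum
    with \<open>0\<close> keeps the cap in a hemisphere, so that \<open>- z\<close> stays
    outside.\<close>
  define c where "c = max 0 (1 - r\<^sup>2 / 4)"
  show thesis
  proof (rule that[of c])
    show "0 \<le> c" "c < 1" using r by (auto simp: c_def)
    show "{x \<in> sphere 0 1. c \<le> x \<bullet> z} \<subseteq> A"
    proof
      fix x assume "x \<in> {x \<in> sphere 0 1. c \<le> x \<bullet> z}"
      then have x: "x \<in> sphere 0 1" "c \<le> x \<bullet> z" by auto
      have "0 < r\<^sup>2" using r by simp
      then have "(norm (x - z))\<^sup>2 < r\<^sup>2"
        using x(2) unfolding sphere_dist_inner[OF x(1) zS] c_def by linarith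
      then have "norm (x - z) < r"
        using r(1) power2_less_imp_less by fastforce
      then show "x \<in> A"
        using r(2) x(1) by (auto simp: dist_norm norm_minus_commute)
    qed
  qed
qed

text \<open>Comparison on a small cap around a point with a solution that is positive at the centre.\<close>

lemma strict_supersolution_pos:
  fixes W :: "'a::euclidean_space \<Rightarrow> real"
  assumes dim: "DIM('a) \<ge> 2" and A: "openin (top_of_set (sphere 0 1)) A"
    and W: "C1_sphere W" and nonneg: "\<And>x. x \<in> A \<Longrightarrow> 0 \<le> W x" and \<kappa>: "\<kappa> > 0"
    and eq: "\<And>\<phi>. C1_sphere \<phi> \<Longrightarrow> (\<forall>x\<in>sphere 0 1. 0 \<le> \<phi> x) \<Longrightarrow> (\<forall>x\<in>sphere 0 1 - A. \<phi> x = 0) \<Longrightarrow>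
       \<kappa> * (LINT x|sphere_measure. \<phi> x) \<le> (LINT x|sphere_measure. sphere_gradient W x \<bullet> sphere_gradient \<phi> x)"
    and z: "z \<in> A"
  shows "0 < W z"
proof -
  have zS: "z \<in> sphere 0 1" using A z openin_imp_subset by blast
  obtain c where c: "0 \<le> c" "c < 1" "{x \<in> sphere 0 1. c \<le> x \<bullet> z} \<subseteq> A"
    using sphere_cap_subset_open[OF A z] .
  define C where "C = {x \<in> sphere 0 1. c < x \<bullet> z}"
  define N where "N = real DIM('a) - 1"
  have N: "N > 0" using dim by (simp add: N_def)
  \<comment> \<open>\<open>x \<bullet> z\<close> is an eigenfunction of \<open>-\<Delta>\<close>
    with eigenvalue \<open>N\<close>, so \<open>-\<Delta>\<close> of this function is
    \<open>\<kappa> (x \<bullet> z)\<close>, at most \<open>\<kappa>\<close>. It vanishes on the rim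
    of the cap and is positive at its centre.\<close>
  define h where "h s = \<kappa> / N * (s - c)" for s
  have h: "(h has_real_derivative \<kappa> / N) (at s)" for s
    unfolding h_def using N by (auto intro!: derivative_eq_intros)
  have k: "((\<lambda>s. \<kappa> / N) has_real_derivative 0) (at s)" for s :: real
    by simp
  note zon = zonal_weak_laplacian[OF h k continuous_on_const]
  note V = C1_sphere_withD(1)[OF zon(1), of z]
  note D = C1_sphere_with_diff[OF C1_sphere_withI[OF W] C1_sphere_withI[OF V]]
  have "0 \<le> W z - h (z \<bullet> z)"
  proof (rule weak_maximum_principle[OF dim, where A = C and ?x0.0 = "- z" and W = "\<lambda>x. W x - h (x \<bullet> z)"])
    show "openin (top_of_set (sphere 0 1)) C"
      unfolding C_def by (rule openin_sphere_halfspace)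
    show "- z \<in> sphere 0 1" "- z \<notin> C" "z \<in> C"
      using zS c inner_self_sphere[OF zS] by (auto simp: C_def)
    have "closure C \<subseteq> {x \<in> sphere 0 1. c \<le> x \<bullet> z}"
      by (rule closure_minimal[OF _ closed_sphere_halfspace]) (auto simp: C_def)
    then show "0 \<le> W x - h (x \<bullet> z)" if "x \<in> closure C" "x \<notin> C" for x
      using that c(3) nonneg[of x] by (force simp: C_def h_def)
    show "weakly_superharmonic_on C (\<lambda>x. W x - h (x \<bullet> z))"
      unfolding weakly_superharmonic_on_def
    proof (intro conjI allI impI)
      show "C1_sphere (\<lambda>x. W x - h (x \<bullet> z))" by (rule C1_sphere_withD(1)[OF D])
      fix \<phi> :: "'a \<Rightarrow> real"
      assume \<phi>: "C1_sphere \<phi>" "\<forall>x\<in>sphere 0 1. 0 \<le> \<phi> x" "\<forall>x\<in>sphere 0 1 - C. \<phi> x = 0"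
      have "C \<subseteq> A" using c(3) by (force simp: C_def)
      then have "\<forall>x\<in>sphere 0 1 - A. \<phi> x = 0" using \<phi>(3) by blast
      note le = eq[OF \<phi>(1,2) this]
      have c\<phi>: "continuous_on (sphere 0 1) \<phi>" by (rule C1_sphere_continuous_on[OF \<phi>(1)])
      have "(LINT x|sphere_measure. sphere_gradient (\<lambda>x. h (x \<bullet> z)) x \<bullet> sphere_gradient \<phi> x)
          = (LINT x|sphere_measure. \<kappa> * ((x \<bullet> z) * \<phi> x))"
        unfolding zon(2)[OF \<phi>(1) zS] N_def[symmetric]
        using N by (intro Bochner_Integration.integral_cong) auto
      also have "\<dots> \<le> (LINT x|sphere_measure. \<kappa> * \<phi> x)"
      proof (intro integral_mono continuous_on_sphere_integrable continuous_intros c\<phi>)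
        fix x :: 'a assume "x \<in> space sphere_measure"
        then have x: "x \<in> sphere 0 1" by simp
        have "(x \<bullet> z) * \<phi> x \<le> 1 * \<phi> x"
          using sphere_inner_le_1[OF x zS] \<phi>(2) x by (intro mult_right_mono) auto
        then show "\<kappa> * ((x \<bullet> z) * \<phi> x) \<le> \<kappa> * \<phi> x"
          using \<kappa> by simp
      qed
      also have "\<dots> \<le> (LINT x|sphere_measure. sphere_gradient W x \<bullet> sphere_gradient \<phi> x)"
        using le by simp
      finally have "0 \<le> (LINT x|sphere_measure. sphere_gradient W x \<bullet> sphere_gradient \<phi> x)
          - (LINT x|sphere_measure. sphere_gradient (\<lambda>x. h (x \<bullet> z)) x \<bullet> sphere_gradient \<phi> x)"
        by simp
      also have "(LINT x|sphere_measure. sphere_gradient W x \<bullet> sphere_gradient \<phi> x)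
          - (LINT x|sphere_measure. sphere_gradient (\<lambda>x. h (x \<bullet> z)) x \<bullet> sphere_gradient \<phi> x)
         = (LINT x|sphere_measure. sphere_gradient (\<lambda>x. W x - h (x \<bullet> z)) x \<bullet> sphere_gradient \<phi> x)"
        by (subst Bochner_Integration.integral_diff[symmetric])
          (auto intro!: integrable_gradient_inner W V \<phi>(1) Bochner_Integration.integral_cong
            simp: C1_sphere_withD(2)[OF D] inner_diff_left)
      finally show "0 \<le> (LINT x|sphere_measure. sphere_gradient (\<lambda>x. W x - h (x \<bullet> z)) x \<bullet> sphere_gradient \<phi> x)" .
    qed
  qed
  moreover have "h (z \<bullet> z) > 0"
    using c \<kappa> N by (simp add: h_def inner_self_sphere[OF zS])
  ultimately show ?thesis by linarith
qed

text \<open>Normalise the component of \<open>y\<close> orthogonal to \<open>z\<close>. Then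
  \<open>\<tau>\<close> is the direction at \<open>z\<close> of the great circle towards
  \<open>y\<close>, and \<open>r\<close> is the rate at which the inner product with
  \<open>y\<close> grows along it; this turns statements about \<open>y\<close> at \<open>z\<close>
  into derivatives along a curve.\<close>

lemma tangent_direction:
  fixes y z :: "'a::euclidean_space"
  assumes y: "y \<in> sphere 0 1" and z: "z \<in> sphere 0 1" and c: "\<bar>z \<bullet> y\<bar> < 1"
  obtains \<tau> r where "\<tau> \<in> sphere 0 1" "z \<bullet> \<tau> = 0" "0 < r" "y = (z \<bullet> y) *\<^sub>R z + r *\<^sub>R \<tau>" "\<tau> \<bullet> y = r"
    "r\<^sup>2 = 1 - (z \<bullet> y)\<^sup>2"
proof -
  define w where "w = y - (z \<bullet> y) *\<^sub>R z"
  define r where "r = norm w"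
  have zw: "z \<bullet> w = 0"
    by (simp add: w_def inner_diff_right inner_self_sphere[OF z])
  have yw: "y \<bullet> w = 1 - (z \<bullet> y)\<^sup>2"
    by (simp add: w_def inner_diff_right inner_self_sphere[OF y] power2_eq_square inner_commute)
  have ww: "w \<bullet> w = 1 - (z \<bullet> y)\<^sup>2"
  proof -
    have "w \<bullet> w = y \<bullet> w - (z \<bullet> y) * (z \<bullet> w)"
      by (subst w_def) (simp add: inner_diff_left)
    then show ?thesis by (simp add: zw yw)
  qed
  have "(z \<bullet> y)\<^sup>2 < 1" using c by (simp add: abs_square_less_1)
  then have "w \<noteq> 0" using ww by auto
  then have r: "0 < r" by (simp add: r_def)
  have r2: "r\<^sup>2 = w \<bullet> w" by (simp add: r_def power2_norm_eq_inner)
  show thesis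
  proof (rule that[of "w /\<^sub>R r" r])
    show "w /\<^sub>R r \<in> sphere 0 1" using r by (simp add: r_def)
    show "y = (z \<bullet> y) *\<^sub>R z + r *\<^sub>R (w /\<^sub>R r)" using r by (simp add: w_def)
    show "(w /\<^sub>R r) \<bullet> y = r"
      using r r2 ww yw by (simp add: inner_commute power2_eq_square field_simps)
  qed (use r zw r2 ww in auto)
qed

text \<open>
  The barrier is a multiple of \<open>exp (a s) - exp (a c)\<close> with \<open>s = x \<bullet> y\<close>, whose Laplacian
  is \<open>a (a (1 - s\<^sup>2) - N s) exp (a s)\<close> up to that factor. It is nonnegative between the levels
  \<open>c\<close> and \<open>c'\<close> for \<open>a = N / k0\<close>.
\<close>

lemma Hopf_lemma:
  fixes w :: "'a::euclidean_space \<Rightarrow> real"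
  assumes dim: "DIM('a) \<ge> 2" and y: "y \<in> sphere 0 1" and c: "- 1 < c" "c < 1"
    and w: "weakly_superharmonic_on {x \<in> sphere 0 1. c < x \<bullet> y} w"
    and pos: "\<And>x. x \<in> sphere 0 1 \<Longrightarrow> c < x \<bullet> y \<Longrightarrow> 0 < w x"
    and nonneg: "\<And>x. x \<in> sphere 0 1 \<Longrightarrow> x \<bullet> y = c \<Longrightarrow> 0 \<le> w x"
    and z: "z \<in> sphere 0 1" "z \<bullet> y = c" and wz: "w z = 0"
  shows "0 < sphere_gradient w z \<bullet> y"
proof -
  have C1w: "C1_sphere w" using w by (simp add: weakly_superharmonic_on_def)
  define N where "N = real DIM('a) - 1"
  have N: "N > 0" using dim by (simp add: N_def)
  \<comment> \<open>The comparison takes place in the annulus between the levels \<open>c\<close>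
    and \<open>c'\<close>, because the barrier needs \<open>1 - s^2\<close> bounded away from zero,
    which fails at the centre. Any level strictly between \<open>c\<close> and \<open>1\<close>
    would do.\<close>
  define c' where "c' = (c + 1) / 2"
  have c': "c < c'" "c' < 1" "- 1 < c'" using c by (auto simp: c'_def)
  define A where "A = {x \<in> sphere 0 1. c < x \<bullet> y} \<inter> {x \<in> sphere 0 1. - c' < x \<bullet> (- y)}"
  have A_iff: "x \<in> A \<longleftrightarrow> x \<in> sphere 0 1 \<and> c < x \<bullet> y \<and> x \<bullet> y < c'" for x
    by (auto simp: A_def)
  have Aop: "openin (top_of_set (sphere 0 1)) A"
    unfolding A_def by (intro openin_Int openin_sphere_halfspace)
  obtain m where m: "m > 0" "\<And>x. x \<in> sphere 0 1 \<Longrightarrow> x \<bullet> y = c' \<Longrightarrow> m \<le> w x"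
  proof -
    define K where "K = sphere (0::'a) 1 \<inter> {x. y \<bullet> x = c'}"
    have K: "compact K" unfolding K_def by (intro compact_Int_closed compact_sphere closed_hyperplane)
    show thesis
    proof (cases "K = {}")
      case True
      show thesis by (rule that[of 1]) (use True in \<open>auto simp: K_def inner_commute\<close>)
    next
      case False
      have "continuous_on K w"
        using C1_sphere_continuous_on[OF C1w] continuous_on_subset K_def by blast
      then obtain x0 where "x0 \<in> K" "\<forall>x\<in>K. w x0 \<le> w x"
        using continuous_attains_inf[OF K False] by blast
      then show thesis
        by (intro that[of "w x0"]) (use pos[of x0] c' in \<open>auto simp: K_def inner_commute\<close>)
    qed
  qed
  define k0 where "k0 = min (1 - c\<^sup>2) (1 - c'\<^sup>2)"
  have k0: "k0 > 0" using c c' by (auto simp: k0_def abs_square_less_1)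
  \<comment> \<open>\<open>1 - s^2\<close> is concave, so on the interval it is smallest at an
    end.\<close>
  have k0_le: "k0 \<le> 1 - s\<^sup>2" if "c < s" "s < c'" for s
  proof -
    have "0 \<le> (s - c) * (c' - s)" using that by simp
    then have *: "s\<^sup>2 \<le> s * (c + c') - c * c'" by (simp add: power2_eq_square algebra_simps)
    show ?thesis
    proof (cases "0 \<le> c + c'")
      case True
      then have "s * (c + c') \<le> c' * (c + c')" using that by (intro mult_right_mono) auto
      then show ?thesis using * by (simp add: k0_def power2_eq_square algebra_simps)
    next
      case False
      then have "s * (c + c') \<le> c * (c + c')" using that by (intro mult_right_mono_neg) auto
      then show ?thesis using * by (simp add: k0_def power2_eq_square algebra_simps)
    qed
  qed
  define a where "a = N / k0"
  have a: "a > 0" "N = a * k0" using N k0 by (auto simp: a_def)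
  define E where "E = exp (a * c') - exp (a * c)"
  have E: "E > 0" using a c' by (simp add: E_def)
  \<comment> \<open>Scaled so that the barrier equals \<open>m\<close> at level \<open>c'\<close>;
    at level \<open>c\<close> it is zero. Thus it lies below \<open>w\<close> on both rims of the
    annulus.\<close>
  define \<epsilon> where "\<epsilon> = m / E"
  have \<epsilon>: "\<epsilon> > 0" using m E by (simp add: \<epsilon>_def)
  define h where "h s = \<epsilon> * (exp (a * s) - exp (a * c))" for s
  define k where "k s = \<epsilon> * a * exp (a * s)" for s
  define k' where "k' s = \<epsilon> * a\<^sup>2 * exp (a * s)" for s
  have h: "(h has_real_derivative k s) (at s)" for s
    unfolding h_def k_def by (auto intro!: derivative_eq_intros)
  have k: "(k has_real_derivative k' s) (at s)" for s
    unfolding k_def k'_def by (auto intro!: derivative_eq_intros simp: power2_eq_square)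
  have ck': "continuous_on UNIV k'"
    unfolding k'_def by (intro continuous_intros)
  note zon = zonal_weak_laplacian[OF h k ck']
  note V = C1_sphere_withD(1)[OF zon(1), of y]
  note D = C1_sphere_with_diff[OF C1_sphere_withI[OF C1w] C1_sphere_withI[OF V]]
  define W where "W x = w x - h (x \<bullet> y)" for x
  note D = D[folded W_def]
  have W_nonneg: "0 \<le> W x" if "x \<in> A" for x
  proof (rule weak_maximum_principle[OF dim Aop y _ _ _ that])
    show "y \<notin> A" using c' by (simp add: A_iff inner_self_sphere[OF y])
    have "closure A \<subseteq> {x \<in> sphere 0 1. c \<le> x \<bullet> y} \<inter> {x \<in> sphere 0 1. - c' \<le> x \<bullet> (- y)}"
      by (intro closure_minimal closed_Int closed_sphere_halfspace) (auto simp: A_def)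
    then show "0 \<le> W x" if "x \<in> closure A" "x \<notin> A" for x
    proof -
      have "x \<in> sphere 0 1" "x \<bullet> y = c \<or> x \<bullet> y = c'"
        using that \<open>closure A \<subseteq> _\<close> by (auto simp: A_iff)
      then show ?thesis
        using nonneg[of x] m(2)[of x] E by (auto simp: W_def h_def \<epsilon>_def E_def)
    qed
    show "weakly_superharmonic_on A W"
      unfolding weakly_superharmonic_on_def
    proof (intro conjI allI impI)
      show "C1_sphere W" by (rule C1_sphere_withD(1)[OF D])
      fix \<phi> :: "'a \<Rightarrow> real"
      assume \<phi>: "C1_sphere \<phi>" "\<forall>x\<in>sphere 0 1. 0 \<le> \<phi> x" "\<forall>x\<in>sphere 0 1 - A. \<phi> x = 0"
      have "(LINT x|sphere_measure. sphere_gradient (\<lambda>x. h (x \<bullet> y)) x \<bullet> sphere_gradient \<phi> x) \<le> 0"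
        unfolding zon(2)[OF \<phi>(1) y] N_def[symmetric]
      proof (rule integral_nonpos_on_sphere)
        fix x :: 'a assume x: "x \<in> sphere 0 1"
        show "(N * (x \<bullet> y) * k (x \<bullet> y) - (1 - (x \<bullet> y)\<^sup>2) * k' (x \<bullet> y)) * \<phi> x \<le> 0"
        proof (cases "x \<in> A")
          case True
          have "a * k0 * (x \<bullet> y) \<le> a * k0 * 1"
            using a k0 sphere_inner_le_1[OF x y] by (intro mult_left_mono) auto
          also have "\<dots> \<le> a * (1 - (x \<bullet> y)\<^sup>2)"
            using a k0_le True by (auto simp: A_iff)
          finally have "(\<epsilon> * a * exp (a * (x \<bullet> y))) * (N * (x \<bullet> y) - a * (1 - (x \<bullet> y)\<^sup>2)) \<le> 0"
            using \<epsilon> a by (intro mult_nonneg_nonpos) auto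
          also have "(\<epsilon> * a * exp (a * (x \<bullet> y))) * (N * (x \<bullet> y) - a * (1 - (x \<bullet> y)\<^sup>2))
              = N * (x \<bullet> y) * k (x \<bullet> y) - (1 - (x \<bullet> y)\<^sup>2) * k' (x \<bullet> y)"
            by (simp add: k_def k'_def power2_eq_square algebra_simps)
          finally show ?thesis
            using \<phi>(2) x by (intro mult_nonpos_nonneg) auto
        next
          case False
          then show ?thesis using \<phi>(3) x by simp
        qed
      qed
      moreover have "0 \<le> (LINT x|sphere_measure. sphere_gradient w x \<bullet> sphere_gradient \<phi> x)"
        using w \<phi> unfolding weakly_superharmonic_on_def by (simp add: A_iff)
      ultimately have "0 \<le> (LINT x|sphere_measure. sphere_gradient w x \<bullet> sphere_gradient \<phi> x)
          - (LINT x|sphere_measure. sphere_gradient (\<lambda>x. h (x \<bullet> y)) x \<bullet> sphere_gradient \<phi> x)"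
        by simp
      also have "\<dots> = (LINT x|sphere_measure. sphere_gradient W x \<bullet> sphere_gradient \<phi> x)"
        by (subst Bochner_Integration.integral_diff[symmetric])
          (auto intro!: integrable_gradient_inner C1w V \<phi>(1) Bochner_Integration.integral_cong
            simp: C1_sphere_withD(2)[OF D] inner_diff_left)
      finally show "0 \<le> (LINT x|sphere_measure. sphere_gradient W x \<bullet> sphere_gradient \<phi> x)" .
    qed
  qed
  have "\<bar>c\<bar> < 1" using c by simp
  then obtain \<tau> r where \<tau>: "\<tau> \<in> sphere 0 1" "z \<bullet> \<tau> = 0" "0 < r" "y = c *\<^sub>R z + r *\<^sub>R \<tau>" "\<tau> \<bullet> y = r"
    "r\<^sup>2 = 1 - c\<^sup>2"
    using tangent_direction[OF y z(1), unfolded z(2)] by blast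
  define q where "q t = cos t *\<^sub>R z + sin t *\<^sub>R \<tau>" for t :: real
  have q: "q t \<in> sphere 0 1" for t unfolding q_def by (rule great_circle_in_sphere[OF z(1) \<tau>(1,2)])
  have q0: "q 0 = z" by (simp add: q_def)
  have Wz: "W z = 0" by (simp add: W_def wz z h_def)
  have dW: "((\<lambda>t. W (q t)) has_real_derivative sphere_gradient W z \<bullet> \<tau>) (at 0)"
    using C1_sphere_curve_derivative[OF C1_sphere_withD(1)[OF D] great_circle_derivative
        great_circle_in_sphere[OF z(1) \<tau>(1,2)], of 0]
    by (simp add: q_def)
  have dq: "((\<lambda>t. q t \<bullet> y) has_real_derivative r) (at 0)"
    unfolding q_def inner_add_left by (auto intro!: derivative_eq_intros simp: \<tau>(5))
  \<comment> \<open>The great circle from \<open>z\<close> towards \<open>y\<close> enters the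
    annulus, where \<open>W \<ge> 0 = W z\<close>. The slope of \<open>w\<close> is therefore at
    least that of the barrier, which is \<open>k c * r > 0\<close>.\<close>
  have "0 \<le> sphere_gradient W z \<bullet> \<tau>"
  proof (rule ccontr)
    assume "\<not> 0 \<le> sphere_gradient W z \<bullet> \<tau>"
    then obtain d1 where d1: "d1 > 0" "\<And>t. 0 < t \<Longrightarrow> t < d1 \<Longrightarrow> W (q t) < 0"
      using DERIV_neg_dec_right[OF dW] by (auto simp: q0 Wz)
    obtain d2 where d2: "d2 > 0" "\<And>t. 0 < t \<Longrightarrow> t < d2 \<Longrightarrow> c < q t \<bullet> y"
      using DERIV_pos_inc_right[OF dq \<tau>(3)] by (auto simp: q0 z)
    have "isCont (\<lambda>t. q t \<bullet> y) 0" using dq DERIV_isCont by blast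
    then have "eventually (\<lambda>t. q t \<bullet> y < c') (at 0)"
      unfolding isCont_def using c' by (intro order_tendstoD(2)) (auto simp: q0 z)
    then obtain d3 where d3: "d3 > 0" "\<And>t. t \<noteq> 0 \<Longrightarrow> \<bar>t\<bar> < d3 \<Longrightarrow> q t \<bullet> y < c'"
      by (auto simp: eventually_at)
    define t where "t = min d1 (min d2 d3) / 2"
    have t: "0 < t" "t < d1" "t < d2" "t < d3" using d1 d2 d3 by (auto simp: t_def)
    then have "q t \<in> A" using d2(2)[of t] d3(2)[of t] q by (simp add: A_iff)
    then show False using W_nonneg d1(2)[of t] t by fastforce
  qed
  also have "sphere_gradient W z \<bullet> \<tau> = sphere_gradient w z \<bullet> \<tau> - k c * r"
    using \<tau>(2,5) z
    by (simp add: C1_sphere_withD(2)[OF D] C1_sphere_withD(2)[OF zon(1)] inner_diff_left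
        inner_commute[of y])
  finally have "k c * r \<le> sphere_gradient w z \<bullet> \<tau>" by simp
  moreover have "k c * r > 0" using \<epsilon> a \<tau>(3) by (simp add: k_def)
  ultimately have "0 < r * (sphere_gradient w z \<bullet> \<tau>)" using \<tau>(3) by simp
  also have "\<dots> = sphere_gradient w z \<bullet> y"
    by (subst \<tau>(4)) (simp add: inner_add_right sphere_gradient_tangent[OF C1w z(1)])
  finally show ?thesis .
qed

text \<open>Along the great circle arc from \<open>p\<close> to a point of the set, the inner
  product with \<open>p\<close> is the cosine of the arc length, so it only decreases and
  \<open>P\<close> holds all the way. An abstract \<open>P\<close> covers open caps and closed
  hemispheres alike.\<close>

lemma connected_sphere_upper_set:
  fixes p :: "'a::euclidean_space"
  assumes dim: "DIM('a) \<ge> 2" and p: "p \<in> sphere 0 1"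
    and up: "\<And>s t. P s \<Longrightarrow> s \<le> t \<Longrightarrow> P t"
  shows "connected {x \<in> sphere 0 1. P (x \<bullet> p)}"
  unfolding connected_iff_connected_component
proof (intro ballI)
  let ?A = "{x \<in> sphere 0 1. P (x \<bullet> p)}"
  have "connected_component ?A p x" if "x \<in> ?A" for x
  proof -
    have x: "x \<in> sphere 0 1" "P (x \<bullet> p)" using that by auto
    obtain t v where v: "0 \<le> t" "t \<le> pi" "v \<in> sphere 0 1" "p \<bullet> v = 0"
      "x = cos t *\<^sub>R p + sin t *\<^sub>R v"
      using great_circle_through[OF dim p x(1)] .
    define q where "q s = cos s *\<^sub>R p + sin s *\<^sub>R v" for s
    have qp: "q s \<bullet> p = cos s" for s
      using v(4) by (simp add: q_def inner_add_left inner_commute[of v] inner_self_sphere[OF p])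
    have "connected (q ` {0..t})"
      unfolding q_def by (intro connected_continuous_image continuous_intros) auto
    moreover have "q ` {0..t} \<subseteq> ?A"
    proof
      fix z assume "z \<in> q ` {0..t}"
      then obtain s where s: "0 \<le> s" "s \<le> t" "z = q s" by auto
      have "cos t \<le> cos s" using s v by (intro cos_monotone_0_pi_le) auto
      moreover have "x \<bullet> p = cos t" using qp[of t] v(5) by (simp add: q_def)
      ultimately have "P (z \<bullet> p)"
        using up[OF x(2)] by (simp add: s(3) qp)
      then show "z \<in> ?A"
        using great_circle_in_sphere[OF p v(3,4), of s] s(3) by (simp add: q_def)
    qed
    moreover have "p \<in> q ` {0..t}" using v(1) by (intro image_eqI[of _ _ 0]) (auto simp: q_def)
    moreover have "x \<in> q ` {0..t}" using v by (intro image_eqI[of _ _ t]) (auto simp: q_def)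
    ultimately show ?thesis unfolding connected_component_def by blast
  qed
  then show "connected_component ?A x y" if "x \<in> ?A" "y \<in> ?A" for x y
    using that connected_component_sym connected_component_trans by meson
qed

text \<open>
  The classical touching ball argument: a largest cap in which \<open>w\<close> is positive touches the zero
  set at a minimum of \<open>w\<close>, where the gradient vanishes, against Hopf's lemma.
\<close>

lemma strong_maximum_principle_hemisphere:
  fixes w :: "'a::euclidean_space \<Rightarrow> real"
  assumes dim: "DIM('a) \<ge> 2" and d: "d \<in> sphere 0 1"
    and w: "weakly_superharmonic_on {x \<in> sphere 0 1. 0 < x \<bullet> d} w"
    and nonneg: "\<And>x. x \<in> sphere 0 1 \<Longrightarrow> 0 < x \<bullet> d \<Longrightarrow> 0 \<le> w x"
    and x1: "x1 \<in> sphere 0 1" "0 < x1 \<bullet> d" "w x1 \<noteq> 0"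
    and x: "x \<in> sphere 0 1" "0 < x \<bullet> d"
  shows "0 < w x"
proof -
  have C1w: "C1_sphere w" using w by (simp add: weakly_superharmonic_on_def)
  have cw: "continuous_on (sphere 0 1) w" by (rule C1_sphere_continuous_on[OF C1w])
  define H where "H = {x \<in> sphere 0 1. 0 < x \<bullet> d}"
  define U where "U = {x \<in> H. w x \<noteq> 0}"
  have H: "connected H"
    unfolding H_def by (rule connected_sphere_upper_set[OF dim d]) auto
  have cwH: "continuous_on H w" using cw by (rule continuous_on_subset) (auto simp: H_def)
  have U: "openin (top_of_set H) U"
    using continuous_openin_preimage_gen[OF cwH, of "- {0}"]
    by (simp add: U_def vimage_def Int_def open_Compl)
  \<comment> \<open>Once the zeros form an open set too, connectedness of \<open>H\<close> and the
    point \<open>x1\<close> leave no zeros.\<close>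
  have "openin (top_of_set H) (H - U)"
    unfolding openin_contains_ball
  proof (intro conjI ballI)
    fix z assume "z \<in> H - U"
    then have z: "z \<in> sphere 0 1" "0 < z \<bullet> d" "w z = 0" by (auto simp: H_def U_def)
    \<comment> \<open>For \<open>y\<close> within \<open>e\<close> of \<open>z\<close>, the cap
      about \<open>y\<close> through \<open>z\<close> stays within
      \<open>2 * e = z \<bullet> d\<close> of \<open>z\<close>, hence inside the open
      hemisphere.\<close>
    define e where "e = z \<bullet> d / 2"
    have e: "0 < e" "e \<le> 1/2" using z sphere_inner_le_1[OF z(1) d] by (auto simp: e_def)
    have "y \<notin> U" if y: "y \<in> ball z e \<inter> H" for y
    proof
      assume "y \<in> U"
      then have yS: "y \<in> sphere 0 1" and wy: "w y \<noteq> 0" by (auto simp: U_def H_def)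
      have yz: "norm (z - y) < e" using y by (simp add: dist_norm)
      define Z where "Z = sphere 0 1 \<inter> w -` {0}"
      have "closed Z"
        unfolding Z_def by (intro continuous_closed_preimage cw) auto
      then have "compact Z"
        using compact_Int_closed[OF compact_sphere, of Z 0 1] by (simp add: Z_def Int_absorb1)
      \<comment> \<open>\<open>z'\<close> is a zero of \<open>w\<close> nearest to \<open>y\<close>
        on the whole sphere. It is no farther than \<open>z\<close>, so the cap about
        \<open>y\<close> through \<open>z'\<close> remains in the hemisphere.\<close>
      then obtain z' where z': "z' \<in> Z" "\<And>x. x \<in> Z \<Longrightarrow> x \<bullet> y \<le> z' \<bullet> y"
      proof -
        have "continuous_on Z (\<lambda>x. x \<bullet> y)" by (intro continuous_intros)
        moreover have "Z \<noteq> {}" using z by (auto simp: Z_def)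
        ultimately show thesis
          using continuous_attains_sup[OF \<open>compact Z\<close>] that by blast
      qed
      define c where "c = z' \<bullet> y"
      have z'S: "z' \<in> sphere 0 1" and wz': "w z' = 0" using z'(1) by (auto simp: Z_def)
      have "z \<bullet> y \<le> c" using z'(2)[of z] z by (simp add: Z_def c_def)
      have c1: "c < 1"
        using sphere_inner_le_1[OF z'S yS] sphere_inner_eq_1[OF z'S yS] wz' wy
        unfolding c_def by fastforce
      have inH: "x \<in> H" if xS: "x \<in> sphere 0 1" and xc: "c \<le> x \<bullet> y" for x
      proof -
        have "(norm (x - y))\<^sup>2 \<le> (norm (z - y))\<^sup>2"
          using xc \<open>z \<bullet> y \<le> c\<close> by (simp only: sphere_dist_inner[OF xS yS] sphere_dist_inner[OF z(1) yS])
        then have "norm (x - y) \<le> norm (z - y)" by simp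
        then have "norm (z - x) < 2 * e"
          using norm_triangle_ineq4[of "z - y" "x - y"] yz by simp
        moreover have "(z - x) \<bullet> d \<le> norm (z - x)"
          using norm_cauchy_schwarz[of "z - x" d] d by simp
        ultimately have "0 < x \<bullet> d" by (simp add: inner_diff_left e_def)
        then show ?thesis using xS by (simp add: H_def)
      qed
      have c0: "- 1 < c"
      proof -
        have "(norm (z - y))\<^sup>2 < 1"
          using yz e by (simp add: abs_square_less_1)
        then show ?thesis
          using \<open>z \<bullet> y \<le> c\<close> unfolding sphere_dist_inner[OF z(1) yS] by linarith
      qed
      have "0 < sphere_gradient w z' \<bullet> y"
      proof (rule Hopf_lemma[where w = w, OF dim yS c0 c1 _ _ _ z'S c_def[symmetric] wz'])
        show "weakly_superharmonic_on {x \<in> sphere 0 1. c < x \<bullet> y} w"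
          by (rule weakly_superharmonic_on_subset[OF w]) (use inH in \<open>force simp: H_def\<close>)
        show "0 < w x" if "x \<in> sphere 0 1" "c < x \<bullet> y" for x
        proof -
          have "x \<in> H" using inH that by simp
          moreover have "x \<notin> Z" using z'(2)[of x] that by (auto simp: c_def)
          ultimately show ?thesis using nonneg[of x] by (force simp: H_def Z_def)
        qed
        show "0 \<le> w x" if "x \<in> sphere 0 1" "x \<bullet> y = c" for x
          using nonneg inH[of x] that by (simp add: H_def)
      qed
      moreover have "sphere_gradient w z' \<bullet> y = 0"
      proof -
        obtain \<tau> r where \<tau>: "\<tau> \<in> sphere 0 1" "z' \<bullet> \<tau> = 0" "y = c *\<^sub>R z' + r *\<^sub>R \<tau>"
        proof -
          have "\<bar>c\<bar> < 1" using c0 c1 by simp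
          then show thesis
            using tangent_direction[OF yS z'S, folded c_def] that by blast
        qed
        define q where "q t = cos t *\<^sub>R z' + sin t *\<^sub>R \<tau>" for t :: real
        have q: "q t \<in> sphere 0 1" for t
          unfolding q_def by (rule great_circle_in_sphere[OF z'S \<tau>(1,2)])
        have q0: "q 0 = z'" by (simp add: q_def)
        have "((\<lambda>t. w (q t)) has_real_derivative sphere_gradient w z' \<bullet> \<tau>) (at 0)"
          using C1_sphere_curve_derivative[OF C1w great_circle_derivative
              great_circle_in_sphere[OF z'S \<tau>(1,2)], of 0]
          by (simp add: q_def)
        moreover have "0 < q 0 \<bullet> d" using inH[of z'] z'S by (simp add: q0 H_def c_def)
        then have "eventually (\<lambda>t. 0 < q t \<bullet> d) (at 0)"
        proof (rule order_tendstoD(1)[rotated])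
          have "isCont (\<lambda>t. q t \<bullet> d) 0" unfolding q_def by (intro continuous_intros)
          then show "((\<lambda>t. q t \<bullet> d) \<longlongrightarrow> q 0 \<bullet> d) (at 0)" by (simp add: isCont_def)
        qed
        then obtain \<delta> where \<delta>: "\<delta> > 0" "\<And>t. t \<noteq> 0 \<Longrightarrow> \<bar>t\<bar> < \<delta> \<Longrightarrow> 0 < q t \<bullet> d"
          by (auto simp: eventually_at)
        have "w (q 0) \<le> w (q t)" if "\<bar>0 - t\<bar> < \<delta>" for t
          using nonneg[OF q \<delta>(2), of t] that by (cases "t = 0") (auto simp: q0 wz')
        ultimately have "sphere_gradient w z' \<bullet> \<tau> = 0"
          using DERIV_local_min[OF _ \<delta>(1)] by blast
        then show ?thesis
          using sphere_gradient_tangent[OF C1w z'S] by (simp add: \<tau>(3) inner_add_right)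
      qed
      ultimately show False by simp
    qed
    then show "\<exists>e>0. ball z e \<inter> H \<subseteq> H - U" using e by blast
  qed auto
  then have "closedin (top_of_set H) U"
    using U by (simp add: closedin_def openin_imp_subset U_def)
  then have "U = H"
    using H U x1 unfolding connected_clopen by (auto simp: U_def H_def)
  then have "w x \<noteq> 0" using x by (auto simp: U_def H_def)
  then show ?thesis using nonneg[OF x] by simp
qed

text \<open>A cap of opening \<open>\<pi>/4\<close> inside the hemisphere touches its boundary at \<open>z\<close>.\<close>

lemma Hopf_lemma_hemisphere:
  fixes w :: "'a::euclidean_space \<Rightarrow> real"
  assumes dim: "DIM('a) \<ge> 2" and d: "d \<in> sphere 0 1"
    and w: "weakly_superharmonic_on {x \<in> sphere 0 1. 0 < x \<bullet> d} w"
    and pos: "\<And>x. x \<in> sphere 0 1 \<Longrightarrow> 0 < x \<bullet> d \<Longrightarrow> 0 < w x"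
    and zero: "\<And>x. x \<in> sphere 0 1 \<Longrightarrow> x \<bullet> d = 0 \<Longrightarrow> w x = 0"
    and z: "z \<in> sphere 0 1" "z \<bullet> d = 0"
  shows "0 < sphere_gradient w z \<bullet> d"
proof -
  define c where "c = 1 / sqrt 2"
  have c: "0 < c" "c < 1" by (auto simp: c_def)
  \<comment> \<open>\<open>y\<close> is the midpoint of the quarter circle from \<open>z\<close> to
    \<open>d\<close>, and \<open>c\<close> is the cosine of \<open>\<pi>/4\<close>. Level
    \<open>c\<close> means \<open>x \<bullet> z + x \<bullet> d = 1\<close>, and
    \<open>x \<bullet> z \<le> 1\<close> keeps the cap on the right side of the equator.\<close>
  define y where "y = c *\<^sub>R (z + d)"
  have cc: "c * c = 1/2" by (simp add: c_def)
  have zz: "z \<bullet> z = 1" "d \<bullet> d = 1" "d \<bullet> z = 0"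
    using z d by (auto simp: inner_self_sphere inner_commute)
  have "y \<bullet> y = (c * c) * 2"
    by (simp add: y_def inner_add_left inner_add_right zz z)
  then have y: "y \<in> sphere 0 1" by (simp add: cc norm_eq_sqrt_inner)
  have xy: "x \<bullet> y = c * (x \<bullet> z + x \<bullet> d)" for x
    by (simp add: y_def inner_add_right)
  have *: "0 < x \<bullet> d \<or> x \<bullet> d = 0 \<and> x \<bullet> y = c" if "x \<in> sphere 0 1" "c \<le> x \<bullet> y" for x
  proof -
    have "1 \<le> x \<bullet> z + x \<bullet> d" using that c by (simp add: xy)
    then show ?thesis using sphere_inner_le_1[OF that(1) z(1)] by (auto simp: xy)
  qed
  have "0 < sphere_gradient w z \<bullet> y"
  proof (rule Hopf_lemma[where w = w, OF dim y _ c(2) _ _ _ z(1)])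
    show "weakly_superharmonic_on {x \<in> sphere 0 1. c < x \<bullet> y} w"
      by (rule weakly_superharmonic_on_subset[OF w]) (use * in force)
    show "0 < w x" if "x \<in> sphere 0 1" "c < x \<bullet> y" for x
      using pos[of x] *[of x] that by force
    show "0 \<le> w x" if "x \<in> sphere 0 1" "x \<bullet> y = c" for x
      using pos[of x] zero[of x] *[of x] that by force
    show "w z = 0" by (rule zero[OF z])
    show "z \<bullet> y = c" by (simp add: xy zz z)
  qed (use c in simp)
  moreover have "C1_sphere w" using w by (simp add: weakly_superharmonic_on_def)
  ultimately show ?thesis
    using c sphere_gradient_tangent[OF _ z(1), of w] by (simp add: xy zero_less_mult_iff)
qed

section \<open>Moving planes\<close>

context
  fixes u f :: "'a::euclidean_space \<Rightarrow> real" and B :: real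
  assumes dim: "DIM('a) \<ge> 2" and u: "C1_sphere u"
    and f_meas: "f \<in> borel_measurable sphere_measure"
    and f_bound: "\<And>x. x \<in> sphere 0 1 \<Longrightarrow> \<bar>f x\<bar> \<le> B"
    and eq: "weak_neg_laplacian_eq u f"
begin

lemma integrable_bounded_mult:
  assumes "C1_sphere \<phi>"
  shows "integrable sphere_measure (\<lambda>x. f x * \<phi> x)"
proof -
  have c: "continuous_on (sphere 0 1) \<phi>" by (rule C1_sphere_continuous_on[OF assms])
  then have "bounded (\<phi> ` sphere 0 1)"
    using compact_continuous_image compact_imp_bounded compact_sphere by blast
  then obtain M where M: "\<And>x. x \<in> sphere 0 1 \<Longrightarrow> \<bar>\<phi> x\<bar> \<le> M"
    unfolding bounded_iff real_norm_def by blast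
  show ?thesis
  proof (rule integrable_sphere_bounded)
    show "(\<lambda>x. f x * \<phi> x) \<in> borel_measurable sphere_measure"
      using f_meas continuous_on_sphere_measurable[OF c] by (rule borel_measurable_times)
    show "norm (f x * \<phi> x) \<le> B * M" if "x \<in> sphere 0 1" for x
      unfolding real_norm_def abs_mult
      using f_bound[OF that] M[OF that] by (intro mult_mono) auto
  qed
qed

lemma reflected_difference_C1:
  assumes d: "d \<in> sphere 0 1"
  shows "C1_sphere_with (\<lambda>x. u x - u (reflect d x))
    (\<lambda>x. sphere_gradient u x - reflect d (sphere_gradient u (reflect d x)))"
  by (intro C1_sphere_with_diff C1_sphere_with_reflect C1_sphere_withI u d)

text \<open>Invariance of the measure and of the inner product moves the reflection from
  \<open>u\<close> to the test function. So the reflected \<open>u\<close> solves the equation with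
  the reflected right hand side.\<close>

lemma reflected_difference_weak:
  assumes d: "d \<in> sphere 0 1" and \<phi>: "C1_sphere \<phi>"
  shows "(LINT x|sphere_measure. sphere_gradient (\<lambda>x. u x - u (reflect d x)) x \<bullet> sphere_gradient \<phi> x)
    = (LINT x|sphere_measure. (f x - f (reflect d x)) * \<phi> x)"
    and "integrable sphere_measure (\<lambda>x. (f x - f (reflect d x)) * \<phi> x)"
proof -
  note R = C1_sphere_with_reflect[OF C1_sphere_withI[OF \<phi>] d]
  note R\<phi> = C1_sphere_withD(1)[OF R]
  note RU = C1_sphere_withD[OF C1_sphere_with_reflect[OF C1_sphere_withI[OF u] d]]
  have int1: "integrable sphere_measure (\<lambda>x. f (reflect d x) * \<phi> x)"
  proof -
    have "integrable (distr sphere_measure sphere_measure (reflect d)) (\<lambda>x. f x * \<phi> (reflect d x))"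
      using integrable_bounded_mult[OF R\<phi>] by (simp only: sphere_measure_distr_reflect[OF d])
    then have "integrable sphere_measure (\<lambda>x. f (reflect d x) * \<phi> (reflect d (reflect d x)))"
      by (rule integrable_distr[OF reflect_measurable_sphere[OF d]])
    then show ?thesis by (simp only: reflect_reflect[OF d])
  qed
  then show "integrable sphere_measure (\<lambda>x. (f x - f (reflect d x)) * \<phi> x)"
    using Bochner_Integration.integrable_diff[OF integrable_bounded_mult[OF \<phi>] int1]
    by (simp add: left_diff_distrib)
  have weak: "(LINT x|sphere_measure. sphere_gradient u x \<bullet> sphere_gradient \<psi> x) =
        (LINT x|sphere_measure. f x * \<psi> x)" if "C1_sphere \<psi>" for \<psi>
    using eq that unfolding weak_neg_laplacian_eq_def by blast
  have "(LINT x|sphere_measure. sphere_gradient (\<lambda>x. u (reflect d x)) x \<bullet> sphere_gradient \<phi> x)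
      = (LINT x|sphere_measure. sphere_gradient u (reflect d x) \<bullet> sphere_gradient (\<lambda>x. \<phi> (reflect d x)) (reflect d x))"
  proof (intro Bochner_Integration.integral_cong refl)
    fix x :: 'a assume "x \<in> space sphere_measure"
    then have x: "x \<in> sphere 0 1" by simp
    show "sphere_gradient (\<lambda>x. u (reflect d x)) x \<bullet> sphere_gradient \<phi> x =
        sphere_gradient u (reflect d x) \<bullet> sphere_gradient (\<lambda>x. \<phi> (reflect d x)) (reflect d x)"
      unfolding RU(2)[OF x] C1_sphere_withD(2)[OF R reflect_sphere[OF d x]] reflect_reflect[OF d]
      by (rule inner_reflect[OF d])
  qed
  also have "\<dots> = (LINT x|sphere_measure. sphere_gradient u x \<bullet> sphere_gradient (\<lambda>x. \<phi> (reflect d x)) x)"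
    by (rule integral_reflect[OF d])
      (intro borel_measurable_integrable integrable_gradient_inner u R\<phi>)
  also have "\<dots> = (LINT x|sphere_measure. f x * \<phi> (reflect d x))"
    by (rule weak[OF R\<phi>])
  also have "\<dots> = (LINT x|sphere_measure. f (reflect d x) * \<phi> (reflect d (reflect d x)))"
    by (rule integral_reflect[OF d, symmetric])
      (intro borel_measurable_integrable integrable_bounded_mult R\<phi>)
  finally have refl: "(LINT x|sphere_measure. sphere_gradient (\<lambda>x. u (reflect d x)) x \<bullet> sphere_gradient \<phi> x)
      = (LINT x|sphere_measure. f (reflect d x) * \<phi> x)"
    by (simp only: reflect_reflect[OF d])
  have "(LINT x|sphere_measure. sphere_gradient (\<lambda>x. u x - u (reflect d x)) x \<bullet> sphere_gradient \<phi> x)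
      = (LINT x|sphere_measure. sphere_gradient u x \<bullet> sphere_gradient \<phi> x)
      - (LINT x|sphere_measure. sphere_gradient (\<lambda>x. u (reflect d x)) x \<bullet> sphere_gradient \<phi> x)"
    by (subst Bochner_Integration.integral_diff[symmetric])
      (auto intro!: integrable_gradient_inner u RU(1) \<phi> Bochner_Integration.integral_cong
        simp: C1_sphere_withD(2)[OF reflected_difference_C1[OF d]] RU(2) inner_diff_left)
  also have "\<dots> = (LINT x|sphere_measure. (f x - f (reflect d x)) * \<phi> x)"
    unfolding refl weak[OF \<phi>] left_diff_distrib
    by (rule Bochner_Integration.integral_diff[symmetric, OF integrable_bounded_mult[OF \<phi>] int1])
  finally show "(LINT x|sphere_measure. sphere_gradient (\<lambda>x. u x - u (reflect d x)) x \<bullet> sphere_gradient \<phi> x)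
    = (LINT x|sphere_measure. (f x - f (reflect d x)) * \<phi> x)" .
qed

lemma reflected_difference_superharmonic:
  assumes d: "d \<in> sphere 0 1" and A: "\<And>x. x \<in> A \<Longrightarrow> x \<in> sphere 0 1 \<Longrightarrow> f (reflect d x) \<le> f x"
  shows "weakly_superharmonic_on A (\<lambda>x. u x - u (reflect d x))"
  unfolding weakly_superharmonic_on_def
proof (intro conjI allI impI)
  show "C1_sphere (\<lambda>x. u x - u (reflect d x))"
    by (rule C1_sphere_withD(1)[OF reflected_difference_C1[OF d]])
  fix \<phi> :: "'a \<Rightarrow> real"
  assume \<phi>: "C1_sphere \<phi>" "\<forall>x\<in>sphere 0 1. 0 \<le> \<phi> x" "\<forall>x\<in>sphere 0 1 - A. \<phi> x = 0"
  show "0 \<le> (LINT x|sphere_measure. sphere_gradient (\<lambda>x. u x - u (reflect d x)) x \<bullet> sphere_gradient \<phi> x)"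
    unfolding reflected_difference_weak(1)[OF d \<phi>(1)]
  proof (rule integral_nonneg_AE[OF AE_I2])
    fix x :: 'a assume "x \<in> space sphere_measure"
    then have x: "x \<in> sphere 0 1" by simp
    show "0 \<le> (f x - f (reflect d x)) * \<phi> x"
      using A[of x] \<phi>(2,3) x by (cases "x \<in> A") auto
  qed
qed

text \<open>The strict inequality alone is not stable under changes of \<open>d\<close>, because the
  difference vanishes on the equator. The gradient condition controls points close to it and makes
  the set open.\<close>

definition moving_planes_pos :: "'a set" where
  "moving_planes_pos = {d \<in> sphere 0 1.
     (\<forall>x\<in>sphere 0 1. 0 < x \<bullet> d \<longrightarrow> u (reflect d x) < u x) \<and>
     (\<forall>x\<in>sphere 0 1. x \<bullet> d = 0 \<longrightarrow> 0 < sphere_gradient u x \<bullet> d)}"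

text \<open>Monotonicity of \<open>f\<close> turns the assumed inequality into superharmonicity of
  the difference. If that is nonzero anywhere in the hemisphere, the strong maximum principle gives
  strictness and Hopf's lemma the gradient condition: on the equator the normal derivative of the
  difference is twice that of \<open>u\<close>.\<close>

lemma moving_planes_dichotomy:
  assumes mono: "\<And>x y. x \<in> sphere 0 1 \<Longrightarrow> y \<in> sphere 0 1 \<Longrightarrow> u y \<le> u x \<Longrightarrow> f y \<le> f x"
    and d: "d \<in> sphere 0 1" and le: "\<And>x. x \<in> sphere 0 1 \<Longrightarrow> 0 < x \<bullet> d \<Longrightarrow> u (reflect d x) \<le> u x"
    and not_pos: "d \<notin> moving_planes_pos" and x: "x \<in> sphere 0 1"
  shows "u (reflect d x) = u x"
proof -
  let ?w = "\<lambda>x. u x - u (reflect d x)"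
  have fixed: "reflect d z = z" if "z \<bullet> d = 0" for z
    using that by (simp add: reflect_def)
  have w: "weakly_superharmonic_on {x \<in> sphere 0 1. 0 < x \<bullet> d} ?w"
    by (rule reflected_difference_superharmonic[OF d]) (use mono le reflect_sphere[OF d] in blast)
  have zero: "?w x = 0" if x: "x \<in> sphere 0 1" "0 < x \<bullet> d" for x
  proof (rule ccontr)
    assume "?w x \<noteq> 0"
    have pos: "0 < ?w z" if "z \<in> sphere 0 1" "0 < z \<bullet> d" for z
      by (rule strong_maximum_principle_hemisphere[OF dim d w _ x(1,2) \<open>?w x \<noteq> 0\<close> that])
        (use le in simp)
    have "0 < sphere_gradient u z \<bullet> d" if z: "z \<in> sphere 0 1" "z \<bullet> d = 0" for z
    proof -
      have "0 < sphere_gradient ?w z \<bullet> d"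
        by (rule Hopf_lemma_hemisphere[OF dim d w pos _ z]) (auto simp: fixed)
      also have "\<dots> = 2 * (sphere_gradient u z \<bullet> d)"
        by (simp add: C1_sphere_withD(2)[OF reflected_difference_C1[OF d] z(1)] fixed[OF z(2)]
            inner_diff_left reflect_inner_normal[OF d])
      finally show ?thesis by simp
    qed
    then have "d \<in> moving_planes_pos"
      using pos d by (auto simp: moving_planes_pos_def)
    then show False using not_pos by blast
  qed
  consider "0 < x \<bullet> d" | "x \<bullet> d = 0" | "x \<bullet> d < 0" by linarith
  then show ?thesis
  proof cases
    case 1
    then show ?thesis using zero[OF x] by simp
  next
    case 2
    then show ?thesis by (simp add: fixed)
  next
    case 3
    then show ?thesis
      using zero[OF reflect_sphere[OF d x]] by (simp add: reflect_inner_normal[OF d] reflect_reflect[OF d])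
  qed
qed

text \<open>
  If the inequality fails at \<open>x\<close>, the mean value theorem on the arc from \<open>x\<close> to its reflection
  gives a point \<open>p\<close> and a direction \<open>q\<close>, close to \<open>x\<close> and \<open>d\<close> when \<open>x\<close> is close to the
  equator, along which \<open>u\<close> does not increase.
\<close>

lemma moving_planes_failure_witness:
  assumes d: "d \<in> sphere 0 1" and fail: "d \<notin> moving_planes_pos"
  obtains x p q where "x \<in> sphere 0 1" "p \<in> sphere 0 1" "0 \<le> x \<bullet> d"
    "0 < x \<bullet> d \<Longrightarrow> u x \<le> u (reflect d x)" "sphere_gradient u p \<bullet> q \<le> 0"
    "norm (p - x) \<le> 3 * (x \<bullet> d)" "norm (q - d) \<le> 2 * (x \<bullet> d)"
proof -
  consider x where "x \<in> sphere 0 1" "0 < x \<bullet> d" "u x \<le> u (reflect d x)"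
    | x where "x \<in> sphere 0 1" "x \<bullet> d = 0" "sphere_gradient u x \<bullet> d \<le> 0"
    using d fail unfolding moving_planes_pos_def by force
  then show thesis
  proof cases
    case (2 x)
    then show thesis by (intro that[of x x d]) auto
  next
    case (1 x)
    obtain t v where v: "0 \<le> t" "t \<le> pi" "v \<in> sphere 0 1" "d \<bullet> v = 0" "x = cos t *\<^sub>R d + sin t *\<^sub>R v"
      using great_circle_through[OF dim d 1(1)] .
    define q where "q s = cos s *\<^sub>R d + sin s *\<^sub>R v" for s
    have q: "q s \<in> sphere 0 1" for s unfolding q_def by (rule great_circle_in_sphere[OF d v(3,4)])
    have xd: "x \<bullet> d = cos t"
      using v(4) by (simp add: v(5) inner_add_left inner_commute[of v] inner_self_sphere[OF d])
    have t: "t < pi / 2"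
    proof (rule ccontr)
      assume "\<not> t < pi / 2"
      then have "cos t \<le> cos (pi / 2)" using v(1,2) by (intro cos_monotone_0_pi_le) auto
      then show False using 1(2) by (simp add: xd)
    qed
    have Rx: "reflect d x = q (pi - t)"
      using xd by (simp add: reflect_def q_def v(5) flip: scaleR_diff_left)
    have DU: "((\<lambda>s. u (q s)) has_real_derivative sphere_gradient u (q s) \<bullet> (- sin s *\<^sub>R d + cos s *\<^sub>R v)) (at s)" for s
      using C1_sphere_curve_derivative[OF u great_circle_derivative
          great_circle_in_sphere[OF d v(3,4)], of s]
      by (simp add: q_def)
    obtain s where s: "t < s" "s < pi - t"
      "u (q (pi - t)) - u (q t) = (pi - t - t) * (sphere_gradient u (q s) \<bullet> (- sin s *\<^sub>R d + cos s *\<^sub>R v))"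
      using MVT2[of t "pi - t" "\<lambda>s. u (q s)", OF _ DU] t by auto
    have "0 \<le> (pi - t - t) * (sphere_gradient u (q s) \<bullet> (- sin s *\<^sub>R d + cos s *\<^sub>R v))"
      using 1(3) s(3) Rx v(5) by (simp add: q_def)
    then have g: "0 \<le> sphere_gradient u (q s) \<bullet> (- sin s *\<^sub>R d + cos s *\<^sub>R v)"
      using t by (simp add: zero_le_mult_iff)
    define h where "h = cos t"
    have h: "0 < h" "h \<le> 1" using 1(2) xd by (auto simp: h_def)
    have cs: "\<bar>cos s\<bar> \<le> h"
    proof -
      have "cos s \<le> cos t" using s v t by (intro cos_monotone_0_pi_le) auto
      moreover have "cos (pi - t) \<le> cos s" using s v t by (intro cos_monotone_0_pi_le) auto
      ultimately show ?thesis by (simp add: h_def abs_le_iff)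
    qed
    \<comment> \<open>For \<open>0 \<le> sin a\<close> one has
      \<open>sin a \<ge> sin^2 a = 1 - cos^2 a \<ge> 1 - h^2 \<ge> 1 - h\<close>. Hence every error
      below is a multiple of \<open>h = x \<bullet> d\<close>.\<close>
    have sin_bound: "1 - h \<le> sin a" if "0 \<le> sin a" "\<bar>cos a\<bar> \<le> h" for a
    proof -
      have "(sin a)\<^sup>2 \<le> sin a" using that(1) by (simp add: power2_eq_square mult_left_le)
      moreover have "(cos a)\<^sup>2 \<le> h\<^sup>2"
        using that(2) h abs_le_square_iff[of "cos a" h] by simp
      moreover have "h\<^sup>2 \<le> h" using h by (simp add: power2_eq_square mult_left_le)
      ultimately show ?thesis using sin_cos_squared_add[of a] by linarith
    qed
    have "0 \<le> sin s" "0 \<le> sin t" using s v t by (auto intro!: sin_ge_zero)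
    then have sn: "1 - h \<le> sin s" "1 - h \<le> sin t" "sin s \<le> 1" "sin t \<le> 1"
      using sin_bound cs h by (auto simp: h_def)
    have nd: "norm d = 1" "norm v = 1" using d v(3) by auto
    show thesis
    \<comment> \<open>The direction is minus the velocity at \<open>s\<close>: the arc runs from
      \<open>x\<close> to its reflection, away from \<open>d\<close>, and \<open>u\<close> does not
      decrease from end to end.\<close>
    proof (rule that[of x "q s" "sin s *\<^sub>R d - cos s *\<^sub>R v"])
      show "sphere_gradient u (q s) \<bullet> (sin s *\<^sub>R d - cos s *\<^sub>R v) \<le> 0"
        using g by (simp add: inner_diff_right inner_add_right)
      have "q s - x = (cos s - cos t) *\<^sub>R d + (sin s - sin t) *\<^sub>R v"
        by (simp add: q_def v(5) algebra_simps)
      then have "norm (q s - x) \<le> norm ((cos s - cos t) *\<^sub>R d) + norm ((sin s - sin t) *\<^sub>R v)"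
        using norm_triangle_ineq by metis
      also have "\<dots> \<le> 2 * h + h"
      proof (intro add_mono)
        have "\<bar>cos s - cos t\<bar> \<le> 2 * h" using cs h unfolding h_def by linarith
        then show "norm ((cos s - cos t) *\<^sub>R d) \<le> 2 * h" by (simp add: nd)
        have "\<bar>sin s - sin t\<bar> \<le> h" using sn by linarith
        then show "norm ((sin s - sin t) *\<^sub>R v) \<le> h" by (simp add: nd)
      qed
      finally show "norm (q s - x) \<le> 3 * (x \<bullet> d)" by (simp add: xd h_def)
      have "sin s *\<^sub>R d - cos s *\<^sub>R v - d = (sin s - 1) *\<^sub>R d - cos s *\<^sub>R v"
        by (simp add: algebra_simps)
      then have "norm (sin s *\<^sub>R d - cos s *\<^sub>R v - d) \<le> norm ((sin s - 1) *\<^sub>R d) + norm (cos s *\<^sub>R v)"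
        using norm_triangle_ineq4 by metis
      also have "\<dots> \<le> h + h"
        using cs sn by (intro add_mono) (auto simp: nd)
      finally show "norm (sin s *\<^sub>R d - cos s *\<^sub>R v - d) \<le> 2 * (x \<bullet> d)" by (simp add: xd h_def)
    qed (use 1 q in auto)
  qed
qed

text \<open>Failing directions that converge bring witnesses along, and a subsequence of the points
  \<open>X\<close> converges. If the limit is off the equator, the failed inequality for
  \<open>u\<close> passes to the limit; if it is on the equator, \<open>P\<close> and
  \<open>Q\<close> converge to it and to \<open>d\<close>, and the gradient inequality passes
  instead.\<close>

lemma openin_moving_planes_pos: "openin (top_of_set (sphere 0 1)) moving_planes_pos"
proof -
  have cu: "continuous_on (sphere 0 1) u" by (rule C1_sphere_continuous_on[OF u])
  have cg: "continuous_on (sphere 0 1) (sphere_gradient u)" by (rule continuous_on_sphere_gradient[OF u])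
  have "closed (sphere 0 1 - moving_planes_pos)"
    unfolding closed_sequential_limits
  proof (intro allI impI, elim conjE)
    fix D d assume D: "\<forall>n. D n \<in> sphere 0 1 - moving_planes_pos" "D \<longlonglongrightarrow> d"
    have DS: "D n \<in> sphere 0 1" for n using D(1) by blast
    have d: "d \<in> sphere 0 1"
      using closed_sphere[of "0::'a" 1] DS D(2) closed_sequentially by blast
    have "\<exists>x p q. x \<in> sphere 0 1 \<and> p \<in> sphere 0 1 \<and> 0 \<le> x \<bullet> D n \<and>
       (0 < x \<bullet> D n \<longrightarrow> u x \<le> u (reflect (D n) x)) \<and> sphere_gradient u p \<bullet> q \<le> 0 \<and>
       norm (p - x) \<le> 3 * (x \<bullet> D n) \<and> norm (q - D n) \<le> 2 * (x \<bullet> D n)" for n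
      using moving_planes_failure_witness[OF DS[of n]] D(1) by (metis DiffE)
    then obtain X P Q where X: "\<And>n. X n \<in> sphere 0 1" "\<And>n. P n \<in> sphere 0 1" "\<And>n. 0 \<le> X n \<bullet> D n"
      "\<And>n. 0 < X n \<bullet> D n \<longrightarrow> u (X n) \<le> u (reflect (D n) (X n))" "\<And>n. sphere_gradient u (P n) \<bullet> Q n \<le> 0"
      "\<And>n. norm (P n - X n) \<le> 3 * (X n \<bullet> D n)" "\<And>n. norm (Q n - D n) \<le> 2 * (X n \<bullet> D n)"
      by metis
    obtain x r where x: "x \<in> sphere 0 1" and r: "strict_mono r" and lim: "(X \<circ> r) \<longlonglongrightarrow> x"
      using compact_sphere[of "0::'a" 1] X(1) unfolding compact_def by meson
    have limX: "(\<lambda>n. X (r n)) \<longlonglongrightarrow> x" using lim by (simp add: o_def)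
    have limD: "(\<lambda>n. D (r n)) \<longlonglongrightarrow> d" using LIMSEQ_subseq_LIMSEQ[OF D(2) r] by (simp add: o_def)
    have limh: "(\<lambda>n. X (r n) \<bullet> D (r n)) \<longlonglongrightarrow> x \<bullet> d" by (intro tendsto_intros limX limD)
    have "0 \<le> x \<bullet> d" using limh X(3) by (intro LIMSEQ_le_const[OF limh]) auto
    have "d \<notin> moving_planes_pos"
    proof
      assume pos: "d \<in> moving_planes_pos"
      show False
      proof (cases "0 < x \<bullet> d")
        case True
        have "eventually (\<lambda>n. 0 < X (r n) \<bullet> D (r n)) sequentially"
          by (rule order_tendstoD(1)[OF limh True])
        then have "eventually (\<lambda>n. u (X (r n)) \<le> u (reflect (D (r n)) (X (r n)))) sequentially"
          by eventually_elim (use X(4) in blast)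
        moreover have "(\<lambda>n. u (X (r n))) \<longlonglongrightarrow> u x"
          using continuous_on_tendsto_compose[OF cu limX x] X(1) by auto
        moreover have "(\<lambda>n. u (reflect (D (r n)) (X (r n)))) \<longlonglongrightarrow> u (reflect d x)"
        proof (rule continuous_on_tendsto_compose[OF cu _ reflect_sphere[OF d x]])
          show "(\<lambda>n. reflect (D (r n)) (X (r n))) \<longlonglongrightarrow> reflect d x"
            unfolding reflect_def by (intro tendsto_intros limX limD)
          show "\<forall>\<^sub>F n in sequentially. reflect (D (r n)) (X (r n)) \<in> sphere 0 1"
            using reflect_sphere[OF DS X(1)] by (intro always_eventually allI)
        qed
        ultimately have "u x \<le> u (reflect d x)"
          using tendsto_le[OF sequentially_bot] by blast
        then show False
          using pos True x unfolding moving_planes_pos_def by force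
      next
        case False
        then have xd: "x \<bullet> d = 0" using \<open>0 \<le> x \<bullet> d\<close> by simp
        have "(\<lambda>n. P (r n) - X (r n)) \<longlonglongrightarrow> 0"
          by (rule Lim_null_comparison[of _ "\<lambda>n. 3 * (X (r n) \<bullet> D (r n))"])
            (use X(6) tendsto_mult_right_zero[OF limh[unfolded xd]] in auto)
        then have limP: "(\<lambda>n. P (r n)) \<longlonglongrightarrow> x"
          using tendsto_add[OF _ limX] by fastforce
        have "(\<lambda>n. Q (r n) - D (r n)) \<longlonglongrightarrow> 0"
          by (rule Lim_null_comparison[of _ "\<lambda>n. 2 * (X (r n) \<bullet> D (r n))"])
            (use X(7) tendsto_mult_right_zero[OF limh[unfolded xd]] in auto)
        then have limQ: "(\<lambda>n. Q (r n)) \<longlonglongrightarrow> d"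
          using tendsto_add[OF _ limD] by fastforce
        have "(\<lambda>n. sphere_gradient u (P (r n))) \<longlonglongrightarrow> sphere_gradient u x"
          using continuous_on_tendsto_compose[OF cg limP x] X(2) by auto
        then have "(\<lambda>n. sphere_gradient u (P (r n)) \<bullet> Q (r n)) \<longlonglongrightarrow> sphere_gradient u x \<bullet> d"
          by (intro tendsto_intros limQ)
        then have "sphere_gradient u x \<bullet> d \<le> 0"
          using X(5) by (intro LIMSEQ_le_const2) auto
        then show False
          using pos x xd unfolding moving_planes_pos_def by force
      qed
    qed
    then show "d \<in> sphere 0 1 - moving_planes_pos" using d by blast
  qed
  moreover have "moving_planes_pos = sphere 0 1 \<inter> - (sphere 0 1 - moving_planes_pos)"
    by (auto simp: moving_planes_pos_def)
  ultimately show ?thesis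
    unfolding openin_open by (meson open_Compl)
qed

text \<open>
  If \<open>u\<close> were symmetric, testing the equation with \<open>x \<bullet> d\<close> would force \<open>f\<close> to be symmetric
  almost everywhere.
\<close>

lemma moving_planes_start:
  assumes mono: "\<And>x y. x \<in> sphere 0 1 \<Longrightarrow> y \<in> sphere 0 1 \<Longrightarrow> u y \<le> u x \<Longrightarrow> f y \<le> f x"
    and d: "d \<in> sphere 0 1" and f_le: "\<And>x. x \<in> sphere 0 1 \<Longrightarrow> 0 < x \<bullet> d \<Longrightarrow> f (reflect d x) \<le> f x"
    and V: "openin (top_of_set (sphere 0 1)) V" "V \<noteq> {}"
    and f_neq: "\<And>x. x \<in> V \<Longrightarrow> x \<bullet> d \<noteq> 0 \<and> f (reflect d x) \<noteq> f x"
  shows "d \<in> moving_planes_pos"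
proof (rule ccontr)
  assume not_pos: "d \<notin> moving_planes_pos"
  define H where "H = {x \<in> sphere 0 1. 0 < x \<bullet> d}"
  let ?w = "\<lambda>x. u x - u (reflect d x)"
  \<comment> \<open>Here the sign of the right hand side is assumed, so the difference is
    superharmonic before its own sign is known; it vanishes on the equator.\<close>
  have w_nonneg: "0 \<le> ?w x" if x: "x \<in> sphere 0 1" "0 < x \<bullet> d" for x
  proof (rule weak_maximum_principle[OF dim, where A = H and ?x0.0 = "- d" and W = ?w])
    show "openin (top_of_set (sphere 0 1)) H"
      unfolding H_def by (rule openin_sphere_halfspace)
    show "- d \<in> sphere 0 1" "- d \<notin> H" "x \<in> H"
      using d x inner_self_sphere[OF d] by (auto simp: H_def)
    show "weakly_superharmonic_on H ?w"
      by (rule reflected_difference_superharmonic[OF d]) (use f_le in \<open>auto simp: H_def\<close>)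
    have cl: "closure H \<subseteq> {x \<in> sphere 0 1. 0 \<le> x \<bullet> d}"
      by (rule closure_minimal[OF _ closed_sphere_halfspace]) (auto simp: H_def)
    show "0 \<le> ?w z" if "z \<in> closure H" "z \<notin> H" for z
    proof -
      have "z \<bullet> d = 0" using cl that by (force simp: H_def)
      then show ?thesis by (simp add: reflect_def)
    qed
  qed
  have sym: "?w x = 0" if "x \<in> sphere 0 1" for x
    using moving_planes_dichotomy[OF mono d _ not_pos that] w_nonneg by simp
  have grad: "sphere_gradient ?w x = 0" if x: "x \<in> sphere 0 1" for x
  proof (rule sphere_gradient_eqI[OF x])
    have "(?w has_derivative (\<lambda>h. 0 \<bullet> h)) (at x within sphere 0 1)"
      by (rule has_derivative_transform[OF x sym]) simp_all
    then show "has_sphere_gradient ?w 0 x" by (simp add: has_sphere_gradient_def)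
  qed
  have C1: "C1_sphere (\<lambda>x. x \<bullet> d)" by (rule C1_sphere_withD(1)[OF C1_sphere_with_inner])
  let ?g = "\<lambda>x. (f x - f (reflect d x)) * (x \<bullet> d)"
  have "(LINT x|sphere_measure. ?g x) = (LINT x|sphere_measure. sphere_gradient ?w x \<bullet> sphere_gradient (\<lambda>x. x \<bullet> d) x)"
    by (rule reflected_difference_weak(1)[OF d C1, symmetric])
  also have "\<dots> = (LINT x|(sphere_measure :: 'a measure). 0)"
    by (intro Bochner_Integration.integral_cong) (auto simp: grad)
  finally have int0: "(LINT x|sphere_measure. ?g x) = 0" by simp
  have "0 \<le> ?g x" if x: "x \<in> sphere 0 1" for x
  proof -
    consider "0 < x \<bullet> d" | "x \<bullet> d = 0" | "x \<bullet> d < 0" by linarith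
    then show ?thesis
    proof cases
      case 1
      then show ?thesis using f_le[OF x] by simp
    next
      case 3
      then have "f x \<le> f (reflect d x)"
        using f_le[OF reflect_sphere[OF d x]] by (simp add: reflect_inner_normal[OF d] reflect_reflect[OF d])
      then show ?thesis using 3 by (intro mult_nonpos_nonpos) auto
    qed simp
  qed
  then have "AE x in sphere_measure. ?g x = 0"
    using int0 by (subst (asm) integral_nonneg_eq_0_iff_AE)
      (auto intro!: reflected_difference_weak(2)[OF d C1])
  then have "AE x in sphere_measure. x \<notin> V"
    by eventually_elim (use f_neq in force)
  then have "emeasure sphere_measure V = 0"
    using AE_iff_null_sets[OF openin_sphere_measurable[OF V(1)]] by auto
  then show False
    using emeasure_sphere_measure_open_pos[OF V] by simp
qed

section \<open>The first moment and the set of good directions\<close>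

text \<open>The line through this vector turns out to be the axis of the cap.\<close>

definition sphere_moment :: 'a where
  "sphere_moment = (LINT x|sphere_measure. u x *\<^sub>R x)"

text \<open>Add the integral of \<open>u x * (x \<bullet> d)\<close> to its reflected form; the
  reflection changes the sign of \<open>x \<bullet> d\<close>.\<close>

lemma sphere_moment_inner:
  assumes d: "d \<in> sphere 0 1"
  shows "2 * (sphere_moment \<bullet> d) = (LINT x|sphere_measure. (u x - u (reflect d x)) * (x \<bullet> d))"
proof -
  have cu: "continuous_on (sphere 0 1) u" by (rule C1_sphere_continuous_on[OF u])
  have cR: "continuous_on (sphere 0 1) (\<lambda>x. u (reflect d x))"
    using reflect_sphere[OF d] by (intro continuous_on_compose2[OF cu] continuous_intros) blast
  have 1: "sphere_moment \<bullet> d = (LINT x|sphere_measure. u x * (x \<bullet> d))"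
    unfolding sphere_moment_def
    by (subst integral_inner_left[symmetric])
      (auto intro!: continuous_on_sphere_integrable continuous_intros cu)
  also have "\<dots> = (LINT x|sphere_measure. u (reflect d x) * (reflect d x \<bullet> d))"
    by (rule integral_reflect[OF d, symmetric]) (intro continuous_on_sphere_measurable continuous_intros cu)
  also have "\<dots> = - (LINT x|sphere_measure. u (reflect d x) * (x \<bullet> d))"
    by (simp add: reflect_inner_normal[OF d])
  finally have "2 * (sphere_moment \<bullet> d) =
      (LINT x|sphere_measure. u x * (x \<bullet> d)) - (LINT x|sphere_measure. u (reflect d x) * (x \<bullet> d))"
    using 1 by simp
  also have "\<dots> = (LINT x|sphere_measure. (u x - u (reflect d x)) * (x \<bullet> d))"
    unfolding left_diff_distrib
    by (rule Bochner_Integration.integral_diff[symmetric])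
      (intro continuous_on_sphere_integrable continuous_intros cu cR)+
  finally show ?thesis .
qed

text \<open>Both factors of the integrand in \<open>sphere_moment_inner\<close> change sign under
  the reflection, so the integrand is nonnegative on both hemispheres, and it is positive at
  \<open>x = d\<close>.\<close>

lemma sphere_moment_pos:
  assumes d: "d \<in> moving_planes_pos"
  shows "0 < sphere_moment \<bullet> d"
proof (rule ccontr)
  have dS: "d \<in> sphere 0 1" using d by (simp add: moving_planes_pos_def)
  have cu: "continuous_on (sphere 0 1) u" by (rule C1_sphere_continuous_on[OF u])
  have cR: "continuous_on (sphere 0 1) (\<lambda>x. u (reflect d x))"
    using reflect_sphere[OF dS] by (intro continuous_on_compose2[OF cu] continuous_intros) blast
  have pos: "u (reflect d x) < u x" if "x \<in> sphere 0 1" "0 < x \<bullet> d" for x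
    using d that unfolding moving_planes_pos_def by blast
  assume "\<not> 0 < sphere_moment \<bullet> d"
  then have "(LINT x|sphere_measure. (u x - u (reflect d x)) * (x \<bullet> d)) \<le> 0"
    using sphere_moment_inner[OF dS] by simp
  then have "(u d - u (reflect d d)) * (d \<bullet> d) = 0"
  proof (rule integral_nonpos_imp_zero_on_sphere[rotated 2, OF _ dS])
    show "continuous_on (sphere 0 1) (\<lambda>x. (u x - u (reflect d x)) * (x \<bullet> d))"
      by (intro continuous_intros cu cR)
    fix x :: 'a assume x: "x \<in> sphere 0 1"
    consider "0 < x \<bullet> d" | "x \<bullet> d = 0" | "x \<bullet> d < 0" by linarith
    then show "0 \<le> (u x - u (reflect d x)) * (x \<bullet> d)"
    proof cases
      case 1
      then show ?thesis using pos[OF x] by simp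
    next
      case 3
      then have "u x < u (reflect d x)"
        using pos[OF reflect_sphere[OF dS x]] by (simp add: reflect_inner_normal[OF dS] reflect_reflect[OF dS])
      then show ?thesis using 3 by (intro mult_nonpos_nonpos) auto
    qed simp
  qed
  then show False using pos[OF dS] by (simp add: inner_self_sphere[OF dS])
qed

text \<open>In the open hemisphere around the moment, a direction that is not good cannot be
  symmetric, as the moment would then be orthogonal to it. By the dichotomy the inequality fails
  strictly at some \<open>x\<close>, an open condition on \<open>d\<close>. So both the good
  directions and their complement are open in a connected set.\<close>

lemma moving_planes:
  assumes mono: "\<And>x y. x \<in> sphere 0 1 \<Longrightarrow> y \<in> sphere 0 1 \<Longrightarrow> u y \<le> u x \<Longrightarrow> f y \<le> f x"
    and e: "e \<in> moving_planes_pos" and d: "d \<in> sphere 0 1" "0 < d \<bullet> sphere_moment"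
  shows "d \<in> moving_planes_pos"
proof -
  let ?m = "sphere_moment"
  define p where "p = ?m /\<^sub>R norm ?m"
  have m0: "?m \<noteq> 0" using d by auto
  have p: "p \<in> sphere 0 1" using m0 by (simp add: p_def)
  define C where "C = {d \<in> sphere 0 1. 0 < d \<bullet> p}"
  have C_iff: "x \<in> C \<longleftrightarrow> x \<in> sphere 0 1 \<and> 0 < x \<bullet> ?m" for x
    using m0 by (auto simp: C_def p_def zero_less_mult_iff)
  have "connected C"
    unfolding C_def by (rule connected_sphere_upper_set[OF dim p]) auto
  have CS: "C \<subseteq> sphere 0 1" by (auto simp: C_def)
  have cu: "continuous_on (sphere 0 1) u" by (rule C1_sphere_continuous_on[OF u])
  have op: "openin (top_of_set C) (C \<inter> moving_planes_pos)"
  proof -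
    obtain T where "open T" "moving_planes_pos = sphere 0 1 \<inter> T"
      using openin_moving_planes_pos unfolding openin_open by blast
    then show ?thesis using CS unfolding openin_open by blast
  qed
  define fails where "fails x = {d \<in> sphere 0 1. 0 < x \<bullet> d \<and> u x < u (reflect d x)}" for x
  have fails: "openin (top_of_set (sphere 0 1)) (fails x)" if x: "x \<in> sphere 0 1" for x
  proof -
    have "continuous_on (sphere 0 1) (\<lambda>d. (x \<bullet> d, u (reflect d x)))"
      using reflect_sphere x by (intro continuous_intros continuous_on_compose2[OF cu]) blast
    moreover have "open ({0::real<..} \<times> {u x<..})" by (intro open_Times) auto
    ultimately have "openin (top_of_set (sphere 0 1))
        (sphere 0 1 \<inter> (\<lambda>d. (x \<bullet> d, u (reflect d x))) -` ({0<..} \<times> {u x<..}))"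
      by (rule continuous_openin_preimage_gen)
    moreover have "sphere 0 1 \<inter> (\<lambda>d. (x \<bullet> d, u (reflect d x))) -` ({0<..} \<times> {u x<..}) = fails x"
      by (auto simp: fails_def)
    ultimately show ?thesis by simp
  qed
  have "C - C \<inter> moving_planes_pos = C \<inter> (\<Union>x\<in>sphere 0 1. fails x)"
  proof (intro set_eqI iffI)
    fix d assume d: "d \<in> C - C \<inter> moving_planes_pos"
    then have dS: "d \<in> sphere 0 1" "0 < d \<bullet> ?m" "d \<notin> moving_planes_pos" by (auto simp: C_iff)
    show "d \<in> C \<inter> (\<Union>x\<in>sphere 0 1. fails x)"
    proof (rule ccontr)
      assume "d \<notin> C \<inter> (\<Union>x\<in>sphere 0 1. fails x)"
      then have "u (reflect d x) \<le> u x" if "x \<in> sphere 0 1" "0 < x \<bullet> d" for x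
        using d dS(1) that by (force simp: fails_def)
      then have "u (reflect d x) = u x" if "x \<in> sphere 0 1" for x
        using moving_planes_dichotomy[OF mono dS(1) _ dS(3) that] by blast
      then have "(LINT x|sphere_measure. (u x - u (reflect d x)) * (x \<bullet> d)) = (LINT x|(sphere_measure :: 'a measure). 0)"
        by (intro Bochner_Integration.integral_cong) auto
      then have "2 * (?m \<bullet> d) = 0"
        using sphere_moment_inner[OF dS(1)] by simp
      then show False using dS(2) by (simp add: inner_commute)
    qed
  next
    fix d assume "d \<in> C \<inter> (\<Union>x\<in>sphere 0 1. fails x)"
    then show "d \<in> C - C \<inter> moving_planes_pos"
      by (force simp: fails_def moving_planes_pos_def)
  qed
  moreover have "openin (top_of_set C) (C \<inter> (\<Union>x\<in>sphere 0 1. fails x))"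
  proof -
    have "openin (top_of_set (sphere 0 1)) (\<Union>x\<in>sphere 0 1. fails x)"
      using fails by blast
    then obtain T where "open T" "(\<Union>x\<in>sphere 0 1. fails x) = sphere 0 1 \<inter> T"
      unfolding openin_open by blast
    then show ?thesis using CS unfolding openin_open by blast
  qed
  ultimately have "closedin (top_of_set C) (C \<inter> moving_planes_pos)"
    by (simp add: closedin_def)
  then have "C \<inter> moving_planes_pos = {} \<or> C \<inter> moving_planes_pos = C"
    using \<open>connected C\<close> op unfolding connected_clopen by blast
  moreover have "e \<in> C"
    using e sphere_moment_pos[OF e] by (simp add: C_iff moving_planes_pos_def inner_commute)
  moreover have "d \<in> C" using d by (simp add: C_iff)
  ultimately show ?thesis using e by blast
qed

text \<open>Any two points of the sphere are exchanged by a reflection.\<close>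

lemma increasing_along_moment:
  assumes mono: "\<And>x y. x \<in> sphere 0 1 \<Longrightarrow> y \<in> sphere 0 1 \<Longrightarrow> u y \<le> u x \<Longrightarrow> f y \<le> f x"
    and e: "e \<in> moving_planes_pos" and x: "x \<in> sphere 0 1" and y: "y \<in> sphere 0 1"
    and xy: "y \<bullet> sphere_moment < x \<bullet> sphere_moment"
  shows "u y < u x"
proof -
  define r where "r = norm (x - y)"
  have r: "r > 0" using xy by (auto simp: r_def)
  define d where "d = (x - y) /\<^sub>R r"
  have d: "d \<in> sphere 0 1" using r by (simp add: d_def r_def)
  have "0 < d \<bullet> sphere_moment" using xy r by (simp add: d_def inner_diff_left)
  then have dpos: "d \<in> moving_planes_pos" using moving_planes[OF mono e d] by blast
  have r2: "r\<^sup>2 = 2 - 2 * (x \<bullet> y)" unfolding r_def by (rule sphere_dist_inner[OF x y])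
  have xd: "x \<bullet> d = r / 2"
    using r r2 by (simp add: d_def inner_diff_right inner_self_sphere[OF x] field_simps power2_eq_square)
  have "reflect d x = y"
    using r by (simp add: reflect_def xd) (simp add: d_def)
  moreover have "0 < x \<bullet> d" using r xd by simp
  ultimately show ?thesis using dpos x unfolding moving_planes_pos_def by auto
qed

end

section \<open>From monotonicity to a cap\<close>

text \<open>Away from \<open>p\<close> and \<open>- p\<close> there is a great circle from
  \<open>x\<close> along which the inner product with \<open>p\<close> grows at a positive rate.
  Used with \<open>- p\<close>, it yields points below the level.\<close>

lemma open_in_sphere_not_in_level:
  fixes p :: "'a::euclidean_space"
  assumes p: "p \<in> sphere 0 1" and V: "openin (top_of_set (sphere 0 1)) V" and x: "x \<in> V"
    and xp: "\<bar>x \<bullet> p\<bar> < 1"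
  obtains y where "y \<in> V" "x \<bullet> p < y \<bullet> p"
proof -
  have xS: "x \<in> sphere 0 1" using V x openin_imp_subset by blast
  obtain T where T: "open T" "V = sphere 0 1 \<inter> T" using V unfolding openin_open by blast
  obtain \<tau> r where \<tau>: "\<tau> \<in> sphere 0 1" "x \<bullet> \<tau> = 0" "0 < r" "\<tau> \<bullet> p = r"
    using tangent_direction[OF p xS xp] by metis
  define q where "q s = cos s *\<^sub>R x + sin s *\<^sub>R \<tau>" for s :: real
  have q: "q s \<in> sphere 0 1" for s unfolding q_def by (rule great_circle_in_sphere[OF xS \<tau>(1,2)])
  have q0: "q 0 = x" by (simp add: q_def)
  have dq: "((\<lambda>s. q s \<bullet> p) has_real_derivative r) (at 0)"
    unfolding q_def inner_add_left by (auto intro!: derivative_eq_intros simp: \<tau>(4))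
  obtain d1 where d1: "d1 > 0" "\<And>s. 0 < s \<Longrightarrow> s < d1 \<Longrightarrow> x \<bullet> p < q s \<bullet> p"
    using DERIV_pos_inc_right[OF dq \<tau>(3)] by (auto simp: q0)
  have "isCont q 0" unfolding q_def by (intro continuous_intros)
  then have "(q \<longlongrightarrow> x) (at 0)" by (simp add: isCont_def q0)
  moreover have "x \<in> T" using x T by blast
  ultimately have "eventually (\<lambda>s. q s \<in> T) (at 0)"
    using T(1) topological_tendstoD by blast
  then obtain d2 where d2: "d2 > 0" "\<And>s. s \<noteq> 0 \<Longrightarrow> \<bar>s\<bar> < d2 \<Longrightarrow> q s \<in> T"
    by (auto simp: eventually_at)
  define s where "s = min d1 d2 / 2"
  have "0 < s" "s < d1" "s < d2" using d1 d2 by (auto simp: s_def)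
  then show thesis
    using that[of "q s"] d1(2)[of s] d2(2)[of s] q[of s] T(2) by auto
qed

lemma geodesic_ball_eq_cap:
  assumes p: "p \<in> sphere 0 1" and c: "- 1 < c" "c < 1"
  shows "geodesic_ball p (arccos c) = {x \<in> sphere 0 1. c < x \<bullet> p}"
proof -
  have "arccos (p \<bullet> x) < arccos c \<longleftrightarrow> c < x \<bullet> p" if x: "x \<in> sphere 0 1" for x
  proof -
    have "\<bar>x \<bullet> p\<bar> \<le> 1" using Cauchy_Schwarz_ineq2[of x p] x p by simp
    then show ?thesis using c by (simp add: arccos_less_mono inner_commute)
  qed
  then show ?thesis by (auto simp: geodesic_ball_def sphere_dist_def simp del: mem_sphere_0)
qed

text \<open>Only the level \<open>c\<close> itself is in doubt. If \<open>V\<close> contained a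
  point of it, it would also contain points below it, which belong to \<open>V'\<close>.\<close>

lemma open_eq_cap:
  fixes p :: "'a::euclidean_space"
  assumes p: "p \<in> sphere 0 1" and c: "- 1 < c" "c < 1"
    and V: "openin (top_of_set (sphere 0 1)) V" and disj: "V \<inter> V' = {}"
    and upper: "{x \<in> sphere 0 1. c < x \<bullet> p} \<subseteq> V" and lower: "{x \<in> sphere 0 1. x \<bullet> p < c} \<subseteq> V'"
  shows "V = {x \<in> sphere 0 1. c < x \<bullet> p}"
proof
  show "V \<subseteq> {x \<in> sphere 0 1. c < x \<bullet> p}"
  proof
    fix x assume x: "x \<in> V"
    have VS: "V \<subseteq> sphere 0 1" using V openin_imp_subset by blast
    have "\<not> x \<bullet> p < c" using x VS disj lower by blast
    moreover have "x \<bullet> p \<noteq> c"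
    proof
      assume xp: "x \<bullet> p = c"
      have "- p \<in> sphere 0 1" "\<bar>x \<bullet> (- p)\<bar> < 1" using p c xp by auto
      then obtain y where y: "y \<in> V" "x \<bullet> (- p) < y \<bullet> (- p)"
        using open_in_sphere_not_in_level[OF _ V x] by metis
      then have "y \<in> {x \<in> sphere 0 1. x \<bullet> p < c}" using VS xp by auto
      then have "y \<in> V'" using lower by blast
      then show False using y disj by blast
    qed
    ultimately show "x \<in> {x \<in> sphere 0 1. c < x \<bullet> p}" using x VS by auto
  qed
qed (rule upper)

lemma connected_subset_open_cover:
  assumes "connected L" "openin (top_of_set S) U" "openin (top_of_set S) V" "U \<inter> V = {}"
    "L \<subseteq> U \<union> V"
  shows "L \<subseteq> U \<or> L \<subseteq> V"
proof -
  obtain T1 T2 where T: "open T1" "open T2" "U = S \<inter> T1" "V = S \<inter> T2"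
    using assms(2,3) unfolding openin_open by blast
  then have "T1 \<inter> L = {} \<or> T2 \<inter> L = {}"
    using connectedD[OF assms(1) T(1,2)] assms(4,5) by blast
  then show ?thesis using T assms(5) by blast
qed

theorem theorem1p1:
  fixes \<Omega> \<Omega>m :: "('a::euclidean_space \<times> real) set"
    and \<alpha> \<gamma> :: real
    and u :: "'a \<times> real \<Rightarrow> real"
  assumes "DIM('a) \<ge> 2"
    and "sphere_domain \<Omega>"
    and "\<Omega>m = sphere 0 1 - closure \<Omega>"
    and "\<Omega>m \<noteq> {}"
    and "0 < \<alpha>" "\<alpha> < 1"
    and "C2_holder_boundary \<alpha> \<Omega>"
    and "\<gamma> = measure sphere_measure \<Omega> / measure sphere_measure \<Omega>m"
    and "\<exists>e\<in>sphere 0 1. \<forall>x\<in>sphere_frontier \<Omega>. e \<bullet> x > 0"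
    and "C1_sphere u"
    and "weak_neg_laplacian_eq u (\<lambda>x. indicator \<Omega> x - \<gamma> * indicator \<Omega>m x)"
    and "\<forall>x\<in>sphere_frontier \<Omega>. u x = 0"
  shows "\<exists>p\<in>sphere 0 1. \<exists>r. 0 < r \<and> r < pi \<and> \<Omega> = geodesic_ball p r"
proof -
  note u = assms(10)
  have dim: "DIM('a \<times> real) \<ge> 2" using assms(1) by simp
  let ?S = "sphere (0 :: 'a \<times> real) 1"
  define f where "f x = indicator \<Omega> x - \<gamma> * indicator \<Omega>m x" for x
  have eq: "weak_neg_laplacian_eq u f" using assms(11) by (simp add: f_def[abs_def])
  have op: "openin (top_of_set ?S) \<Omega>" and ne: "\<Omega> \<noteq> {}"
    using assms(2) by (auto simp: sphere_domain_def)
  have \<Omega>S: "\<Omega> \<subseteq> ?S" using op openin_imp_subset by blast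
  have opm: "openin (top_of_set ?S) \<Omega>m"
  proof -
    have "\<Omega>m = ?S \<inter> - closure \<Omega>" using assms(3) by blast
    moreover have "open (- closure \<Omega>)" by (rule open_Compl[OF closed_closure])
    ultimately show ?thesis unfolding openin_open by blast
  qed
  have \<Omega>mS: "\<Omega>m \<subseteq> ?S" using assms(3) by blast
  have disj: "\<Omega> \<inter> \<Omega>m = {}" using assms(3) closure_subset by blast
  have clS: "closure \<Omega> \<subseteq> ?S" using \<Omega>S by (rule closure_minimal) simp
  have fr: "sphere_frontier \<Omega> = closure \<Omega> - \<Omega>"
    by (simp only: frontier_of_def closure_of_subtopology euclidean_closure_of
        interior_of_openin[OF op] Int_absorb1[OF \<Omega>S] Int_absorb1[OF clS])
  define F where "F = sphere_frontier \<Omega>"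
  have F: "F = closure \<Omega> - \<Omega>" by (simp add: F_def fr)
  have cases_S: "x \<in> \<Omega> \<or> x \<in> F \<or> x \<in> \<Omega>m" if "x \<in> ?S" for x
    using that F assms(3) by blast
  have F_disj: "x \<notin> \<Omega>" "x \<notin> \<Omega>m" if "x \<in> F" for x
    using that F assms(3) by auto
  have uF: "u x = 0" if "x \<in> F" for x using assms(12) that by (simp add: F_def)
  \<comment> \<open>\<open>\<Omega>\<close> is open and disjoint from \<open>\<Omega>m\<close>, so
    it misses the closure as well. This supplies the boundary values for the maximum principle on
    \<open>\<Omega>m\<close>.\<close>
  have bdm: "x \<in> F" if "x \<in> closure \<Omega>m" "x \<notin> \<Omega>m" for x
  proof -
    obtain T where T: "open T" "\<Omega> = ?S \<inter> T" using op unfolding openin_open by blast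
    have "\<Omega>m \<inter> T = {}" using disj T \<Omega>mS by blast
    then have "closure \<Omega>m \<inter> T = {}" using open_Int_closure_eq_empty[OF T(1)] by blast
    moreover have "x \<in> ?S"
      using that(1) closure_minimal[OF \<Omega>mS] by auto
    ultimately show ?thesis using cases_S[of x] that T by blast
  qed
  have \<gamma>: "0 \<le> \<gamma>" by (simp add: assms(8))
  \<comment> \<open>The value \<open>0\<close> on the boundary, where also \<open>u = 0\<close>,
    makes \<open>f\<close> monotone in \<open>u\<close> at every point and not just almost
    everywhere.\<close>
  have f_vals: "x \<in> \<Omega> \<Longrightarrow> f x = 1" "x \<in> F \<Longrightarrow> f x = 0" "x \<in> \<Omega>m \<Longrightarrow> f x = - \<gamma>" for x
    using disj F_disj by (auto simp: f_def indicator_def)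
  have f_meas: "f \<in> borel_measurable sphere_measure"
    unfolding f_def using openin_sphere_measurable[OF op] openin_sphere_measurable[OF opm] by measurable
  have f_bound: "\<bar>f x\<bar> \<le> 1 + \<gamma>" for x
    using \<gamma> by (auto simp: f_def indicator_def)
  have weak: "(LINT x|sphere_measure. sphere_gradient u x \<bullet> sphere_gradient \<phi> x) =
        (LINT x|sphere_measure. f x * \<phi> x)" if "C1_sphere \<phi>" for \<phi>
    using eq that unfolding weak_neg_laplacian_eq_def by blast
  have weak_\<Omega>: "(LINT x|sphere_measure. sphere_gradient u x \<bullet> sphere_gradient \<phi> x) =
        (LINT x|sphere_measure. \<phi> x)" if "C1_sphere \<phi>" "\<forall>x\<in>?S - \<Omega>. \<phi> x = 0" for \<phi>
    unfolding weak[OF that(1)] by (intro Bochner_Integration.integral_cong refl)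
      (metis DiffI f_vals(1) mult_1 mult_zero_right space_sphere_measure that(2))
  have weak_\<Omega>m: "(LINT x|sphere_measure. sphere_gradient u x \<bullet> sphere_gradient \<phi> x) =
        - \<gamma> * (LINT x|sphere_measure. \<phi> x)" if "C1_sphere \<phi>" "\<forall>x\<in>?S - \<Omega>m. \<phi> x = 0" for \<phi>
  proof -
    have "(LINT x|sphere_measure. f x * \<phi> x) = (LINT x|sphere_measure. - \<gamma> * \<phi> x)"
      by (intro Bochner_Integration.integral_cong refl)
        (metis DiffI f_vals(3) mult_zero_right space_sphere_measure that(2))
    then show ?thesis using weak[OF that(1)] by simp
  qed
  note neg = C1_sphere_with_diff[OF C1_sphere_with_const[of 0] C1_sphere_withI[OF u]]
  have weak_neg: "(LINT x|sphere_measure. sphere_gradient (\<lambda>x. 0 - u x) x \<bullet> sphere_gradient \<phi> x) =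
      - (LINT x|sphere_measure. sphere_gradient u x \<bullet> sphere_gradient \<phi> x)" for \<phi>
  proof -
    have "(LINT x|sphere_measure. sphere_gradient (\<lambda>x. 0 - u x) x \<bullet> sphere_gradient \<phi> x) =
       (LINT x|sphere_measure. - (sphere_gradient u x \<bullet> sphere_gradient \<phi> x))"
    proof (intro Bochner_Integration.integral_cong refl)
      fix x :: "'a \<times> real" assume "x \<in> space sphere_measure"
      then have x: "x \<in> ?S" by simp
      show "sphere_gradient (\<lambda>x. 0 - u x) x \<bullet> sphere_gradient \<phi> x
          = - (sphere_gradient u x \<bullet> sphere_gradient \<phi> x)"
        unfolding C1_sphere_withD(2)[OF neg x] by simp
    qed
    then show ?thesis by simp
  qed
  have int_nonneg: "0 \<le> (LINT x|sphere_measure. \<phi> x)" if "\<forall>x\<in>?S. 0 \<le> \<phi> x" for \<phi> :: "'a \<times> real \<Rightarrow> real"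
    using that by (intro integral_nonneg_AE AE_I2) auto
  obtain x\<Omega> where x\<Omega>: "x\<Omega> \<in> \<Omega>" using ne by blast
  obtain xm where xm: "xm \<in> \<Omega>m" using assms(4) by blast
  have nonneg: "0 \<le> u x" if "x \<in> \<Omega>" for x
  proof (rule weak_maximum_principle[OF dim op _ _ _ _ that])
    show "xm \<in> ?S" "xm \<notin> \<Omega>" using xm \<Omega>mS disj by auto
    show "weakly_superharmonic_on \<Omega> u"
      unfolding weakly_superharmonic_on_def using u weak_\<Omega> int_nonneg by simp
  qed (use uF F in auto)
  have nonpos: "0 \<le> 0 - u x" if "x \<in> \<Omega>m" for x
  proof (rule weak_maximum_principle[OF dim opm, where ?x0.0 = x\<Omega> and W = "\<lambda>x. 0 - u x"])
    show "x\<Omega> \<in> ?S" "x\<Omega> \<notin> \<Omega>m" using x\<Omega> \<Omega>S disj by auto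
    show "weakly_superharmonic_on \<Omega>m (\<lambda>x. 0 - u x)"
      unfolding weakly_superharmonic_on_def weak_neg
      using C1_sphere_withD(1)[OF neg] weak_\<Omega>m int_nonneg \<gamma> by simp
  qed (use uF bdm that in auto)
  have pos: "0 < u x" if "x \<in> \<Omega>" for x
    by (rule strict_supersolution_pos[OF dim op u nonneg zero_less_one _ that]) (simp_all add: weak_\<Omega>)
  have neg_strict: "0 < 0 - u x" if "x \<in> \<Omega>m" "0 < \<gamma>" for x
  proof (rule strict_supersolution_pos[OF dim opm C1_sphere_withD(1)[OF neg] _ that(2) _ that(1)])
    fix \<phi> :: "'a \<times> real \<Rightarrow> real"
    assume \<phi>: "C1_sphere \<phi>" "\<forall>x\<in>?S - \<Omega>m. \<phi> x = 0"
    show "\<gamma> * (LINT x|sphere_measure. \<phi> x)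
        \<le> (LINT x|sphere_measure. sphere_gradient (\<lambda>x. 0 - u x) x \<bullet> sphere_gradient \<phi> x)"
      unfolding weak_neg weak_\<Omega>m[OF \<phi>] by simp
  qed (rule nonpos)
  have mono: "f y \<le> f x" if xy: "x \<in> ?S" "y \<in> ?S" "u y \<le> u x" for x y
  proof -
    have fle: "f y \<le> 0" if "u y \<le> 0"
      using cases_S[OF xy(2)] pos[of y] that f_vals[of y] \<gamma> by auto
    consider "x \<in> \<Omega>" | "x \<in> F" | "x \<in> \<Omega>m" using cases_S[OF xy(1)] by blast
    then show ?thesis
    proof cases
      case 1
      then show ?thesis using cases_S[OF xy(2)] f_vals[of x] f_vals[of y] \<gamma> by auto
    next
      case 2
      then show ?thesis using fle uF[of x] xy f_vals by auto
    next
      case 3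
      show ?thesis
      \<comment> \<open>For \<open>\<gamma> = 0\<close> there is no strict sign of \<open>u\<close>
        on \<open>\<Omega>m\<close>, but then \<open>f x = 0\<close> and \<open>f y \<le> 0\<close>
        suffices.\<close>
      proof (cases "\<gamma> = 0")
        case True
        then show ?thesis using fle nonpos[OF 3] xy f_vals(3)[OF 3] by simp
      next
        case False
        then have "u y < 0" using neg_strict[OF 3] \<gamma> xy by simp
        then have "y \<in> \<Omega>m" using cases_S[OF xy(2)] pos[of y] uF[of y] by auto
        then show ?thesis using f_vals(3) 3 by simp
      qed
    qed
  qed
  have split: "L \<subseteq> \<Omega> \<or> L \<subseteq> \<Omega>m" if "connected L" "L \<subseteq> ?S" "L \<inter> F = {}" for L
    by (rule connected_subset_open_cover[OF that(1) op opm disj]) (use cases_S that in blast)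
  note start = moving_planes_start[OF dim u f_meas f_bound eq mono]
  obtain e where e: "e \<in> ?S" "\<And>x. x \<in> F \<Longrightarrow> e \<bullet> x > 0"
    using assms(9) unfolding F_def by blast
  \<comment> \<open>The closed hemisphere opposite to \<open>e\<close> contains no boundary point,
    so it lies on one side. There \<open>f\<close> is constant and takes an extreme value: the least
    one makes \<open>e\<close> a start, the greatest one \<open>- e\<close>.\<close>
  define L where "L = {x \<in> ?S. 0 \<le> x \<bullet> (- e)}"
  have e': "- e \<in> ?S" using e by simp
  have "L \<subseteq> \<Omega> \<or> L \<subseteq> \<Omega>m"
  proof (rule split)
    show "connected L" unfolding L_def by (rule connected_sphere_upper_set[OF dim e']) auto
    show "L \<inter> F = {}" using e(2) by (force simp: L_def inner_commute)
  qed (auto simp: L_def)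
  then have "\<exists>d. d \<in> moving_planes_pos u"
  proof
    assume L: "L \<subseteq> \<Omega>m"
    have fR: "f (reflect e x) = - \<gamma>" if "x \<in> ?S" "0 < x \<bullet> e" for x
    proof -
      have "reflect e x \<in> L"
        using reflect_sphere[OF e(1) that(1)] reflect_inner_normal[OF e(1), of x] that(2)
        by (simp add: L_def)
      then show ?thesis using L f_vals(3) by blast
    qed
    have "e \<in> moving_planes_pos u"
    proof (rule start[OF _ _ _ e(1) _ op ne])
      show "f (reflect e x) \<le> f x" if "x \<in> ?S" "0 < x \<bullet> e" for x
        using fR[OF that] cases_S[OF that(1)] f_vals[of x] \<gamma> by auto
      show "x \<bullet> e \<noteq> 0 \<and> f (reflect e x) \<noteq> f x" if "x \<in> \<Omega>" for x
      proof -
        have "x \<in> ?S" "x \<notin> L" using that L \<Omega>S disj by blast+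
        then have x: "x \<in> ?S" "0 < x \<bullet> e" by (simp_all add: L_def)
        then show ?thesis using fR[OF x] f_vals(1)[OF that] \<gamma> by simp
      qed
    qed
    then show ?thesis by blast
  next
    assume L: "L \<subseteq> \<Omega>"
    have "- e \<in> moving_planes_pos u"
    proof (rule start[OF _ _ _ e' _ opm assms(4)])
      show "f (reflect (- e) x) \<le> f x" if "x \<in> ?S" "0 < x \<bullet> (- e)" for x
      proof -
        have "x \<in> L" using that by (simp add: L_def)
        then have "f x = 1" using L f_vals(1) by blast
        then show ?thesis
          using cases_S[OF reflect_sphere[OF e' that(1)]] f_vals[of "reflect (- e) x"] \<gamma> by auto
      qed
      show "x \<bullet> (- e) \<noteq> 0 \<and> f (reflect (- e) x) \<noteq> f x" if "x \<in> \<Omega>m" for x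
      proof -
        have "x \<in> ?S" "x \<notin> L" using that L \<Omega>mS disj by blast+
        then have x: "x \<in> ?S" "x \<bullet> (- e) < 0" by (simp_all add: L_def)
        then have "reflect (- e) x \<in> L"
          using reflect_sphere[OF e' x(1)] reflect_inner_normal[OF e', of x] by (simp add: L_def)
        then have "f (reflect (- e) x) = 1" using L f_vals(1) by blast
        then show ?thesis using x f_vals(3)[OF that] \<gamma> by simp
      qed
    qed
    then show ?thesis by blast
  qed
  then obtain d where d: "d \<in> moving_planes_pos u" by blast
  define m where "m = sphere_moment u"
  have incr: "u y < u x" if "x \<in> ?S" "y \<in> ?S" "y \<bullet> m < x \<bullet> m" for x y
    using increasing_along_moment[OF dim u f_meas f_bound eq mono d] that unfolding m_def by blast
  have m0: "m \<noteq> 0"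
    using sphere_moment_pos[OF dim u f_meas f_bound eq d] by (auto simp: m_def)
  define p where "p = m /\<^sub>R norm m"
  have p: "p \<in> ?S" "- p \<in> ?S" using m0 by (auto simp: p_def)
  have incr_p: "u y < u x" if "x \<in> ?S" "y \<in> ?S" "y \<bullet> p < x \<bullet> p" for x y
    using incr[OF that(1,2)] that(3) m0 by (simp add: p_def)
  have "F \<noteq> {}"
  proof
    assume "F = {}"
    then have "?S \<subseteq> \<Omega> \<or> ?S \<subseteq> \<Omega>m"
      using connected_sphere[OF dim] by (intro split) auto
    then show False using x\<Omega> xm \<Omega>S \<Omega>mS disj by blast
  qed
  then obtain z where z: "z \<in> F" by blast
  have zS: "z \<in> ?S" using z F clS by blast
  define c where "c = z \<bullet> p"
  have Fc: "x \<bullet> p = c" if "x \<in> F" for x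
  proof -
    have "x \<in> ?S" using that F clS by blast
    then show ?thesis
      using incr_p[of x z] incr_p[of z x] zS uF[OF that] uF[OF z] unfolding c_def by fastforce
  qed
  define A where "A = {x \<in> ?S. c < x \<bullet> p}"
  \<comment> \<open>The lower cap, written as an upper cap for \<open>- p\<close> so that its
    connectedness follows in the same way.\<close>
  define B where "B = {x \<in> ?S. - c < x \<bullet> (- p)}"
  have A: "A \<subseteq> \<Omega> \<or> A \<subseteq> \<Omega>m"
  proof (rule split)
    show "connected A" unfolding A_def by (rule connected_sphere_upper_set[OF dim p(1)]) auto
    show "A \<subseteq> ?S" unfolding A_def by blast
    show "A \<inter> F = {}" using Fc by (force simp: A_def simp del: split_paired_All)
  qed
  have B: "B \<subseteq> \<Omega> \<or> B \<subseteq> \<Omega>m"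
  proof (rule split)
    show "connected B" unfolding B_def by (rule connected_sphere_upper_set[OF dim p(2)]) auto
    show "B \<subseteq> ?S" unfolding B_def by blast
    show "B \<inter> F = {}" using Fc by (force simp: B_def simp del: split_paired_All)
  qed
  have zn: "z \<notin> \<Omega>" "z \<notin> \<Omega>m" using F_disj[OF z] by auto
  \<comment> \<open>For \<open>c = 1\<close> the boundary point \<open>z\<close> is \<open>p\<close>
    itself and \<open>B\<close> is the sphere without it, which would contain points of both
    \<open>\<Omega>\<close> and \<open>\<Omega>m\<close>.\<close>
  have c1: "c < 1"
  proof (rule ccontr)
    assume "\<not> c < 1"
    then have "c = 1" using sphere_inner_le_1[OF zS p(1)] by (simp add: c_def)
    then have "x \<in> B" if "x \<in> ?S" "x \<noteq> z" for x
      using that sphere_inner_le_1[OF that(1) p(1)] sphere_inner_eq_1[OF that(1) p(1)]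
        sphere_inner_eq_1[OF zS p(1)] by (simp add: B_def c_def order_less_le) blast
    then have "x\<Omega> \<in> B" "xm \<in> B" using x\<Omega> xm zn \<Omega>S \<Omega>mS by blast+
    then show False using B x\<Omega> xm disj by blast
  qed
  have c0: "- 1 < c"
  proof (rule ccontr)
    assume "\<not> - 1 < c"
    then have zp: "z \<bullet> (- p) = 1" using sphere_inner_le_1[OF zS p(2)] by (simp add: c_def)
    have "x \<in> A" if "x \<in> ?S" "x \<noteq> z" for x
    proof -
      have "x \<bullet> (- p) \<noteq> 1"
        using that sphere_inner_eq_1[OF that(1) p(2)] sphere_inner_eq_1[OF zS p(2) zp] by blast
      then have "x \<bullet> (- p) < z \<bullet> (- p)"
        using sphere_inner_le_1[OF that(1) p(2)] zp by linarith
      then show ?thesis using that(1) by (simp add: A_def c_def)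
    qed
    then have "x\<Omega> \<in> A" "xm \<in> A" using x\<Omega> xm zn \<Omega>S \<Omega>mS by blast+
    then show False using A x\<Omega> xm disj by blast
  qed
  \<comment> \<open>No nonempty open set fits inside the level \<open>c\<close>. Applied to
    \<open>\<Omega>\<close> and \<open>\<Omega>m\<close>, this shows that the two caps lie on
    different sides.\<close>
  have meets: "V \<inter> A \<noteq> {} \<or> V \<inter> B \<noteq> {}" if V: "openin (top_of_set ?S) V" and x: "x \<in> V" for V x
  proof (cases "x \<bullet> p = c")
    case True
    then have "\<bar>x \<bullet> p\<bar> < 1" using c0 c1 by simp
    then obtain y where "y \<in> V" "x \<bullet> p < y \<bullet> p"
      using open_in_sphere_not_in_level[OF p(1) V x] by blast
    then show ?thesis using True V openin_imp_subset by (force simp: A_def)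
  next
    case False
    then have "x \<in> A \<or> x \<in> B" using x V openin_imp_subset by (force simp: A_def B_def)
    then show ?thesis using x by blast
  qed
  have B_eq: "B = {x \<in> ?S. x \<bullet> p < c}" and A_eq: "A = {x \<in> ?S. x \<bullet> (- p) < - c}"
    by (auto simp: A_def B_def)
  from A B consider "A \<subseteq> \<Omega>" "B \<subseteq> \<Omega>m" | "A \<subseteq> \<Omega>m" "B \<subseteq> \<Omega>"
    using meets[OF op x\<Omega>] meets[OF opm xm] disj by blast
  then show ?thesis
  proof cases
    case 1
    then have "\<Omega> = {x \<in> ?S. c < x \<bullet> p}"
      unfolding A_def B_eq by (intro open_eq_cap[OF p(1) c0 c1 op disj])
    then have "\<Omega> = geodesic_ball p (arccos c)"
      by (simp only: geodesic_ball_eq_cap[OF p(1) c0 c1])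
    then show ?thesis using p(1) arccos_lt_bounded[OF c0 c1] by blast
  next
    case 2
    have c': "- 1 < - c" "- c < 1" using c0 c1 by auto
    have "\<Omega> = {x \<in> ?S. - c < x \<bullet> (- p)}"
      using 2 unfolding A_eq B_def by (intro open_eq_cap[OF p(2) c' op disj])
    then have "\<Omega> = geodesic_ball (- p) (arccos (- c))"
      by (simp only: geodesic_ball_eq_cap[OF p(2) c'])
    then show ?thesis using p(2) arccos_lt_bounded[OF c'] by blast
  qed
qed

end
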